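(* Let $pp(n)$ denote the number of plane partitions of $n$, i.e. the coefficients in $\prod_{m=1}^{\infty}(1-q^m)^{-m}=\sum_{n\geq 0} pp(n)\,q^n$. Then the sequence $\left\{\sqrt[n]{pp(n)}\right\}_{n\geq 6}$ is strictly decreasing.
   Context: A plane partition of $n$ is an array $(\pi_{ij})_{i,j\geq1}$ of nonnegative integers, weakly decreasing along rows and columns, with $\sum_{i,j}\pi_{ij}=n$. *)

theory Defs
  imports
    "HOL-Analysis.Analysis"
    "HOL-Computational_Algebra.Formal_Power_Series"
begin

text \<open>
  Rows and columns are indexed from 0 rather than from 1. The support is required to be
  finite explicitly, because a sum over an infinite set is 0 in HOL; for natural number
  entries this is exactly the convergence of the sum of all entries.
\<close>

definition plane_partition_of :: "(nat \<Rightarrow> nat \<Rightarrow> nat) \<Rightarrow> nat \<Rightarrow> bool" where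
  "plane_partition_of p n \<longleftrightarrow>
     (\<forall>i. antimono (\<lambda>j. p i j)) \<and> (\<forall>j. antimono (\<lambda>i. p i j)) \<and>
     finite {(i, j). p i j \<noteq> 0} \<and>
     (\<Sum>(i, j) \<in> {(i, j). p i j \<noteq> 0}. p i j) = n"

definition pp :: "nat \<Rightarrow> nat" where
  "pp n = card {p. plane_partition_of p n}"

text \<open>The set counted by \<^const>\<open>pp\<close> is finite, so its cardinality is meaningful.\<close>

lemma plane_partition_of_entry_le:
  assumes "plane_partition_of p n"
  shows "p i j \<le> n"
proof (cases "p i j = 0")
  case False
  let ?S = "{(i, j). p i j \<noteq> 0}"
  have "(case (i, j) of (i, j) \<Rightarrow> p i j) \<le> (\<Sum>(i, j) \<in> ?S. p i j)"
    using assms False unfolding plane_partition_of_def by (intro member_le_sum) auto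
  then show ?thesis
    using assms unfolding plane_partition_of_def by simp
qed simp

lemma plane_partition_of_support:
  assumes "plane_partition_of p n" "p i j \<noteq> 0"
  shows "i < n" "j < n"
proof -
  let ?S = "{(i, j). p i j \<noteq> 0}"
  have row: "\<And>i. antimono (\<lambda>j. p i j)" and col: "\<And>j. antimono (\<lambda>i. p i j)"
    and fin: "finite ?S" and tot: "(\<Sum>(i, j) \<in> ?S. p i j) = n"
    using assms(1) unfolding plane_partition_of_def by auto
  have bound: "card A \<le> n" if "A \<subseteq> ?S" for A
  proof -
    have "card A \<le> card ?S"
      using fin that by (rule card_mono)
    also have "\<dots> = (\<Sum>x \<in> ?S. 1)"
      by simp
    also have "\<dots> \<le> (\<Sum>(i, j) \<in> ?S. p i j)"
      by (rule sum_mono) auto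
    finally show ?thesis
      using tot by simp
  qed
  have "(\<lambda>k. (k, j)) ` {..i} \<subseteq> ?S"
  proof -
    have "p k j \<noteq> 0" if "k \<le> i" for k
      using antimonoD[OF col[of j] that] assms(2) by simp
    then show ?thesis
      by auto
  qed
  from bound[OF this] show "i < n"
    by (simp add: card_image inj_on_def)
  have "(\<lambda>k. (i, k)) ` {..j} \<subseteq> ?S"
  proof -
    have "p i k \<noteq> 0" if "k \<le> j" for k
      using antimonoD[OF row[of i] that] assms(2) by simp
    then show ?thesis
      by auto
  qed
  from bound[OF this] show "j < n"
    by (simp add: card_image inj_on_def)
qed

lemma finite_plane_partitions: "finite {p. plane_partition_of p n}"
proof (rule finite_subset)
  let ?F = "{f. (\<forall>x. (x \<in> {..<n} \<times> {..<n} \<longrightarrow> f x \<in> {..n}) \<and>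
                     (x \<notin> {..<n} \<times> {..<n} \<longrightarrow> f x = 0))}"
  show "finite (curry ` ?F)"
    by (intro finite_imageI finite_set_of_finite_funs) auto
  show "{p. plane_partition_of p n} \<subseteq> curry ` ?F"
  proof
    fix p assume "p \<in> {p. plane_partition_of p n}"
    then have p: "plane_partition_of p n"
      by simp
    have "p i j = 0" if "\<not> (i < n \<and> j < n)" for i j
      using plane_partition_of_support[OF p, of i j] that by blast
    then have "case_prod p \<in> ?F"
      using plane_partition_of_entry_le[OF p] by auto
    then show "p \<in> curry ` ?F"
      by (rule rev_image_eqI) simp
  qed
qed

end

theory Submission
  imports Defs
begin

text \<open>
  \<^bold>\<open>Product formula.\<close> The diagonals of a plane partition form a chain of sequences that
  interlace upwards to the main diagonal and downwards after it. Replacing an upper neighbour \<open>h\<close> of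
  two sequences \<open>f, g\<close> by a lower neighbour \<open>k\<close> and a number \<open>m\<close> with
  \<open>|h| + |k| = m + |f| + |g|\<close> (a local form of the Robinson-Schensted-Knuth correspondence) moves all
  descents before all ascents and splits off a geometric series at each exchange; what remains is
  the chain of zero sequences.

  \<^bold>\<open>Monotonicity.\<close> The claim at \<open>n\<close> is \<open>(pp (n + 1) / pp n)\<^sup>n < pp n\<close>. Logarithmic differentiation
  gives \<open>n * pp n = (\<Sum>k. sigma2 k * pp (n - k))\<close>. The analogous recurrence for the third
  differences of \<open>pp\<close> shows that these are nonnegative from index 4 on, so up to a small correction the
  generating function is \<open>G / (1 - X)\<^sup>3\<close> with \<open>G\<close> nonnegative, and \<open>pp (n + 1) / pp n \<le> 1 + l + \<mu> / n\<close> follows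
  from an inequality between iterated partial sums of \<open>sigma2\<close>. The recurrence also yields, by
  induction, \<open>pp n \<ge> exp (1.9 n\<^sup>2\<^sup>/\<^sup>3 - 3.5)\<close>. Together these settle \<open>n \<ge> 200\<close>; below that, the
  inequality propagates from \<open>n = 12\<close> by the log-concavity visible in a table.
\<close>

section \<open>Interlacing sequences and the local toggle bijection\<close>

text \<open>Non-sharp bounds suffice for a simple reason. Asymptotically ln (\<open>pp n\<close>) is
  c n^(2/3) with c = 3 (zeta(3) / 4)^(1/3), about 2.01, while n times the logarithm of the ratio
  \<open>pp (Suc n) / pp n\<close> is only 2c/3 n^(2/3), with 2c/3 about 1.34. Any constant in
  between separates the two; the proof reaches 1.8042 from above and 1.9 from below, and this gap
  governs the choice of the other constants.

  The obstacle is the irregularity of \<open>sigma2\<close>, which is known only to lie between n^2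
  and 2 n^2. Iterated partial sums of it behave like polynomials. They appear once a factor 1 / (1 -
  X)^3 is split off the generating function, and nonnegativity of what remains allows a comparison
  term by term. The threshold 200 comes from the lower-order terms, which almost consume the gap
  there.\<close>

definition interlaces :: "(nat \<Rightarrow> nat) \<Rightarrow> (nat \<Rightarrow> nat) \<Rightarrow> bool" where
  "interlaces f g \<longleftrightarrow> (\<forall>i. g i \<le> f i \<and> f (Suc i) \<le> g i)"

definition psize :: "(nat \<Rightarrow> nat) \<Rightarrow> nat" where
  "psize f = sum f {i. f i \<noteq> 0}"

definition fsupp :: "(nat \<Rightarrow> nat) \<Rightarrow> bool" where
  "fsupp f \<longleftrightarrow> (\<exists>M. \<forall>i\<ge>M. f i = 0)"

lemma psize_eq_sum: "(\<And>i. i \<ge> M \<Longrightarrow> f i = 0) \<Longrightarrow> psize f = sum f {..<M}"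
  unfolding psize_def by (rule sum.mono_neutral_left) (auto intro: ccontr simp: not_less)

lemma psize_zero [simp]: "psize (\<lambda>_. 0) = 0"
  by (simp add: psize_def)

lemma fsupp_interlaces_lower: "interlaces f g \<Longrightarrow> fsupp f \<Longrightarrow> fsupp g"
  unfolding interlaces_def fsupp_def by (metis le_zero_eq)

lemma fsupp_interlaces_upper: "interlaces f g \<Longrightarrow> fsupp g \<Longrightarrow> fsupp f"
  unfolding interlaces_def fsupp_def by (metis le_zero_eq Suc_le_D Suc_le_mono)

lemma psize_interlaces_mono:
  assumes "interlaces f g" "fsupp f" shows "psize g \<le> psize f"
proof -
  obtain M where M: "\<And>i. i \<ge> M \<Longrightarrow> f i = 0"
    using assms(2) unfolding fsupp_def by blast
  have le: "g i \<le> f i" for i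
    using assms(1) by (simp add: interlaces_def)
  have "g i = 0" if "i \<ge> M" for i
    using M[OF that] le[of i] by simp
  then show ?thesis
    using psize_eq_sum[of M f] psize_eq_sum[of M g] M le by (simp add: sum_mono)
qed

text \<open>A common upper neighbour \<open>h\<close> and a common lower neighbour \<open>k\<close>
  of \<open>f\<close> and \<open>g\<close> are constrained alike: \<open>h (Suc i)\<close> and
  \<open>k i\<close> both range over the interval from \<open>max (f (Suc i)) (g (Suc i))\<close> to
  \<open>min (f i) (g i)\<close>. Reflecting this interval turns one into the other. Only
  \<open>h 0\<close> has no upper bound; its excess over \<open>max (f 0) (g 0)\<close> is the free
  number \<open>m\<close>.\<close>

definition toggle :: "(nat \<Rightarrow> nat) \<Rightarrow> (nat \<Rightarrow> nat) \<Rightarrow> nat \<Rightarrow> (nat \<Rightarrow> nat) \<Rightarrow> nat \<Rightarrow> nat" where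
  "toggle f g m k i = (case i of 0 \<Rightarrow> m + max (f 0) (g 0)
     | Suc i \<Rightarrow> max (f (Suc i)) (g (Suc i)) + min (f i) (g i) - k i)"

lemma bij_betw_toggle:
  "bij_betw (\<lambda>(m, k). toggle f g m k) (UNIV \<times> {k. interlaces f k \<and> interlaces g k})
     {h. interlaces h f \<and> interlaces h g}"
proof (rule bij_betw_byWitness[where f' = "\<lambda>h. (h 0 - max (f 0) (g 0),
      \<lambda>i. max (f (Suc i)) (g (Suc i)) + min (f i) (g i) - h (Suc i))"], goal_cases)
  case 1
  then show ?case
  proof (clarsimp simp: toggle_def, rule ext)
    fix k i assume "interlaces f k" "interlaces g k"
    then have "max (f (Suc i)) (g (Suc i)) \<le> k i" "k i \<le> min (f i) (g i)"
      by (auto simp: interlaces_def)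
    then show "max (f (Suc i)) (g (Suc i)) + min (f i) (g i)
       - (max (f (Suc i)) (g (Suc i)) + min (f i) (g i) - k i) = k i"
      by linarith
  qed
next
  case 2
  then show ?case
  proof (clarsimp, rule ext)
    fix h i assume h: "interlaces h f" "interlaces h g"
    show "toggle f g (h 0 - max (f 0) (g 0))
         (\<lambda>i. max (f (Suc i)) (g (Suc i)) + min (f i) (g i) - h (Suc i)) i = h i"
    proof (cases i)
      case (Suc j)
      have "max (f (Suc j)) (g (Suc j)) \<le> h (Suc j)" "h (Suc j) \<le> min (f j) (g j)"
        using h by (auto simp: interlaces_def)
      then show ?thesis
        using Suc by (simp add: toggle_def del: max.bounded_iff min.bounded_iff)
    qed (use h in \<open>auto simp: toggle_def interlaces_def\<close>)
  qed
next
  case 3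
  show ?case
  proof (clarsimp simp: interlaces_def, intro conjI allI, goal_cases)
    case (1 m k i)
    have "max (f (Suc j)) (g (Suc j)) \<le> k j" "k j \<le> min (f j) (g j)" for j
      using 1 by auto
    from this[of "i - 1"] show ?case
      by (cases i) (simp_all add: toggle_def, linarith)
  next
    case (2 m k i)
    have "max (f (Suc j)) (g (Suc j)) \<le> k j" "k j \<le> min (f j) (g j)" for j
      using 2 by auto
    from this[of i] show ?case
      by (simp add: toggle_def) linarith
  next
    case (3 m k i)
    have "max (f (Suc j)) (g (Suc j)) \<le> k j" "k j \<le> min (f j) (g j)" for j
      using 3 by auto
    from this[of "i - 1"] show ?case
      by (cases i) (simp_all add: toggle_def, linarith)
  next
    case (4 m k i)
    have "max (f (Suc j)) (g (Suc j)) \<le> k j" "k j \<le> min (f j) (g j)" for j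
      using 4 by auto
    from this[of i] show ?case
      by (simp add: toggle_def) linarith
  qed
next
  case 4
  show ?case
  proof (clarsimp simp: interlaces_def, intro conjI allI, goal_cases)
    case (1 h i)
    then show ?case
      by (metis (no_types, lifting) diff_le_mono2 max.bounded_iff diff_add_inverse le_diff_conv2 min.cobounded1 order_trans le_diff_conv add_le_mono le_refl add.commute)
  next
    case (2 h i)
    have "max (f (Suc i)) (g (Suc i)) \<le> h (Suc i)" "h (Suc i) \<le> min (f i) (g i)"
      using 2 by auto
    then show ?case
      by linarith
  next
    case (3 h i)
    have "max (f (Suc i)) (g (Suc i)) \<le> h (Suc i)" "h (Suc i) \<le> min (f i) (g i)"
      using 3 by auto
    then show ?case
      by linarith
  next
    case (4 h i)
    have "max (f (Suc i)) (g (Suc i)) \<le> h (Suc i)" "h (Suc i) \<le> min (f i) (g i)"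
      using 4 by auto
    then show ?case
      by linarith
  qed
qed

text \<open>By the reflection, \<open>toggle f g m k (Suc i) + k i\<close> is a maximum at index
  \<open>Suc i\<close> plus a minimum at index \<open>i\<close>. Regrouped by index, maximum and
  minimum add up to \<open>f i + g i\<close>.\<close>

lemma psize_toggle:
  assumes "interlaces f k" "interlaces g k" "fsupp f" "fsupp g"
  shows "psize (toggle f g m k) + psize k = m + psize f + psize g"
proof -
  obtain M1 M2 where "\<And>i. i \<ge> M1 \<Longrightarrow> f i = 0" "\<And>i. i \<ge> M2 \<Longrightarrow> g i = 0"
    using assms(3,4) unfolding fsupp_def by blast
  then obtain M where M: "\<And>i. i \<ge> M \<Longrightarrow> f i = 0" "\<And>i. i \<ge> M \<Longrightarrow> g i = 0"
    using that[of "max M1 M2"] by simp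
  have k: "max (f (Suc i)) (g (Suc i)) \<le> k i" "k i \<le> min (f i) (g i)" for i
    using assms by (auto simp: interlaces_def)
  have k0: "k i = 0" if "i \<ge> M" for i
    using k(2)[of i] M[OF that] by simp
  have t0: "toggle f g m k i = 0" if "i \<ge> Suc M" for i
    using that M k0 by (cases i) (auto simp: toggle_def)
  have "psize (toggle f g m k) + psize k
      = sum (toggle f g m k) {..<Suc M} + sum k {..<M}"
    using psize_eq_sum[OF t0] psize_eq_sum[OF k0] by simp
  also have "sum (toggle f g m k) {..<Suc M}
      = m + max (f 0) (g 0) + (\<Sum>i<M. toggle f g m k (Suc i))"
    by (subst sum.lessThan_Suc_shift) (simp add: toggle_def)
  also have "\<dots> + sum k {..<M}
      = m + max (f 0) (g 0) + (\<Sum>i<M. toggle f g m k (Suc i) + k i)"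
    by (simp add: sum.distrib)
  also have "(\<Sum>i<M. toggle f g m k (Suc i) + k i)
      = (\<Sum>i<M. max (f (Suc i)) (g (Suc i)) + min (f i) (g i))"
  proof (rule sum.cong)
    fix i
    show "toggle f g m k (Suc i) + k i = max (f (Suc i)) (g (Suc i)) + min (f i) (g i)"
      using k[of i] by (simp add: toggle_def del: max.bounded_iff min.bounded_iff)
  qed simp
  also have "m + max (f 0) (g 0) + \<dots>
      = m + (\<Sum>i<Suc M. max (f i) (g i)) + (\<Sum>i<M. min (f i) (g i))"
    by (simp only: sum.lessThan_Suc_shift[of "\<lambda>i. max (f i) (g i)"]) (simp add: sum.distrib)
  also have "\<dots> = m + (\<Sum>i<M. max (f i) (g i) + min (f i) (g i))"
    using M by (simp add: sum.distrib)
  also have "(\<Sum>i<M. max (f i) (g i) + min (f i) (g i)) = (\<Sum>i<M. f i + g i)"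
    by (intro sum.cong) auto
  also have "\<dots> = psize f + psize g"
    using psize_eq_sum[OF M(1)] psize_eq_sum[OF M(2)] by (simp add: sum.distrib)
  finally show ?thesis by simp
qed

section \<open>Weight-preserving bijections\<close>

definition wequiv :: "'a set \<Rightarrow> ('a \<Rightarrow> nat) \<Rightarrow> 'b set \<Rightarrow> ('b \<Rightarrow> nat) \<Rightarrow> bool" where
  "wequiv A w B v \<longleftrightarrow> (\<exists>f. bij_betw f A B \<and> (\<forall>a\<in>A. v (f a) = w a))"

lemma wequivI: "bij_betw f A B \<Longrightarrow> (\<And>a. a \<in> A \<Longrightarrow> v (f a) = w a) \<Longrightarrow> wequiv A w B v"
  unfolding wequiv_def by blast

lemma wequiv_trans [trans]: "wequiv A w B v \<Longrightarrow> wequiv B v C u \<Longrightarrow> wequiv A w C u"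
  unfolding wequiv_def
proof clarify
  fix f g assume "bij_betw f A B" "bij_betw g B C" "\<forall>a\<in>A. v (f a) = w a" "\<forall>b\<in>B. u (g b) = v b"
  then show "\<exists>h. bij_betw h A C \<and> (\<forall>a\<in>A. u (h a) = w a)"
    by (intro exI[of _ "g \<circ> f"]) (auto intro: bij_betw_trans simp: bij_betwE)
qed

lemma wequiv_sym: "wequiv A w B v \<Longrightarrow> wequiv B v A w"
  unfolding wequiv_def
proof clarify
  fix f assume f: "bij_betw f A B" "\<forall>a\<in>A. v (f a) = w a"
  have "bij_betw (inv_into A f) B A"
    using f(1) by (rule bij_betw_inv_into)
  moreover have "w (inv_into A f b) = v b" if "b \<in> B" for b
    using f that by (metis bij_betw_inv_into_right bij_betw_imp_surj_on inv_into_into)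
  ultimately show "\<exists>g. bij_betw g B A \<and> (\<forall>b\<in>B. w (g b) = v b)"
    by blast
qed

text \<open>Lets an equivalence be applied to one component of a tuple: bijections of the fibres are
  chosen for all indices and glued, and the index keeps its own weight \<open>c i\<close>.\<close>

lemma wequiv_Sigma:
  assumes "\<And>i. i \<in> I \<Longrightarrow> wequiv (A i) (w i) (B i) (v i)"
  shows "wequiv (Sigma I A) (\<lambda>(i, a). c i + w i a) (Sigma I B) (\<lambda>(i, b). c i + v i b)"
proof -
  obtain f where f: "\<And>i. i \<in> I \<Longrightarrow> bij_betw (f i) (A i) (B i)"
      "\<And>i a. i \<in> I \<Longrightarrow> a \<in> A i \<Longrightarrow> v i (f i a) = w i a"
    using assms unfolding wequiv_def by metis
  have "bij_betw (\<lambda>(i, a). (i, f i a)) (Sigma I A) (Sigma I B)"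
    using f(1) by (force simp: bij_betw_def inj_on_def image_iff)
  then show ?thesis
    by (rule wequivI) (auto simp: f(2))
qed

section \<open>Chains of interlacing sequences and matrices\<close>

fun down_chains :: "nat \<Rightarrow> (nat \<Rightarrow> nat) \<Rightarrow> (nat \<Rightarrow> nat) list set" where
  "down_chains 0 f = (if f = (\<lambda>_. 0) then {[]} else {})"
| "down_chains (Suc n) f = {g # s | g s. interlaces f g \<and> s \<in> down_chains n g}"

text \<open>The start \<open>f\<close> is not listed: there are \<open>m\<close> ascents from
  \<open>f\<close>, then \<open>n\<close> descents, and the last sequence reached must be
  zero.\<close>

fun updown_chains :: "nat \<Rightarrow> nat \<Rightarrow> (nat \<Rightarrow> nat) \<Rightarrow> (nat \<Rightarrow> nat) list set" where
  "updown_chains 0 n f = down_chains n f"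
| "updown_chains (Suc m) n f = {g # s | g s. interlaces g f \<and> s \<in> updown_chains m n g}"

abbreviation total :: "(nat \<Rightarrow> nat) list \<Rightarrow> nat" where
  "total s \<equiv> sum_list (map psize s)"

lemma fsupp_down_chains: "s \<in> down_chains n f \<Longrightarrow> fsupp f"
proof (induction n arbitrary: f s)
  case 0
  then show ?case by (auto simp: fsupp_def split: if_splits)
next
  case (Suc n)
  then show ?case by (auto intro: fsupp_interlaces_upper)
qed

fun weighted_sum :: "nat \<Rightarrow> nat list \<Rightarrow> nat" where
  "weighted_sum b [] = 0"
| "weighted_sum b (k # ks) = b * k + weighted_sum (Suc b) ks"

text \<open>One ascent is pushed past all descents. Replacing \<open>f\<close>, \<open>h\<close>,
  \<open>g\<close> by \<open>f\<close>, \<open>k\<close>, \<open>g\<close> turns the excess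
  \<open>psize h - psize f\<close> into \<open>m + (psize g - psize k)\<close>, and
  \<open>psize g\<close> is \<open>psize k\<close> plus the new excess. So \<open>b\<close> copies
  of the old excess release \<open>b * m\<close>, and \<open>Suc b\<close> copies of the new one
  travel on; hence the weights increase by 1 at each exchange. At the zero sequence the ascent
  disappears.\<close>

lemma wequiv_up_down_chains:
  assumes "fsupp f"
  shows "wequiv {(g, s). interlaces g f \<and> s \<in> down_chains n g}
      (\<lambda>(g, s). b * (psize g - psize f) + total s)
    ({ks. length ks = n} \<times> down_chains n f) (\<lambda>(ks, s). weighted_sum b ks + total s)"
  using assms
proof (induction n arbitrary: b f)
  case 0
  have "interlaces (\<lambda>_. 0) f \<longleftrightarrow> f = (\<lambda>_. 0)"
    by (auto simp: interlaces_def)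
  then have "bij_betw (\<lambda>_. ([], [])) {(g, s). interlaces g f \<and> s \<in> down_chains 0 g}
      ({ks :: nat list. length ks = 0} \<times> down_chains 0 f)"
    by (auto simp: bij_betw_def inj_on_def split: if_splits)
  then show ?case
    by (rule wequivI) (auto split: if_splits)
next
  case (Suc n)
  \<comment> \<open>The state after one exchange: the number split off, the new lower neighbour
    \<open>k\<close>, and an ascent from \<open>k\<close> to \<open>g\<close> that still has
    \<open>n\<close> descents ahead.\<close>
  let ?M = "(UNIV :: nat set) \<times> (SIGMA k:{k. interlaces f k}. {(g, s). interlaces g k \<and> s \<in> down_chains n g})"
  let ?M' = "(UNIV :: nat set) \<times> (SIGMA k:{k. interlaces f k}. {ks :: nat list. length ks = n} \<times> down_chains n k)"
  have "wequiv {(h, s). interlaces h f \<and> s \<in> down_chains (Suc n) h}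
     (\<lambda>(h, s). b * (psize h - psize f) + total s) ?M
     (\<lambda>(m, x). b * m + (case x of (k, y) \<Rightarrow> psize k +
        (case y of (g, s) \<Rightarrow> Suc b * (psize g - psize k) + total s)))"
  proof (rule wequiv_sym, rule wequivI[where f = "\<lambda>(m, k, g, s). (toggle f g m k, g # s)"])
    have T: "inj_on (\<lambda>(m, k). toggle f g m k) (UNIV \<times> {k. interlaces f k \<and> interlaces g k})"
      "(\<lambda>(m, k). toggle f g m k) ` (UNIV \<times> {k. interlaces f k \<and> interlaces g k})
         = {h. interlaces h f \<and> interlaces h g}" for g
      using bij_betw_toggle[of f g] by (auto simp: bij_betw_def)
    show "bij_betw (\<lambda>(m, k, g, s). (toggle f g m k, g # s)) ?M
        {(h, s). interlaces h f \<and> s \<in> down_chains (Suc n) h}"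
      unfolding bij_betw_def
    proof (intro conjI inj_onI)
      fix x y assume "x \<in> ?M" "y \<in> ?M" "(\<lambda>(m, k, g, s). (toggle f g m k, g # s)) x
         = (\<lambda>(m, k, g, s). (toggle f g m k, g # s)) y"
      then show "x = y"
        using T(1) by (fastforce simp: inj_on_def)
    next
      show "(\<lambda>(m, k, g, s). (toggle f g m k, g # s)) ` ?M
        = {(h, s). interlaces h f \<and> s \<in> down_chains (Suc n) h}"
      proof (intro equalityI subsetI)
        fix x assume "x \<in> (\<lambda>(m, k, g, s). (toggle f g m k, g # s)) ` ?M"
        then show "x \<in> {(h, s). interlaces h f \<and> s \<in> down_chains (Suc n) h}"
          using T(2) by fastforce
      next
        fix x assume "x \<in> {(h, s). interlaces h f \<and> s \<in> down_chains (Suc n) h}"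
        then obtain h g s where x: "x = (h, g # s)" "interlaces h f" "interlaces h g" "s \<in> down_chains n g"
          by auto
        then obtain m k where "h = toggle f g m k" "interlaces f k" "interlaces g k"
          using T(2)[of g] by (smt (verit) imageE mem_Collect_eq SigmaE case_prod_conv)
        with x show "x \<in> (\<lambda>(m, k, g, s). (toggle f g m k, g # s)) ` ?M"
          by (intro image_eqI[of _ _ "(m, k, g, s)"]) auto
      qed
    qed
  next
    fix x assume "x \<in> ?M"
    then obtain m k g s where x: "x = (m, k, g, s)" "interlaces f k" "interlaces g k" "s \<in> down_chains n g"
      by auto
    have g: "fsupp g" using fsupp_down_chains x(4) by blast
    have "psize (toggle f g m k) + psize k = m + psize f + psize g"
      using psize_toggle x(2,3) Suc.prems g by blast
    moreover have "psize k \<le> psize g"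
      using psize_interlaces_mono x(3) g by blast
    ultimately obtain d where "psize g = psize k + d" "psize (toggle f g m k) = psize f + (m + d)"
      using le_Suc_ex[of "psize k" "psize g"] by auto
    then show "(\<lambda>(h, s). b * (psize h - psize f) + total s)
        ((\<lambda>(m, k, g, s). (toggle f g m k, g # s)) x) =
      (\<lambda>(m, x). b * m + (case x of (k, y) \<Rightarrow> psize k +
        (case y of (g, s) \<Rightarrow> Suc b * (psize g - psize k) + total s))) x"
      by (simp add: x(1) algebra_simps)
  qed
  also have "wequiv ?M (\<lambda>(m, x). b * m + (case x of (k, y) \<Rightarrow> psize k +
        (case y of (g, s) \<Rightarrow> Suc b * (psize g - psize k) + total s))) ?M'
     (\<lambda>(m, x). b * m + (case x of (k, y) \<Rightarrow> psize k +
        (case y of (ks, s) \<Rightarrow> weighted_sum (Suc b) ks + total s)))"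
    by (intro wequiv_Sigma Suc.IH) (auto intro: fsupp_interlaces_lower[OF _ Suc.prems])
  also have "wequiv ?M' (\<lambda>(m, x). b * m + (case x of (k, y) \<Rightarrow> psize k +
        (case y of (ks, s) \<Rightarrow> weighted_sum (Suc b) ks + total s)))
    ({ks. length ks = Suc n} \<times> down_chains (Suc n) f) (\<lambda>(ks, s). weighted_sum b ks + total s)"
  proof (rule wequivI[where f = "\<lambda>(m, k, ks, s). (m # ks, k # s)"])
    show "bij_betw (\<lambda>(m, k, ks, s). (m # ks, k # s)) ?M'
       ({ks. length ks = Suc n} \<times> down_chains (Suc n) f)"
      by (rule bij_betw_byWitness[where f' = "\<lambda>(ks, s). (hd ks, hd s, tl ks, tl s)"])
        (auto simp: length_Suc_conv)
  next
    fix x assume "x \<in> ?M'"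
    then show "(\<lambda>(ks, s). weighted_sum b ks + total s) ((\<lambda>(m, k, ks, s). (m # ks, k # s)) x)
      = (\<lambda>(m, x). b * m + (case x of (k, y) \<Rightarrow> psize k +
        (case y of (ks, s) \<Rightarrow> weighted_sum (Suc b) ks + total s))) x"
      by auto
  qed
  finally show ?case .
qed

text \<open>A row belongs to one ascent. If \<open>j\<close> ascents follow it, its excess is
  counted in \<open>j + 1\<close> sequences up to the peak, which is the weight at which the row
  starts; an entry at position \<open>i\<close> then has weight \<open>i + j + 1\<close>.\<close>

fun matrix_weight :: "nat list list \<Rightarrow> nat" where
  "matrix_weight [] = 0"
| "matrix_weight (ks # kss) = weighted_sum (Suc (length kss)) ks + matrix_weight kss"

abbreviation matrices :: "nat \<Rightarrow> nat \<Rightarrow> nat list list set" where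
  "matrices m n \<equiv> {kss. length kss = m \<and> (\<forall>ks\<in>set kss. length ks = n)}"

text \<open>The term \<open>m * psize f\<close> is the part that all ascended sequences inherit from
  \<open>f\<close>. The later ascents are resolved by induction; the first one, whose excess occurs
  \<open>Suc m\<close> times, is then pushed through the descents.\<close>

lemma wequiv_updown_chains:
  assumes "fsupp f"
  shows "wequiv (updown_chains m n f) total (matrices m n \<times> down_chains n f)
    (\<lambda>(kss, s). m * psize f + matrix_weight kss + total s)"
  using assms
proof (induction m arbitrary: f)
  case 0
  show ?case
    by (rule wequivI[where f = "\<lambda>s. ([], s)"]) (auto simp: bij_betw_def inj_on_def)
next
  case (Suc m)
  let ?G = "{g. interlaces g f}"
  have "wequiv (updown_chains (Suc m) n f) total (SIGMA g:?G. updown_chains m n g)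
      (\<lambda>(g, s). psize g + total s)"
    by (rule wequivI[where f = "\<lambda>s. (hd s, tl s)"])
      (auto intro!: bij_betw_byWitness[where f' = "\<lambda>(g, s). g # s"])
  also have "wequiv (SIGMA g:?G. updown_chains m n g) (\<lambda>(g, s). psize g + total s)
     (SIGMA g:?G. matrices m n \<times> down_chains n g)
     (\<lambda>(g, x). psize g + (case x of (kss, s) \<Rightarrow> m * psize g + matrix_weight kss + total s))"
    by (intro wequiv_Sigma Suc.IH) (auto intro: fsupp_interlaces_upper[OF _ Suc.prems])
  also have "wequiv (SIGMA g:?G. matrices m n \<times> down_chains n g)
     (\<lambda>(g, x). psize g + (case x of (kss, s) \<Rightarrow> m * psize g + matrix_weight kss + total s))
     (matrices m n \<times> {(g, s). interlaces g f \<and> s \<in> down_chains n g})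
     (\<lambda>(kss, x). Suc m * psize f + matrix_weight kss + (case x of (g, s) \<Rightarrow>
        Suc m * (psize g - psize f) + total s))"
  proof (rule wequivI[where f = "\<lambda>(g, kss, s). (kss, g, s)"])
    show "bij_betw (\<lambda>(g, kss, s). (kss, g, s)) (SIGMA g:?G. matrices m n \<times> down_chains n g)
      (matrices m n \<times> {(g, s). interlaces g f \<and> s \<in> down_chains n g})"
      by (rule bij_betw_byWitness[where f' = "\<lambda>(kss, g, s). (g, kss, s)"]) auto
  next
    fix x assume "x \<in> (SIGMA g:?G. matrices m n \<times> down_chains n g)"
    then obtain g kss s where x: "x = (g, kss, s)" "interlaces g f" by auto
    have "psize f \<le> psize g"
      using psize_interlaces_mono[OF x(2)] fsupp_interlaces_upper[OF x(2) Suc.prems] .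
    then obtain d where "psize g = psize f + d"
      using le_Suc_ex by blast
    then show "(\<lambda>(kss, x). Suc m * psize f + matrix_weight kss + (case x of (g, s) \<Rightarrow>
        Suc m * (psize g - psize f) + total s)) ((\<lambda>(g, kss, s). (kss, g, s)) x) =
     (\<lambda>(g, x). psize g + (case x of (kss, s) \<Rightarrow> m * psize g + matrix_weight kss + total s)) x"
      by (simp add: x(1) algebra_simps)
  qed
  also have "wequiv (matrices m n \<times> {(g, s). interlaces g f \<and> s \<in> down_chains n g})
     (\<lambda>(kss, x). Suc m * psize f + matrix_weight kss + (case x of (g, s) \<Rightarrow>
        Suc m * (psize g - psize f) + total s))
     (matrices m n \<times> ({ks. length ks = n} \<times> down_chains n f))
     (\<lambda>(kss, x). Suc m * psize f + matrix_weight kss + (case x of (ks, s) \<Rightarrow>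
        weighted_sum (Suc m) ks + total s))"
    by (intro wequiv_Sigma wequiv_up_down_chains Suc.prems)
  also have "wequiv (matrices m n \<times> ({ks. length ks = n} \<times> down_chains n f))
     (\<lambda>(kss, x). Suc m * psize f + matrix_weight kss + (case x of (ks, s) \<Rightarrow>
        weighted_sum (Suc m) ks + total s))
     (matrices (Suc m) n \<times> down_chains n f)
     (\<lambda>(kss, s). Suc m * psize f + matrix_weight kss + total s)"
  proof (rule wequivI[where f = "\<lambda>(kss, ks, s). (ks # kss, s)"])
    show "bij_betw (\<lambda>(kss, ks, s). (ks # kss, s)) (matrices m n \<times> ({ks. length ks = n} \<times> down_chains n f))
       (matrices (Suc m) n \<times> down_chains n f)"
      by (rule bij_betw_byWitness[where f' = "\<lambda>(kss, s). (tl kss, hd kss, s)"])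
        (auto simp: length_Suc_conv)
  qed auto
  finally show ?case .
qed

section \<open>MacMahon's product formula\<close>

unbundle no vec_syntax
unbundle fps_syntax

section \<open>Plane partitions as chains of diagonals\<close>

lemma down_chains_iff:
  "s \<in> down_chains n f \<longleftrightarrow> length s = n \<and> (\<forall>k<n. interlaces ((f # s) ! k) (s ! k))
     \<and> (f # s) ! n = (\<lambda>_. 0)"
proof (induction n arbitrary: f s)
  case (Suc n)
  have "g # t \<in> down_chains (Suc n) f \<longleftrightarrow> length (g # t) = Suc n
      \<and> (\<forall>k<Suc n. interlaces ((f # g # t) ! k) ((g # t) ! k)) \<and> (f # g # t) ! Suc n = (\<lambda>_. 0)" for g t
    by (auto simp: Suc.IH All_less_Suc2)
  then show ?case
    by (cases s) auto
qed auto

lemma updown_chains_iff: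
  "s \<in> updown_chains m n f \<longleftrightarrow> length s = m + n \<and> (\<forall>k<m. interlaces (s ! k) ((f # s) ! k))
     \<and> (\<forall>k<n. interlaces ((f # s) ! (m + k)) (s ! (m + k))) \<and> (f # s) ! (m + n) = (\<lambda>_. 0)"
proof (induction m arbitrary: f s)
  case 0
  then show ?case by (simp add: down_chains_iff)
next
  case (Suc m)
  have "g # t \<in> updown_chains (Suc m) n f \<longleftrightarrow> length (g # t) = Suc m + n
      \<and> (\<forall>k<Suc m. interlaces ((g # t) ! k) ((f # g # t) ! k))
      \<and> (\<forall>k<n. interlaces ((f # g # t) ! (Suc m + k)) ((g # t) ! (Suc m + k)))
      \<and> (f # g # t) ! (Suc m + n) = (\<lambda>_. 0)" for g t
    by (auto simp: Suc.IH All_less_Suc2)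
  then show ?case
    by (cases s) auto
qed

declare updown_chains.simps [simp del]

text \<open>The truncated differences make \<open>k\<close> run through all diagonals at once: below the main
  diagonal for \<open>k < M\<close>, the main diagonal for \<open>k = M\<close>, above it for \<open>k > M\<close>.\<close>

definition diagonals :: "nat \<Rightarrow> (nat \<Rightarrow> nat \<Rightarrow> nat) \<Rightarrow> (nat \<Rightarrow> nat) list" where
  "diagonals M p = map (\<lambda>k i. p (i + (M - k)) (i + (k - M))) [0..<2 * M + 2]"

text \<open>Entry \<open>(i, j)\<close> sits at position \<open>min i j\<close> of the diagonal with
  index \<open>M + j - i\<close>. The last sequence of a chain is zero and stands for the first
  diagonal outside the band.\<close>

definition undiagonals :: "nat \<Rightarrow> (nat \<Rightarrow> nat) list \<Rightarrow> nat \<Rightarrow> nat \<Rightarrow> nat" where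
  "undiagonals M s i j =
     (if i \<le> M + j \<and> j \<le> M + i then (s ! (M + j - i)) (min i j) else 0)"

lemma sum_support_diagonals:
  assumes box: "\<And>i j. p i j \<noteq> 0 \<Longrightarrow> i \<le> M \<and> j \<le> M"
  shows "(\<Sum>(i, j) \<in> {(i, j). p i j \<noteq> 0}. p i j) = total (diagonals M p)"
proof -
  let ?d = "\<lambda>k i. p (i + (M - k)) (i + (k - M))"
  have fin: "finite {i. ?d k i \<noteq> 0}" for k
  proof (rule finite_subset)
    show "{i. ?d k i \<noteq> 0} \<subseteq> {..M}"
    proof
      fix i assume "i \<in> {i. ?d k i \<noteq> 0}"
      then have "i + (M - k) \<le> M" using box by blast
      then show "i \<in> {..M}" by simp
    qed
  qed simp
  have "total (diagonals M p) = (\<Sum>k<2 * M + 2. psize (?d k))"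
    by (simp add: diagonals_def comp_def interv_sum_list_conv_sum_set_nat atLeast0LessThan
        del: sum.lessThan_Suc upt_Suc add_2_eq_Suc')
  also have "\<dots> = (\<Sum>(k, i) \<in> (SIGMA k:{..<2 * M + 2}. {i. ?d k i \<noteq> 0}). ?d k i)"
    unfolding psize_def by (rule sum.Sigma) (use fin in auto)
  also have "\<dots> = (\<Sum>(i, j) \<in> {(i, j). p i j \<noteq> 0}. p i j)"
  proof (rule sum.reindex_bij_witness[where i = "\<lambda>(i, j). (M + j - i, min i j)"
        and j = "\<lambda>(k, i). (i + (M - k), i + (k - M))"], goal_cases)
    case (3 x)
    then obtain i j where x: "x = (i, j)" "p i j \<noteq> 0" by auto
    with box have "i \<le> M" "j \<le> M" by blast+
    then show ?case by (auto simp: x min_def)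
  next
    case (4 x)
    then obtain i j where x: "x = (i, j)" "p i j \<noteq> 0" by auto
    with box have "i \<le> M" "j \<le> M" by blast+
    moreover have "min i j + (M - (M + j - i)) = i" "min i j + (M + j - i - M) = j"
      using \<open>i \<le> M\<close> by (auto simp: min_def)
    ultimately show ?case using x by auto
  qed auto
  finally show ?thesis by simp
qed

lemma diagonals_in_updown_chains:
  assumes row: "\<And>i. antimono (\<lambda>j. p i j)" and col: "\<And>j. antimono (\<lambda>i. p i j)"
    and box: "\<And>i j. p i j \<noteq> 0 \<Longrightarrow> i \<le> M \<and> j \<le> M"
  shows "diagonals M p \<in> updown_chains (Suc M) (Suc M) (\<lambda>_. 0)"
proof -
  have nth: "(diagonals M p ! k) i = p (i + (M - k)) (i + (k - M))" if "k < 2 * M + 2" for k i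
    using that by (simp add: diagonals_def del: upt_Suc)
  have mono: "p i' j' \<le> p i j" if "i \<le> i'" "j \<le> j'" for i j i' j'
    using antimonoD[OF row that(2), of i'] antimonoD[OF col that(1), of j] by linarith
  have z: "p i j = 0" if "i > M \<or> j > M" for i j
    using box[of i j] that by force
  show ?thesis
    unfolding updown_chains_iff
  proof (intro conjI allI impI)
    fix k assume k: "k < Suc M"
    show "interlaces (diagonals M p ! k) (((\<lambda>_. 0) # diagonals M p) ! k)"
    proof (cases k)
      case 0
      then show ?thesis by (auto simp: interlaces_def nth z)
    next
      case (Suc l)
      then show ?thesis using k by (auto simp: interlaces_def nth intro!: mono)
    qed
  next
    fix k assume k: "k < Suc M"
    then show "interlaces (((\<lambda>_. 0) # diagonals M p) ! (Suc M + k)) (diagonals M p ! (Suc M + k))"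
      by (auto simp: interlaces_def nth intro!: mono)
  next
    show "((\<lambda>_. 0) # diagonals M p) ! (Suc M + Suc M) = (\<lambda>_. 0)"
      by (auto simp: nth z fun_eq_iff)
  qed (simp add: diagonals_def)
qed

lemma undiagonals_diagonals:
  assumes box: "\<And>i j. p i j \<noteq> 0 \<Longrightarrow> i \<le> M \<and> j \<le> M"
  shows "undiagonals M (diagonals M p) = p"
proof (intro ext)
  fix i j
  show "undiagonals M (diagonals M p) i j = p i j"
  proof (cases "i \<le> M + j \<and> j \<le> M + i")
    case True
    then have "min i j + (M - (M + j - i)) = i" "min i j + (M + j - i - M) = j" "M + j - i < 2 * M + 2"
      by (auto simp: min_def)
    then show ?thesis
      using True by (simp add: undiagonals_def diagonals_def del: upt_Suc)
  next
    case False
    then show ?thesis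
      using box[of i j] by (force simp: undiagonals_def)
  qed
qed

lemma diagonals_undiagonals:
  assumes "s \<in> updown_chains (Suc M) (Suc M) (\<lambda>_. 0)"
  shows "diagonals M (undiagonals M s) = s"
proof (rule nth_equalityI)
  show "length (diagonals M (undiagonals M s)) = length s"
    using assms by (simp add: updown_chains_iff diagonals_def)
next
  fix k assume "k < length (diagonals M (undiagonals M s))"
  then have k: "k < 2 * M + 2" by (simp add: diagonals_def)
  have last: "s ! Suc (2 * M) = (\<lambda>_. 0)"
    using assms by (simp add: updown_chains_iff mult_2)
  have "undiagonals M s (i + (M - k)) (i + (k - M)) = (s ! k) i" for i
  proof (cases "k = 2 * M + 1")
    case True
    then show ?thesis by (simp add: undiagonals_def last)
  next
    case False
    then have "M + (i + (k - M)) - (i + (M - k)) = k" "min (i + (M - k)) (i + (k - M)) = i"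
        "i + (M - k) \<le> M + (i + (k - M))" "i + (k - M) \<le> M + (i + (M - k))"
      using k by (auto simp: min_def)
    then show ?thesis by (simp add: undiagonals_def)
  qed
  then show "diagonals M (undiagonals M s) ! k = s ! k"
    using k by (simp add: diagonals_def fun_eq_iff del: upt_Suc)
qed

text \<open>A step to the right or down leads to a neighbouring diagonal, so monotonicity is
  interlacing, read in the ascending part below the main diagonal and in the descending part above
  it.\<close>

lemma undiagonals_props:
  assumes s: "s \<in> updown_chains (Suc M) (Suc M) (\<lambda>_. 0)"
  defines "p \<equiv> undiagonals M s"
  shows "antimono (\<lambda>j. p i j)" "antimono (\<lambda>i. p i j)" "p i j \<noteq> 0 \<Longrightarrow> i \<le> M \<and> j \<le> M"
proof -
  have len: "length s = 2 * M + 2" and last: "s ! (2 * M + 1) = (\<lambda>_. 0)"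
    using s by (auto simp: updown_chains_iff mult_2)
  have up': "interlaces (s ! k) (((\<lambda>_. 0) # s) ! k)" if "k < Suc M" for k
    using s that by (simp add: updown_chains_iff)
  have up: "interlaces (s ! Suc k) (s ! k)" if "k < M" for k
    using up'[of "Suc k"] that by simp
  have up0: "interlaces (s ! 0) (\<lambda>_. 0)"
    using up'[of 0] by simp
  have down: "interlaces (s ! k) (s ! Suc k)" if "M \<le> k" "k \<le> 2 * M" for k
  proof -
    have "k - M < Suc M" using that by simp
    moreover have "\<forall>l<Suc M. interlaces (((\<lambda>_. 0) # s) ! (Suc M + l)) (s ! (Suc M + l))"
      using s unfolding updown_chains_iff by blast
    ultimately have "interlaces (((\<lambda>_. 0) # s) ! (Suc M + (k - M))) (s ! (Suc M + (k - M)))"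
      by blast
    then show ?thesis using that by simp
  qed
  have row: "p i (Suc j) \<le> p i j" for i j
  proof -
    consider "i = M + j + 1" | "i > M + j + 1" | "i \<le> M + j" "j < i"
      | "i \<le> j" "j < M + i" | "j \<ge> M + i" by linarith
    then show ?thesis
    proof cases
      \<comment> \<open>Here \<open>p i j\<close> is the default 0; \<open>up0\<close> makes the
        first diagonal vanish beyond position 0. The zero sequence at the other end plays the same
        role for the columns.\<close>
      case 1
      then show ?thesis using up0 by (simp add: p_def undiagonals_def interlaces_def)
    next
      case 3
      then have "M + Suc j - i = Suc (M + j - i)" "M + j - i < M" "min i (Suc j) = Suc j" "min i j = j"
        by auto
      then show ?thesis using up[of "M + j - i"] 3
        by (simp add: p_def undiagonals_def interlaces_def)
    next
      case 4
      then have "M + Suc j - i = Suc (M + j - i)" "M + j - i \<ge> M" "min i (Suc j) = i" "min i j = i"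
          "M + j - i \<le> 2 * M"
        by auto
      then show ?thesis using down[of "M + j - i"] 4
        by (simp add: p_def undiagonals_def interlaces_def)
    qed (auto simp: p_def undiagonals_def)
  qed
  have col: "p (Suc i) j \<le> p i j" for i j
  proof -
    consider "j = i + M + 1" | "j > i + M + 1" | "j \<le> M + i" "i < j"
      | "j \<le> i" "i < M + j" | "i \<ge> M + j" by linarith
    then show ?thesis
    proof cases
      case 1
      then show ?thesis using down[of "2 * M"] last
        by (simp add: p_def undiagonals_def interlaces_def mult_2)
    next
      case 3
      then have "M + j - i = Suc (M + j - Suc i)" "M + j - Suc i \<ge> M" "min (Suc i) j = Suc i" "min i j = i"
          "M + j - Suc i \<le> 2 * M"
        by auto
      then show ?thesis using down[of "M + j - Suc i"] 3
        by (simp add: p_def undiagonals_def interlaces_def)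
    next
      case 4
      then have "M + j - i = Suc (M + j - Suc i)" "M + j - Suc i < M" "min (Suc i) j = j" "min i j = j"
        by auto
      then show ?thesis using up[of "M + j - Suc i"] 4
        by (simp add: p_def undiagonals_def interlaces_def)
    qed (auto simp: p_def undiagonals_def)
  qed
  show R: "antimono (\<lambda>j. p i j)" for i
    using row by (simp add: antimono_iff_le_Suc)
  show C: "antimono (\<lambda>i. p i j)" for j
    using col by (simp add: antimono_iff_le_Suc)
  \<comment> \<open>By monotonicity a nonzero entry forces \<open>p i 0\<close> and
    \<open>p 0 j\<close> to be nonzero, and on the border of the array the band condition is the
    bound itself.\<close>
  show "i \<le> M \<and> j \<le> M" if "p i j \<noteq> 0"
  proof -
    have "p i j \<le> p i 0" "p i j \<le> p 0 j"
      using antimonoD[OF R, of 0 j i] antimonoD[OF C, of 0 i j] by auto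
    with that have "p i 0 \<noteq> 0" "p 0 j \<noteq> 0" by auto
    then show ?thesis by (auto simp: p_def undiagonals_def split: if_splits)
  qed
qed

lemma bij_betw_diagonals:
  assumes "n \<le> Suc M"
  shows "bij_betw (diagonals M) {p. plane_partition_of p n}
     {s \<in> updown_chains (Suc M) (Suc M) (\<lambda>_. 0). total s = n}"
proof (rule bij_betw_byWitness[where f' = "undiagonals M"])
  have box: "i \<le> M \<and> j \<le> M" if "plane_partition_of p n" "p i j \<noteq> 0" for p i j
    using plane_partition_of_support[OF that] assms by auto
  show "\<forall>p\<in>{p. plane_partition_of p n}. undiagonals M (diagonals M p) = p"
    using box by (auto intro!: undiagonals_diagonals)
  show "\<forall>s\<in>{s \<in> updown_chains (Suc M) (Suc M) (\<lambda>_. 0). total s = n}. diagonals M (undiagonals M s) = s"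
    by (auto intro!: diagonals_undiagonals)
  show "diagonals M ` {p. plane_partition_of p n}
      \<subseteq> {s \<in> updown_chains (Suc M) (Suc M) (\<lambda>_. 0). total s = n}"
  proof safe
    fix p assume p: "plane_partition_of p n"
    then show "diagonals M p \<in> updown_chains (Suc M) (Suc M) (\<lambda>_. 0)"
      by (intro diagonals_in_updown_chains) (use box[OF p] in \<open>auto simp: plane_partition_of_def\<close>)
    show "total (diagonals M p) = n"
      using sum_support_diagonals[of p M, OF box[OF p]] p by (simp add: plane_partition_of_def)
  qed
  show "undiagonals M ` {s \<in> updown_chains (Suc M) (Suc M) (\<lambda>_. 0). total s = n}
      \<subseteq> {p. plane_partition_of p n}"
  proof safe
    fix s assume s: "s \<in> updown_chains (Suc M) (Suc M) (\<lambda>_. 0)" and n: "n = total s"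
    note P = undiagonals_props[OF s]
    have "{(i, j). undiagonals M s i j \<noteq> 0} \<subseteq> {..M} \<times> {..M}"
      using P(3) by auto
    then have "finite {(i, j). undiagonals M s i j \<noteq> 0}"
      by (rule finite_subset) auto
    then show "plane_partition_of (undiagonals M s) (total s)"
      unfolding plane_partition_of_def
      using P(1,2) sum_support_diagonals[of "undiagonals M s" M, OF P(3)]
      by (simp add: diagonals_undiagonals[OF s])
  qed
qed

section \<open>Generating functions of weighted sets\<close>

definition genfun :: "'a set \<Rightarrow> ('a \<Rightarrow> nat) \<Rightarrow> real fps" where
  "genfun A w = Abs_fps (\<lambda>n. real (card {a \<in> A. w a = n}))"

text \<open>Since \<open>card\<close> of an infinite set is 0, the coefficients of
  \<open>genfun\<close> really count only under this condition, so it is carried along with every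
  product.\<close>

definition finite_fibers :: "'a set \<Rightarrow> ('a \<Rightarrow> nat) \<Rightarrow> bool" where
  "finite_fibers A w \<longleftrightarrow> (\<forall>n. finite {a \<in> A. w a = n})"

lemma wequiv_fiber:
  assumes "wequiv A w B v"
  shows "\<exists>f. bij_betw f {a \<in> A. w a = n} {b \<in> B. v b = n}"
proof -
  obtain f where f: "bij_betw f A B" "\<forall>a\<in>A. v (f a) = w a"
    using assms by (auto simp: wequiv_def)
  have "bij_betw f {a \<in> A. w a = n} {b \<in> B. v b = n}"
    using f by (force simp: bij_betw_def inj_on_def image_iff)
  then show ?thesis by blast
qed

lemma genfun_wequiv: "wequiv A w B v \<Longrightarrow> genfun A w = genfun B v"
  unfolding genfun_def using wequiv_fiber[of A w B v] bij_betw_same_card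
  by (intro arg_cong[of _ _ Abs_fps] ext arg_cong[of _ _ real]) blast

lemma finite_fibers_wequiv: "wequiv A w B v \<Longrightarrow> finite_fibers B v \<Longrightarrow> finite_fibers A w"
  unfolding finite_fibers_def using wequiv_fiber[of A w B v] bij_betw_finite by blast

lemma genfun_times:
  assumes "finite_fibers A w" "finite_fibers B v"
  shows "genfun (A \<times> B) (\<lambda>(a, b). w a + v b) = genfun A w * genfun B v" (is ?gf)
    and "finite_fibers (A \<times> B) (\<lambda>(a, b). w a + v b)" (is ?fin)
proof -
  have eq: "{x \<in> A \<times> B. (case x of (a, b) \<Rightarrow> w a + v b) = n}
      = (\<Union>i\<in>{0..n}. {a \<in> A. w a = i} \<times> {b \<in> B. v b = n - i})" for n
    by auto
  have fin: "finite {a \<in> A. w a = i}" "finite {b \<in> B. v b = i}" for i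
    using assms by (auto simp: finite_fibers_def)
  show ?fin
    unfolding finite_fibers_def eq using fin by auto
  have "card (\<Union>i\<in>{0..n}. {a \<in> A. w a = i} \<times> {b \<in> B. v b = n - i})
     = (\<Sum>i=0..n. card {a \<in> A. w a = i} * card {b \<in> B. v b = n - i})" for n
    by (subst card_UN_disjoint) (use fin in \<open>auto simp: card_cartesian_product\<close>)
  then show ?gf
    unfolding genfun_def eq by (simp add: fps_eq_iff fps_mult_nth)
qed

lemma genfun_multiples:
  assumes "c > 0"
  shows "genfun UNIV (\<lambda>m. c * m) = inverse (1 - fps_X ^ c)" "finite_fibers UNIV (\<lambda>m. c * m)"
proof -
  have eq: "{m. c * m = n} = (if c dvd n then {n div c} else {})" for n
    using assms by auto
  show "finite_fibers UNIV (\<lambda>m. c * m)"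
    by (auto simp: finite_fibers_def eq)
  have "(1 - fps_X ^ c) * genfun UNIV (\<lambda>m. c * m) = (1 :: real fps)"
  proof (rule fps_ext)
    fix n
    show "((1 - fps_X ^ c) * genfun UNIV (\<lambda>m. c * m)) $ n = (1 :: real fps) $ n"
      using assms
      by (auto simp: genfun_def eq left_diff_distrib fps_X_power_mult_nth dvd_minus_self not_less dest: dvd_imp_le)
  qed
  then show "genfun UNIV (\<lambda>m. c * m) = inverse (1 - fps_X ^ c)"
    using fps_inverse_unique by metis
qed

lemma genfun_weighted_sum:
  assumes "b > 0"
  shows "genfun {ks. length ks = n} (weighted_sum b) = (\<Prod>i<n. inverse (1 - fps_X ^ (b + i)))
    \<and> finite_fibers {ks. length ks = n} (weighted_sum b)"
  using assms
proof (induction n arbitrary: b)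
  case 0
  have "{a. length a = 0 \<and> weighted_sum b a = n} = (if n = 0 then {[]} else {})" for n
    by auto
  then show ?case
    by (auto simp: genfun_def finite_fibers_def fps_eq_iff)
next
  case (Suc n)
  have W: "wequiv {ks. length ks = Suc n} (weighted_sum b)
      (UNIV \<times> {ks. length ks = n}) (\<lambda>(m, ks). b * m + weighted_sum (Suc b) ks)"
  proof (rule wequivI[where f = "\<lambda>ks. (hd ks, tl ks)"])
    show "bij_betw (\<lambda>ks. (hd ks, tl ks)) {ks. length ks = Suc n} (UNIV \<times> {ks. length ks = n})"
      by (rule bij_betw_byWitness[where f' = "\<lambda>(k, ks). k # ks"]) (auto simp: length_Suc_conv)
  qed (auto simp: length_Suc_conv)
  note T = genfun_times[OF genfun_multiples(2)[OF Suc.prems] conjunct2[OF Suc.IH[of "Suc b"]]]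
  have "genfun {ks. length ks = Suc n} (weighted_sum b)
      = inverse (1 - fps_X ^ b) * (\<Prod>i<n. inverse (1 - fps_X ^ (Suc b + i)))"
    unfolding genfun_wequiv[OF W] using T(1) Suc.IH[of "Suc b"] genfun_multiples(1)[OF Suc.prems] by simp
  also have "\<dots> = (\<Prod>i<Suc n. inverse (1 - fps_X ^ (b + i)))"
    unfolding prod.lessThan_Suc_shift by simp
  finally show ?case
    using finite_fibers_wequiv[OF W T(2)] by simp
qed

lemma genfun_matrix_weight:
  "genfun (matrices m n) matrix_weight = (\<Prod>j<m. \<Prod>i<n. inverse (1 - fps_X ^ (Suc j + i)))
    \<and> finite_fibers (matrices m n) matrix_weight"
proof (induction m)
  case 0
  have "{a. (length a = 0 \<and> (\<forall>ks\<in>set a. length ks = n)) \<and> matrix_weight a = k}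
      = (if k = 0 then {[]} else {})" for k
    by auto
  then show ?case
    by (auto simp: genfun_def finite_fibers_def fps_eq_iff)
next
  case (Suc m)
  have W: "wequiv (matrices (Suc m) n) matrix_weight
      ({ks. length ks = n} \<times> matrices m n) (\<lambda>(ks, kss). weighted_sum (Suc m) ks + matrix_weight kss)"
  proof (rule wequivI[where f = "\<lambda>ks. (hd ks, tl ks)"])
    show "bij_betw (\<lambda>ks. (hd ks, tl ks)) (matrices (Suc m) n) ({ks. length ks = n} \<times> matrices m n)"
      by (rule bij_betw_byWitness[where f' = "\<lambda>(k, ks). k # ks"]) (auto simp: length_Suc_conv)
  qed (auto simp: length_Suc_conv)
  note G = genfun_weighted_sum[of "Suc m" n, simplified]
  note T = genfun_times[OF conjunct2[OF G] conjunct2[OF Suc.IH]]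
  have "genfun (matrices (Suc m) n) matrix_weight
      = (\<Prod>i<n. inverse (1 - fps_X ^ (Suc m + i))) * (\<Prod>j<m. \<Prod>i<n. inverse (1 - fps_X ^ (Suc j + i)))"
    unfolding genfun_wequiv[OF W] using T(1) Suc.IH G by simp
  then show ?case
    using finite_fibers_wequiv[OF W] T(2) by (simp add: mult.commute)
qed

text \<open>The chains of diagonals start and end at the zero sequence. After all exchanges the
  descents left over start at zero and hence are zero throughout, so the \<open>N\<close> by
  \<open>N\<close> matrix alone carries the weight.\<close>

lemma pp_eq_box_coeff:
  assumes "n \<le> N"
  shows "real (pp n) = (\<Prod>j<N. \<Prod>i<N. inverse (1 - fps_X ^ (Suc j + i)) :: real fps) $ n"
proof (cases N)
  case 0
  then have "n = 0" using assms by simp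
  have "{p. plane_partition_of p 0} = {\<lambda>_ _. 0}"
  proof (intro equalityI subsetI)
    fix p assume "p \<in> {p. plane_partition_of p 0}"
    then show "p \<in> {\<lambda>_ _. 0}"
      using plane_partition_of_entry_le[of p 0] by (auto simp: fun_eq_iff)
  qed (auto simp: plane_partition_of_def monotone_on_def)
  then show ?thesis using 0 \<open>n = 0\<close> by (simp add: pp_def)
next
  case (Suc M)
  have f0: "fsupp (\<lambda>_. 0)" by (simp add: fsupp_def)
  have D: "down_chains n (\<lambda>_. 0) = {replicate n (\<lambda>_. 0)}" for n
  proof (induction n)
    case (Suc n)
    have "interlaces (\<lambda>_. 0) k \<longleftrightarrow> k = (\<lambda>_. 0)" for k
      by (auto simp: interlaces_def)
    then show ?case using Suc by auto
  qed auto
  have W: "wequiv (updown_chains N N (\<lambda>_. 0)) total (matrices N N) matrix_weight"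
  proof -
    have "wequiv (updown_chains N N (\<lambda>_. 0)) total (matrices N N \<times> down_chains N (\<lambda>_. 0))
       (\<lambda>(kss, s). N * psize (\<lambda>_. 0) + matrix_weight kss + total s)"
      by (rule wequiv_updown_chains[OF f0])
    also have "wequiv (matrices N N \<times> down_chains N (\<lambda>_. 0))
       (\<lambda>(kss, s). N * psize (\<lambda>_. 0) + matrix_weight kss + total s) (matrices N N) matrix_weight"
      by (rule wequivI[where f = fst]) (auto simp: bij_betw_def inj_on_def D sum_list_replicate)
    finally show ?thesis .
  qed
  have "pp n = card {s \<in> updown_chains N N (\<lambda>_. 0). total s = n}"
    unfolding pp_def using bij_betw_same_card[OF bij_betw_diagonals[of n M]] assms Suc by simp
  then have "real (pp n) = genfun (updown_chains N N (\<lambda>_. 0)) total $ n"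
    by (simp add: genfun_def)
  also have "\<dots> = genfun (matrices N N) matrix_weight $ n"
    using genfun_wequiv[OF W] by simp
  finally show ?thesis
    using genfun_matrix_weight by simp
qed

section \<open>From the square box to the infinite product\<close>

definition macmahon :: "nat \<Rightarrow> real fps" where
  "macmahon M = (\<Prod>m<M. inverse ((1 - fps_X ^ Suc m) ^ Suc m))"

text \<open>Congruence modulo \<open>fps_X ^ Suc n\<close>.\<close>

definition fps_cong :: "nat \<Rightarrow> real fps \<Rightarrow> real fps \<Rightarrow> bool" where
  "fps_cong n f g \<longleftrightarrow> (\<forall>i\<le>n. f $ i = g $ i)"

lemma fps_cong_mult: "fps_cong n f g \<Longrightarrow> fps_cong n f' g' \<Longrightarrow> fps_cong n (f * f') (g * g')"
  by (auto simp: fps_cong_def fps_mult_nth intro!: sum.cong)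

lemma fps_cong_prod: "(\<And>x. x \<in> A \<Longrightarrow> fps_cong n (f x) (g x)) \<Longrightarrow> fps_cong n (prod f A) (prod g A)"
proof (induction A rule: infinite_finite_induct)
  case (insert x A)
  then show ?case by (simp add: fps_cong_mult)
qed (auto simp: fps_cong_def)

lemma fps_cong_inverse_one_minus: "n < k \<Longrightarrow> fps_cong n (inverse (1 - fps_X ^ k)) 1"
proof -
  assume k: "n < k"
  have "inverse (1 - fps_X ^ k) = (1 :: real fps) + fps_X ^ k * inverse (1 - fps_X ^ k)"
  proof -
    have "(1 - fps_X ^ k) * inverse (1 - fps_X ^ k) = (1 :: real fps)"
      using k by (intro inverse_mult_eq_1') simp
    then show ?thesis by (simp add: algebra_simps)
  qed
  then have "inverse (1 - fps_X ^ k) $ i = ((1 :: real fps) + fps_X ^ k * inverse (1 - fps_X ^ k)) $ i" for i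
    by simp
  then show ?thesis
    using k unfolding fps_cong_def by (simp add: fps_X_power_mult_nth)
qed

text \<open>Group the factors of the box product by \<open>m = j + i\<close>. Each
  \<open>m < M\<close> comes from \<open>m + 1\<close> pairs, which explains the exponent; all other
  pairs give factors congruent to 1 up to degree \<open>n\<close>.\<close>

lemma pp_eq_macmahon_coeff:
  assumes "n \<le> M"
  shows "real (pp n) = macmahon M $ n"
proof -
  let ?g = "\<lambda>k. inverse (1 - fps_X ^ Suc k) :: real fps"
  have "(\<Prod>j<M. \<Prod>i<M. ?g (j + i)) = (\<Prod>(j, i)\<in>{..<M} \<times> {..<M}. ?g (j + i))"
    by (simp add: prod.cartesian_product)
  also have "\<dots> = (\<Prod>(j, i)\<in>{(j, i). j + i < M}. ?g (j + i))
       * (\<Prod>(j, i)\<in>{..<M} \<times> {..<M} - {(j, i). j + i < M}. ?g (j + i))"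
    by (subst mult.commute, rule prod.subset_diff) auto
  finally have A: "(\<Prod>j<M. \<Prod>i<M. ?g (j + i)) = \<dots>" .
  have "(\<Prod>(j, i)\<in>{(j, i). j + i < M}. ?g (j + i)) = (\<Prod>m<M. \<Prod>j\<le>m. ?g m)"
    by (subst prod.triangle_reindex) simp
  also have "\<dots> = macmahon M"
    unfolding macmahon_def by (simp add: fps_inverse_power del: power_Suc)
  finally have B: "(\<Prod>(j, i)\<in>{(j, i). j + i < M}. ?g (j + i)) = macmahon M" .
  have "fps_cong n (\<Prod>(j, i)\<in>{..<M} \<times> {..<M} - {(j, i). j + i < M}. ?g (j + i)) (\<Prod>x\<in>{..<M} \<times> {..<M} - {(j, i). j + i < M}. 1)"
    by (rule fps_cong_prod) (use assms in \<open>auto simp: not_less simp del: power_Suc intro!: fps_cong_inverse_one_minus\<close>)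
  then have "fps_cong n (macmahon M * (\<Prod>(j, i)\<in>{..<M} \<times> {..<M} - {(j, i). j + i < M}. ?g (j + i))) (macmahon M * 1)"
    by (intro fps_cong_mult) (auto simp: fps_cong_def)
  then show ?thesis
    using pp_eq_box_coeff[OF assms] A B by (simp add: fps_cong_def)
qed

lemma pp_0: "pp 0 = 1"
  using pp_eq_macmahon_coeff[of 0 0] by (simp add: macmahon_def)

theorem has_prod_macmahon:
  "(\<lambda>m. inverse ((1 - fps_X ^ Suc m) ^ Suc m) :: real fps) has_prod Abs_fps (\<lambda>n. real (pp n))"
proof -
  have "(\<lambda>n. \<Prod>i\<le>n. inverse ((1 - fps_X ^ Suc i) ^ Suc i) :: real fps) \<longlonglongrightarrow> Abs_fps (\<lambda>n. real (pp n))"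
    unfolding tendsto_fps_iff
  proof
    fix n
    have "(\<Prod>i\<le>N. inverse ((1 - fps_X ^ Suc i) ^ Suc i) :: real fps) $ n = Abs_fps (\<lambda>n. real (pp n)) $ n"
      if "N \<ge> n" for N
      using pp_eq_macmahon_coeff[of n "Suc N"] that by (simp add: macmahon_def lessThan_Suc_atMost)
    then show "\<forall>\<^sub>F N in sequentially. (\<Prod>i\<le>N. inverse ((1 - fps_X ^ Suc i) ^ Suc i) :: real fps) $ n
        = Abs_fps (\<lambda>n. real (pp n)) $ n"
      using eventually_at_top_linorder by blast
  qed
  \<comment> \<open>A limit of 0 would not count as convergence for \<open>has_prod\<close>.\<close>
  moreover have "Abs_fps (\<lambda>n. real (pp n)) $ 0 \<noteq> (0 :: real fps) $ 0"
    by (simp add: pp_0)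
  then have "Abs_fps (\<lambda>n. real (pp n)) \<noteq> 0"
    by metis
  ultimately show ?thesis
    by (simp add: has_prod_def raw_has_prod_def)
qed

section \<open>The recurrence with sums of squared divisors\<close>

definition sigma2 :: "nat \<Rightarrow> nat" where
  "sigma2 n = (\<Sum>d | d dvd n. d\<^sup>2)"

lemma sigma2_0 [simp]: "sigma2 0 = 0"
  by (simp add: sigma2_def)

definition pp_fps :: "real fps" where
  "pp_fps = Abs_fps (\<lambda>n. real (pp n))"

definition sigma2_fps :: "real fps" where
  "sigma2_fps = Abs_fps (\<lambda>n. real (sigma2 n))"

text \<open>For the factor (1 - X^k)^(-k), X times the logarithmic derivative is k^2 X^k / (1 -
  X^k), which has coefficient k^2 at every positive multiple of k. In the proof this series is
  \<open>T\<close>.\<close>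

lemma log_deriv_macmahon:
  "fps_X * fps_deriv (macmahon M)
     = macmahon M * (\<Sum>m<M. Abs_fps (\<lambda>n. if n > 0 \<and> Suc m dvd n then real ((Suc m)\<^sup>2) else 0))"
proof (induction M)
  case (Suc M)
  define k where "k = Suc M"
  define D :: "real fps" where "D = 1 - fps_X ^ k"
  define E where "E = inverse (D ^ k)"
  define T :: "real fps" where "T = Abs_fps (\<lambda>n. if n > 0 \<and> k dvd n then real (k\<^sup>2) else 0)"
  have TD: "T * D = of_nat (k ^ 2) * fps_X ^ k"
  proof (rule fps_ext)
    fix n
    have "k > 0" by (simp add: k_def)
    have "(T * D) $ n = T $ n - (if n < k then 0 else T $ (n - k))"
      by (simp add: D_def right_diff_distrib fps_X_power_mult_right_nth)
    also have "\<dots> = (if n = k then real (k\<^sup>2) else 0)"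
      using \<open>k > 0\<close> by (auto simp: T_def dvd_minus_self not_less dest: dvd_imp_le)
    also have "\<dots> = (of_nat (k ^ 2) * fps_X ^ k :: real fps) $ n"
      by (simp add: fps_X_power_nth fps_mult_of_nat_nth del: of_nat_power)
    finally show "(T * D) $ n = (of_nat (k ^ 2) * fps_X ^ k :: real fps) $ n" .
  qed
  have D0: "D $ 0 = 1" by (simp add: D_def k_def)
  have ED: "E * D ^ k = 1"
    unfolding E_def using D0 by (intro inverse_mult_eq_1) (simp add: fps_power_zeroth)
  have dD: "fps_X * fps_deriv D = - (of_nat k * fps_X ^ k)"
  proof -
    have "fps_X * fps_deriv (fps_X ^ j) = (of_nat j * fps_X ^ j :: real fps)" for j
      by (induction j) (simp_all add: algebra_simps)
    then show ?thesis by (simp add: D_def)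
  qed
  have "fps_deriv (E * D ^ k) = 0" by (simp add: ED)
  then have "fps_deriv E * D ^ k + E * (of_nat k * fps_deriv D * D ^ (k - 1)) = 0"
    by (simp add: fps_deriv_power fps_of_nat algebra_simps)
  then have "fps_X * (fps_deriv E * D ^ k + E * (of_nat k * fps_deriv D * D ^ (k - 1))) = 0"
    by simp
  then have "fps_X * fps_deriv E * D ^ k = - (E * of_nat k * (fps_X * fps_deriv D) * D ^ (k - 1))"
    by (simp add: algebra_simps eq_neg_iff_add_eq_0)
  also have "\<dots> = E * (of_nat (k\<^sup>2) * fps_X ^ k) * D ^ (k - 1)"
    unfolding dD by (simp add: power2_eq_square algebra_simps)
  also have "\<dots> = E * T * (D * D ^ (k - 1))"
    unfolding TD[symmetric] by (simp add: algebra_simps)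
  also have "D * D ^ (k - 1) = D ^ k"
    by (simp add: k_def)
  finally have "(fps_X * fps_deriv E) * D ^ k = (E * T) * D ^ k" .
  moreover have "D \<noteq> 0" using D0 by auto
  ultimately have E': "fps_X * fps_deriv E = E * T"
    by simp
  have P: "macmahon (Suc M) = macmahon M * E"
    by (simp add: macmahon_def E_def D_def k_def del: power_Suc)
  have S: "(\<Sum>m<Suc M. Abs_fps (\<lambda>n. if n > 0 \<and> Suc m dvd n then real ((Suc m)\<^sup>2) else 0))
     = (\<Sum>m<M. Abs_fps (\<lambda>n. if n > 0 \<and> Suc m dvd n then real ((Suc m)\<^sup>2) else 0)) + T"
    unfolding T_def k_def by (rule sum.lessThan_Suc)
  have "fps_X * fps_deriv (macmahon (Suc M))
      = E * (fps_X * fps_deriv (macmahon M)) + macmahon M * (fps_X * fps_deriv E)"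
    unfolding P by (simp add: algebra_simps)
  then show ?case
    unfolding Suc.IH E' S by (simp add: P algebra_simps)
qed (simp add: macmahon_def)

theorem pp_recurrence: "n * pp n = (\<Sum>k=1..n. sigma2 k * pp (n - k))"
proof -
  let ?L = "\<Sum>m<n. Abs_fps (\<lambda>j. if j > 0 \<and> Suc m dvd j then real ((Suc m)\<^sup>2) else 0)"
  have L: "?L $ j = real (sigma2 j)" if "j \<le> n" for j
  proof (cases "j = 0")
    case True
    then show ?thesis by (simp add: fps_sum_nth)
  next
    case False
    have "?L $ j = (\<Sum>m<n. if Suc m dvd j then real ((Suc m)\<^sup>2) else 0)"
      using False by (simp add: fps_sum_nth)
    also have "\<dots> = (\<Sum>m\<in>{m. m < n \<and> Suc m dvd j}. real ((Suc m)\<^sup>2))"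
      by (subst sum.inter_filter[symmetric]) auto
    also have "\<dots> = (\<Sum>d | d dvd j. real (d\<^sup>2))"
    proof (rule sum.reindex_bij_witness[where i = "\<lambda>d. d - 1" and j = Suc])
      fix d assume "d \<in> {d. d dvd j}"
      then have "d > 0" "d \<le> j" using False by (auto dest: dvd_imp_le intro: Nat.gr0I)
      then show "Suc (d - 1) = d" "d - 1 \<in> {m. m < n \<and> Suc m dvd j}"
        using \<open>d \<in> _\<close> that by auto
    qed auto
    finally show ?thesis by (simp add: sigma2_def)
  qed
  have "real (n * pp n) = (fps_X * fps_deriv (macmahon n)) $ n"
    using pp_eq_macmahon_coeff[of n n] by (cases n) (auto simp: algebra_simps)
  also have "\<dots> = (\<Sum>i=0..n. ?L $ i * macmahon n $ (n - i))"
    unfolding log_deriv_macmahon by (subst mult.commute) (simp add: fps_mult_nth)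
  also have "\<dots> = (\<Sum>i=0..n. real (sigma2 i * pp (n - i)))"
    by (intro sum.cong) (auto simp: L pp_eq_macmahon_coeff[of _ n])
  also have "\<dots> = (\<Sum>i=1..n. real (sigma2 i * pp (n - i)))"
    by (simp add: sum.atLeast_Suc_atMost)
  finally show ?thesis
    by (simp only: of_nat_sum[symmetric] of_nat_eq_iff)
qed

lemma pp_fps_log_deriv: "fps_X * fps_deriv pp_fps = pp_fps * sigma2_fps"
proof (rule fps_ext)
  fix n
  have "(fps_X * fps_deriv pp_fps) $ n = real (n * pp n)"
    by (cases n) (auto simp: pp_fps_def algebra_simps)
  also have "\<dots> = (\<Sum>k=1..n. real (sigma2 k * pp (n - k)))"
    unfolding pp_recurrence by simp
  also have "\<dots> = (\<Sum>k=0..n. real (sigma2 k * pp (n - k)))"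
    by (simp add: sum.atLeast_Suc_atMost)
  also have "\<dots> = (sigma2_fps * pp_fps) $ n"
    by (simp add: fps_mult_nth sigma2_fps_def pp_fps_def)
  finally show "(fps_X * fps_deriv pp_fps) $ n = (pp_fps * sigma2_fps) $ n"
    by (simp add: mult.commute)
qed

section \<open>A certified table\<close>

text \<open>The tables have entries of type \<^typ>\<open>int\<close>, whose code equations compute in binary.
  The list \<open>sigma2_table\<close> starts at \<open>sigma2 1\<close>, the list \<open>pp_table\<close> at \<open>pp 0\<close>.\<close>

definition sigma2_table :: "int list" where
  "sigma2_table = [
    1, 5, 10, 21, 26, 50, 50, 85, 91, 130, 122, 210, 170, 250, 260, 341, 290, 455, 362, 546, 500,
    610, 530, 850, 651, 850, 820, 1050, 842, 1300, 962, 1365, 1220, 1450, 1300, 1911, 1370, 1810,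
    1700, 2210, 1682, 2500, 1850, 2562, 2366, 2650, 2210, 3410, 2451, 3255, 2900, 3570, 2810, 4100,
    3172, 4250, 3620, 4210, 3482, 5460, 3722, 4810, 4550, 5461, 4420, 6100, 4490, 6090, 5300, 6500,
    5042, 7735, 5330, 6850, 6510, 7602, 6100, 8500, 6242, 8866, 7381, 8410, 6890, 10500, 7540, 9250,
    8420, 10370, 7922, 11830, 8500, 11130, 9620, 11050, 9412, 13650, 9410, 12255, 11102, 13671,
    10202, 14500, 10610, 14450, 13000, 14050, 11450, 17220, 11882, 15860, 13700, 17050, 12770,
    18100, 13780, 17682, 15470, 17410, 14500, 22100, 14763, 18610, 16820, 20202, 16276, 22750,
    16130, 21845, 18500, 22100, 17162, 25620, 18100, 22450, 21320, 24650, 18770, 26500, 19322,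
    27300, 22100, 25210, 20740, 31031, 21892, 26650, 24510, 28770, 22202, 32550, 22802, 30770,
    26390, 30500, 25012, 35700, 24650, 31210, 28100, 35490, 26500, 36905, 26570, 35322, 31720,
    34450, 27890, 42500, 28731, 37700, 32942, 38850, 29930, 42100, 32550, 41602, 34820, 39610,
    32042, 49686, 32762, 42500, 37220, 45050, 35620, 48100, 35380, 46410, 41000, 47060, 36482,
    54610, 37250, 47050, 44200, 51471, 38810, 55510, 39602, 55335, 44900]"

definition pp_table :: "int list" where
  "pp_table = [
    1, 1, 3, 6, 13, 24, 48, 86, 160, 282, 500, 859, 1479, 2485, 4167, 6879, 11297, 18334, 29601,
    47330, 75278, 118794, 186475, 290783, 451194, 696033, 1068745, 1632658, 2483234, 3759612,
    5668963, 8512309, 12733429, 18974973, 28175955, 41691046, 61484961, 90379784, 132441995,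
    193487501, 281846923, 409383981, 593001267, 856667495, 1234363833, 1774079109, 2543535902,
    3637993036, 5191304973, 7391026522, 10499640707, 14883573114, 21053676445, 29720561230,
    41871334614, 58874385349, 82623976486, 115737404664, 161825846160, 225863047430, 314689799781,
    437699333376, 607771804065, 842541287719, 1166117605448, 1611415838202, 2223312543970,
    3062906627106, 4213276093961, 5787232662336, 7937771067795, 10872114256046, 14870591703377,
    20311959869076, 27707354427729, 37745732428153, 51354666391773, 69781543686979, 94701959299374,
    128364196860773, 173781688194937, 234989042219523, 317382398602028, 428171324714100,
    576978362008262, 776633557947931, 1044226582040722, 1402498445554353, 1881680993051046,
    2521925777635221, 3376508618954817, 4516053506209319, 6034095681424573, 8054401761691018,
    10740594259633282, 14308794779412286, 19044219737399823, 25322945742768655, 33640433065994170,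
    44648874867815365, 59206066030052023, 78439293700357398, 103828804854575647, 137316765340748719,
    181449391626745928, 239562215450944137, 316021397636306406, 416537818017241498,
    548575601658379427, 721883096239454718, 949182527469523938, 1247065128647762745,
    1637152176324093054, 2147599898026689140, 2815048804548720144, 3687147014923669040,
    4825814464642705036, 6311462786100001944, 8248447176613819344, 10772105450365375110,
    14057840661556747838, 18332833286777843181, 23891135000922598621, 31113108526215845490,
    40490449891678761817, 52658376905566496345, 68437011759141946361, 88884552727586169570,
    115365553885986138909, 149638555157335279224, 193968482613020132327, 251270739456205494821,
    325295819644181541216, 420865709344199816940, 544176437900249995295, 703185077691811744728,
    908104498141674012315, 1172035538726987796895, 1511774342460095420742, 1948842842148010077610,
    2510803397346698360787, 3232935070946522416377, 4160369936832220680802, 5350814289433647253400,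
    6878013156958149667114, 8836158957987629600473, 11345498830377491493243,
    14559463050357782592634, 18673722769148876046574, 23937693701256154766802,
    30669139297980503425545, 39272699737807175034402, 50263391086791248401862,
    64296393934920940728257, 82204797423730637290803, 105047401323720214735845,
    134169228912949039287309, 171278095963564183185569, 218541452704160865229938,
    278708811988654889282787, 355266455497904629804490, 452632842552473370269719,
    576405323141579582309840, 733671490855787750236063, 933401943740087821163525,
    1186945528235280303834757, 1508653544221474513081866, 1916666163752283499792711,
    2433902807377268551927653, 3089308860861156846221058, 3919424439726932455481904,
    4970357590933597283199550, 6300265198208446181387857, 7982470975264499966300332,
    10109382592684890243935339, 12797410813969092203145839, 16193144538163466498006354,
    20481099381444438788196201, 25893437016882057002359861, 32722151836985252154268327,
    41334345468569987398570526, 52191364299884417719452192, 65872767993555537025883953,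
    83106337299727088689944730, 104805628962565753189854866, 132116958551821405730024982,
    166478156557769638392954705, 209692021292006169914637474, 264018111623671283147441228,
    332287417569898717222320168, 418045559687018487091153244, 525731551683042340388049309,
    660900879890993309967869495, 830503788981492479746361648, 1043232315595314569428800381,
    1309952904308988596987465058, 1644245526827756819010460077, 2063075295240989518792806192,
    2587628848248919062602055775, 3244355585674551210485206229, 4066263490068623016919082185,
    5094531248171978554425113454]"

fun divisor_square_sum :: "int list \<Rightarrow> int \<Rightarrow> int" where
  "divisor_square_sum [] n = 0"
| "divisor_square_sum (d # ds) n = (if n mod d = 0 then d * d else 0) + divisor_square_sum ds n"

text \<open>Invariant: \<open>ds\<close> lists the positive numbers below \<open>n\<close>, largest
  first, so \<open>n # ds\<close> contains all possible divisors.\<close>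

fun sigma2_table_ok :: "int list \<Rightarrow> int \<Rightarrow> int list \<Rightarrow> bool" where
  "sigma2_table_ok ds n [] \<longleftrightarrow> True"
| "sigma2_table_ok ds n (s # ss) \<longleftrightarrow>
     s = divisor_square_sum (n # ds) n \<and> sigma2_table_ok (n # ds) (n + 1) ss"

fun dot :: "int list \<Rightarrow> int list \<Rightarrow> int" where
  "dot (x # xs) (y # ys) = x * y + dot xs ys"
| "dot _ _ = 0"

text \<open>Invariant: \<open>ps\<close> lists the values already checked, latest first. Then
  \<open>dot ss ps\<close>, which stops at the end of the shorter list, is the right-hand side of
  \<open>pp_recurrence\<close>.\<close>

fun pp_table_ok :: "int list \<Rightarrow> int list \<Rightarrow> int \<Rightarrow> int list \<Rightarrow> bool" where
  "pp_table_ok ss ps n [] \<longleftrightarrow> True"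
| "pp_table_ok ss ps n (p # qs) \<longleftrightarrow> n * p = dot ss ps \<and> pp_table_ok ss (p # ps) (n + 1) qs"

lemma divisor_square_sum_upt:
  "divisor_square_sum (map int (rev [1..<Suc k])) (int n)
     = int (\<Sum>d=1..k. if d dvd n then d\<^sup>2 else 0)"
proof (induction k)
  case (Suc k)
  have "rev [1..<Suc (Suc k)] = Suc k # rev [1..<Suc k]"
    by simp
  moreover have "int n mod int (Suc k) = 0 \<longleftrightarrow> Suc k dvd n"
    by (metis int_dvd_int_iff dvd_eq_mod_eq_0)
  ultimately show ?case
    using Suc by (simp only: list.map divisor_square_sum.simps sum.cl_ivl_Suc) (simp add: power2_eq_square algebra_simps)
qed simp

lemma sigma2_eq_sum: "n > 0 \<Longrightarrow> sigma2 n = (\<Sum>d=1..n. if d dvd n then d\<^sup>2 else 0)"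
  unfolding sigma2_def by (subst sum.inter_filter[symmetric]) (auto intro!: sum.cong dest: dvd_imp_le Nat.gr0I)

lemma sigma2_table_ok_nth:
  assumes "sigma2_table_ok (map int (rev [1..<n])) (int n) ss" "n > 0" "i < length ss"
  shows "ss ! i = int (sigma2 (n + i))"
  using assms
proof (induction ss arbitrary: n i)
  case (Cons s ss)
  have eq: "int n # map int (rev [1..<n]) = map int (rev [1..<Suc n])"
    using Cons.prems(2) by simp
  have s: "s = int (sigma2 n)" "sigma2_table_ok (map int (rev [1..<Suc n])) (int (Suc n)) ss"
    using Cons.prems(1,2) unfolding sigma2_table_ok.simps eq divisor_square_sum_upt
    by (simp_all add: sigma2_eq_sum add.commute del: upt_Suc)
  show ?case
  proof (cases i)
    case (Suc j)
    then show ?thesis using Cons.IH[OF s(2), of j] Cons.prems(3) by simp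
  qed (use s in simp)
qed simp

lemma dot_eq_sum: "length ys \<le> length xs \<Longrightarrow> dot xs ys = (\<Sum>i<length ys. xs ! i * ys ! i)"
  by (induction xs ys rule: dot.induct) (auto simp: sum.lessThan_Suc_shift simp del: sum.lessThan_Suc)

lemma pp_table_ok_nth:
  assumes "pp_table_ok ss (map (\<lambda>j. int (pp j)) (rev [0..<n])) (int n) qs"
    and "n > 0" "i < length qs" "n + length qs \<le> length ss + 1"
    and "\<And>i. i < length ss \<Longrightarrow> ss ! i = int (sigma2 (Suc i))"
  shows "qs ! i = int (pp (n + i))"
  using assms(1-4)
proof (induction qs arbitrary: n i)
  case (Cons q qs)
  let ?ps = "map (\<lambda>j. int (pp j)) (rev [0..<n])"
  have "dot ss ?ps = (\<Sum>i<n. ss ! i * ?ps ! i)"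
    using Cons.prems(4) by (subst dot_eq_sum) auto
  also have "\<dots> = (\<Sum>i<n. int (sigma2 (Suc i) * pp (n - Suc i)))"
    using Cons.prems(4) by (intro sum.cong) (auto simp: assms(5) rev_nth)
  also have "\<dots> = (\<Sum>k=1..n. int (sigma2 k * pp (n - k)))"
    by (rule sum.reindex_bij_witness[where i = "\<lambda>k. k - 1" and j = Suc]) auto
  also have "\<dots> = int (n * pp n)"
    unfolding pp_recurrence by simp
  finally have "int n * q = int n * int (pp n)"
    using Cons.prems(1) by simp
  then have q: "q = int (pp n)"
    using Cons.prems(2) by simp
  have ok: "pp_table_ok ss (map (\<lambda>j. int (pp j)) (rev [0..<Suc n])) (int (Suc n)) qs"
    using Cons.prems(1) q by (simp add: add.commute)
  show ?case
  proof (cases i)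
    case (Suc j)
    then show ?thesis using Cons.IH[OF ok, of j] Cons.prems(3,4) by simp
  qed (use q in simp)
qed simp

lemma sigma2_table_correct: "i < length sigma2_table \<Longrightarrow> sigma2_table ! i = int (sigma2 (Suc i))"
proof -
  have "sigma2_table_ok [] 1 sigma2_table"
    by code_simp
  then show "i < length sigma2_table \<Longrightarrow> sigma2_table ! i = int (sigma2 (Suc i))"
    using sigma2_table_ok_nth[of 1 sigma2_table i] by simp
qed

lemma pp_table_correct:
  assumes "n \<le> 201"
  shows "pp_table ! n = int (pp n)"
proof (cases n)
  case 0
  have "pp_table ! 0 = 1"
    by code_simp
  then show ?thesis using 0 by (simp add: pp_0)
next
  case (Suc m)
  have "pp_table_ok sigma2_table [1] 1 (tl pp_table)"
    by code_simp
  moreover have "length sigma2_table = 201" "length (tl pp_table) = 201"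
    by code_simp+
  ultimately have "tl pp_table ! m = int (pp (1 + m))"
    using pp_table_ok_nth[of sigma2_table 1 "tl pp_table" m] sigma2_table_correct assms Suc
    by (simp add: pp_0)
  then show ?thesis
    using Suc \<open>length (tl pp_table) = 201\<close> assms by (simp add: nth_tl)
qed

section \<open>Third differences\<close>

lemma sigma2_ge: "n > 0 \<Longrightarrow> n\<^sup>2 \<le> sigma2 n"
  unfolding sigma2_def by (rule member_le_sum) auto

lemma sigma2_ge_even:
  assumes "m > 0" shows "(2 * m)\<^sup>2 + m\<^sup>2 \<le> sigma2 (2 * m)"
proof -
  have "(\<Sum>d\<in>{2 * m, m}. d\<^sup>2) \<le> sigma2 (2 * m)"
    unfolding sigma2_def by (rule sum_mono2) (use assms in auto)
  then show ?thesis using assms by simp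
qed

lemma sum_inverse_squares_le: "n > 0 \<Longrightarrow> (\<Sum>d=1..n. 1 / (real d)\<^sup>2) \<le> 2 - 1 / real n"
proof (induction n)
  case (Suc n)
  show ?case
  proof (cases "n = 0")
    case False
    have "1 / (real (Suc n))\<^sup>2 \<le> 1 / real n - 1 / real (Suc n)"
    proof -
      have "1 / (real (Suc n))\<^sup>2 \<le> 1 / (real n * real (Suc n))"
        using False by (intro divide_left_mono) (auto simp: power2_eq_square)
      also have "\<dots> = 1 / real n - 1 / real (Suc n)"
        using False by (simp add: field_simps)
      finally show ?thesis .
    qed
    then show ?thesis using Suc.IH False by simp
  qed simp
qed simp

text \<open>Passing from divisors to cofactors writes \<open>sigma2 n\<close> as n^2 times a sum of
  distinct inverse squares, and all inverse squares together stay below 2.\<close>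

lemma sigma2_le: "sigma2 n \<le> 2 * n\<^sup>2"
proof (cases "n = 0")
  case False
  have "real (sigma2 n) = (\<Sum>d | d dvd n. (real d)\<^sup>2)"
    by (simp add: sigma2_def)
  also have "\<dots> = (\<Sum>d | d dvd n. (real n)\<^sup>2 * (1 / (real d)\<^sup>2))"
  proof (rule sum.reindex_bij_witness[where i = "\<lambda>d. n div d" and j = "\<lambda>d. n div d"])
    fix d assume "d \<in> {d. d dvd n}"
    then show "(real n)\<^sup>2 * (1 / (real (n div d))\<^sup>2) = (real d)\<^sup>2"
      using False by (auto elim!: dvdE simp: power2_eq_square)
  qed (use False in \<open>auto simp: div_dvd_iff_mult div_div_eq_right elim!: dvdE\<close>)
  also have "\<dots> \<le> (\<Sum>d=1..n. (real n)\<^sup>2 * (1 / (real d)\<^sup>2))"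
    by (rule sum_mono2) (use False in \<open>auto dest: dvd_imp_le intro!: Nat.gr0I simp: Suc_le_eq\<close>)
  also have "\<dots> = (real n)\<^sup>2 * (\<Sum>d=1..n. 1 / (real d)\<^sup>2)"
    by (simp add: sum_distrib_left)
  also have "\<dots> \<le> (real n)\<^sup>2 * 2"
  proof (rule mult_left_mono)
    have "(\<Sum>d=1..n. 1 / (real d)\<^sup>2) \<le> 2 - 1 / real n"
      using sum_inverse_squares_le False by blast
    also have "\<dots> \<le> 2" by simp
    finally show "(\<Sum>d=1..n. 1 / (real d)\<^sup>2) \<le> 2" .
  qed simp
  also have "\<dots> = real (2 * n\<^sup>2)" by simp
  finally show ?thesis by (simp only: of_nat_le_iff)
qed simp

lemma fps_X_deriv_nth: "fps_nth (fps_X * fps_deriv f) n = real n * fps_nth f n"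
  by (cases n) auto

definition pp_diff3 :: "nat \<Rightarrow> real" where
  "pp_diff3 n = fps_nth ((1 - fps_X) ^ 3 * pp_fps) n"

lemma pp_diff3_eq:
  "pp_diff3 0 = real (pp 0)"
  "pp_diff3 1 = real (pp 1) - 3 * real (pp 0)"
  "pp_diff3 2 = real (pp 2) - 3 * real (pp 1) + 3 * real (pp 0)"
  "pp_diff3 (n + 3) = real (pp (n + 3)) - 3 * real (pp (n + 2)) + 3 * real (pp (n + 1)) - real (pp n)"
proof -
  have e: "(1 - fps_X) ^ 3 * pp_fps
     = pp_fps - 3 * (fps_X * pp_fps) + 3 * (fps_X ^ 2 * pp_fps) - fps_X ^ 3 * pp_fps"
    by (simp add: power3_eq_cube power2_eq_square algebra_simps)
  show "pp_diff3 0 = real (pp 0)"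
    "pp_diff3 1 = real (pp 1) - 3 * real (pp 0)"
    "pp_diff3 2 = real (pp 2) - 3 * real (pp 1) + 3 * real (pp 0)"
    "pp_diff3 (n + 3) = real (pp (n + 3)) - 3 * real (pp (n + 2)) + 3 * real (pp (n + 1)) - real (pp n)"
    unfolding pp_diff3_def e
    by (simp_all add: fps_X_power_mult_nth pp_fps_def numeral_fps_const fps_mult_left_const_nth)
qed

text \<open>The factor (1 - X)^3 adds -3X / (1 - X) to X times the logarithmic derivative, so every
  \<open>sigma2 k\<close> with \<open>k > 0\<close> drops by 3.\<close>

lemma pp_diff3_recurrence:
  "real n * pp_diff3 n = (\<Sum>k=1..n. (real (sigma2 k) - 3) * pp_diff3 (n - k))"
proof -
  define J :: "real fps" where "J = Abs_fps (\<lambda>n. if n = 0 then 0 else 1)"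
  define G where "G = (1 - fps_X) ^ 3 * pp_fps"
  have J: "J * (1 - fps_X) = fps_X"
  proof (rule fps_ext)
    fix n
    show "fps_nth (J * (1 - fps_X)) n = fps_nth fps_X n"
      by (cases n) (auto simp: J_def right_diff_distrib)
  qed
  have "fps_deriv ((1 - fps_X) ^ 3 :: real fps) = - (3 * (1 - fps_X) ^ 2)"
    by (simp add: power3_eq_cube power2_eq_square algebra_simps)
  then have "fps_X * fps_deriv G = (1 - fps_X) ^ 3 * (fps_X * fps_deriv pp_fps)
      - 3 * (1 - fps_X) ^ 2 * fps_X * pp_fps"
    unfolding G_def by (simp add: algebra_simps)
  also have "\<dots> = (1 - fps_X) ^ 3 * (pp_fps * sigma2_fps) - 3 * (1 - fps_X) ^ 2 * (J * (1 - fps_X)) * pp_fps"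
    unfolding pp_fps_log_deriv J ..
  also have "\<dots> = (sigma2_fps - 3 * J) * G"
    unfolding G_def by (simp add: power3_eq_cube power2_eq_square algebra_simps)
  finally have E: "fps_X * fps_deriv G = (sigma2_fps - 3 * J) * G" .
  have c: "fps_nth (sigma2_fps - 3 * J) k = (if k = 0 then 0 else real (sigma2 k) - 3)" for k
    by (simp add: sigma2_fps_def J_def numeral_fps_const fps_mult_left_const_nth)
  have "real n * pp_diff3 n = fps_nth (fps_X * fps_deriv G) n"
    by (simp only: fps_X_deriv_nth pp_diff3_def G_def)
  also have "\<dots> = (\<Sum>k=0..n. fps_nth (sigma2_fps - 3 * J) k * pp_diff3 (n - k))"
    unfolding E by (simp add: fps_mult_nth pp_diff3_def G_def)
  also have "\<dots> = (\<Sum>k=1..n. (real (sigma2 k) - 3) * pp_diff3 (n - k))"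
    unfolding c by (simp add: sum.atLeast_Suc_atMost)
  finally show ?thesis .
qed

fun third_differences_ok :: "int list \<Rightarrow> bool" where
  "third_differences_ok (a # b # c # d # xs) \<longleftrightarrow>
     d - 3 * c + 3 * b - a \<ge> 0 \<and> third_differences_ok (b # c # d # xs)"
| "third_differences_ok _ \<longleftrightarrow> True"

lemma third_differences_ok_nth:
  assumes "third_differences_ok xs" "i + 3 < length xs"
  shows "xs ! (i + 3) - 3 * xs ! (i + 2) + 3 * xs ! (i + 1) - xs ! i \<ge> 0"
  using assms
proof (induction xs arbitrary: i rule: third_differences_ok.induct)
  case (1 a b c d xs)
  show ?case
  proof (cases i)
    case 0
    then show ?thesis using 1 by (simp add: numeral_2_eq_2 numeral_3_eq_3)
  next
    case (Suc j)
    then show ?thesis using 1(1)[of j] 1(2,3) by simp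
  qed
qed auto

lemma pp_table_length: "length pp_table = 202"
  by code_simp

lemma pp_diff3_nonneg_small:
  assumes "n \<ge> 4" "n \<le> 201"
  shows "pp_diff3 n \<ge> 0"
proof -
  obtain i where n: "n = i + 4" using assms(1) le_Suc_ex by (metis add.commute)
  have "third_differences_ok (tl pp_table)"
    by code_simp
  moreover have i4: "i + 4 = Suc (Suc (Suc (Suc i)))" by simp
  ultimately
  have "pp_table ! (i + 4) - 3 * pp_table ! (i + 3) + 3 * pp_table ! (i + 2) - pp_table ! (i + 1) \<ge> 0"
    using third_differences_ok_nth[of "tl pp_table" i] assms n
    by (simp add: nth_tl pp_table_length numeral_2_eq_2 numeral_3_eq_3 i4)
  then have "int (pp (i + 4)) - 3 * int (pp (i + 3)) + 3 * int (pp (i + 2)) - int (pp (i + 1)) \<ge> 0"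
    using assms n by (simp add: pp_table_correct)
  then have "real_of_int (int (pp (i + 4)) - 3 * int (pp (i + 3)) + 3 * int (pp (i + 2)) - int (pp (i + 1))) \<ge> 0"
    by simp
  then show ?thesis
    using pp_diff3_eq(4)[of "i + 1"] n by (simp add: add.commute numeral_3_eq_3 i4)
qed

lemma pp_small: "pp 0 = 1" "pp 1 = 1" "pp 2 = 3" "pp 3 = 6" "pp 4 = 13"
proof -
  have "take 5 pp_table = [1, 1, 3, 6, 13]"
    by code_simp
  then have "pp_table ! i = [1, 1, 3, 6, 13] ! i" if "i < 5" for i
    by (metis nth_take that)
  from this[of 0] this[of 1] this[of 2] this[of 3] this[of 4]
  show "pp 0 = 1" "pp 1 = 1" "pp 2 = 3" "pp 3 = 6" "pp 4 = 13"
    by (simp_all add: pp_table_correct)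
qed

lemma pp_diff3_small:
  "pp_diff3 0 = 1" "pp_diff3 1 = -2" "pp_diff3 2 = 3" "pp_diff3 3 = -1" "pp_diff3 4 = 3"
proof -
  have "pp (Suc 0) = 1" "pp (Suc (Suc 0)) = 3" "pp (Suc (Suc (Suc 0))) = 6"
    using pp_small by (simp_all add: eval_nat_numeral)
  then show "pp_diff3 0 = 1" "pp_diff3 1 = -2" "pp_diff3 2 = 3" "pp_diff3 3 = -1" "pp_diff3 4 = 3"
    using pp_diff3_eq(1-3) pp_diff3_eq(4)[of 0] pp_diff3_eq(4)[of 1] by (simp_all add: pp_small)
qed

text \<open>The only negative coefficient of the recurrence is \<open>sigma2 1 - 3 = -2\<close>.
  Multiplying by \<open>n - 1\<close> and expanding \<open>(n - 1) * pp_diff3 (n - 1)\<close> by the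
  recurrence one step earlier removes it; the resulting coefficients \<open>v k\<close> are
  nonnegative for \<open>k\<close> from 2 to \<open>n\<close>. The negative values of
  \<open>pp_diff3\<close> at 1 and 3 then occur only in the last five terms.\<close>

lemma pp_diff3_nonneg: "n \<ge> 4 \<Longrightarrow> pp_diff3 n \<ge> 0"
proof (induction n rule: less_induct)
  case (less n)
  show ?case
  proof (cases "n \<le> 201")
    case True
    then show ?thesis using pp_diff3_nonneg_small less.prems by blast
  next
    case False
    define s where "s k = real (sigma2 k) - 3" for k
    define v where "v k = (real n - 1) * s k - 2 * s (k - 1)" for k
    have s_lo: "s k \<ge> (real k)\<^sup>2 - 3" if "k > 0" for k
      using sigma2_ge[OF that] unfolding s_def by (metis diff_right_mono of_nat_le_iff of_nat_power)
    have s_hi: "s k \<le> 2 * (real k)\<^sup>2 - 3" for k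
      using sigma2_le[of k] of_nat_mono[OF sigma2_le[of k], where 'a = real] unfolding s_def by simp
    have s12: "s 1 = -2" "s 2 = 2" "s 3 = 7"
    proof -
      have "{1..2::nat} = {1, 2}" "{1..3::nat} = {1, 2, 3}" by auto
      then show "s 1 = -2" "s 2 = 2" "s 3 = 7"
        by (simp_all add: s_def sigma2_eq_sum)
    qed
    have v_nonneg: "v k \<ge> 0" if "2 \<le> k" "k \<le> n" for k
    proof -
      consider "k = 2" | "k = 3" | "k \<ge> 4" using \<open>2 \<le> k\<close> by linarith
      then show ?thesis
      proof cases
        case 3
        have "(real k - 1) * ((real k)\<^sup>2 - 3) \<le> (real n - 1) * s k"
        proof (rule mult_mono)
          have "(2::real)\<^sup>2 \<le> (real k)\<^sup>2" using 3 by (intro power_mono) auto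
          then show "0 \<le> (real k)\<^sup>2 - 3" by simp
        qed (use s_lo[of k] 3 \<open>k \<le> n\<close> in auto)
        moreover have "s (k - 1) \<le> 2 * (real k - 1)\<^sup>2"
          using s_hi[of "k - 1"] 3 by (simp add: of_nat_diff)
        moreover have "(real k - 1) * ((real k)\<^sup>2 - 3) - 4 * (real k - 1)\<^sup>2
            = (real k - 1) * (real k * (real k - 4) + 1)"
          by (simp add: power2_eq_square algebra_simps)
        moreover have "\<dots> \<ge> 0" using 3 by simp
        ultimately show ?thesis unfolding v_def by linarith
      qed (use that s12 in \<open>auto simp: v_def\<close>)
    qed
    define m where "m = real n"
    have m: "m \<ge> 202" using False by (simp add: m_def)
    have v_lo: "v k \<ge> (m - 1) * ((real k)\<^sup>2 - 3) - 4 * (m - 1)\<^sup>2" if "k \<ge> 4" "k \<le> n" for k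
    proof -
      have "(m - 1) * ((real k)\<^sup>2 - 3) \<le> (m - 1) * s k"
        using s_lo[of k] m that by (intro mult_left_mono) auto
      moreover have "s (k - 1) \<le> 2 * (real (k - 1))\<^sup>2" using s_hi[of "k - 1"] by linarith
      moreover have "(real (k - 1))\<^sup>2 \<le> (m - 1)\<^sup>2"
        using that by (intro power_mono) (auto simp: m_def)
      ultimately show ?thesis unfolding v_def m_def by linarith
    qed
    have v_hi: "v k \<le> (m - 1) * (2 * (real k)\<^sup>2)" if "k \<ge> 4" for k
    proof -
      have "(m - 1) * s k \<le> (m - 1) * (2 * (real k)\<^sup>2 - 3)"
        using s_hi[of k] m by (intro mult_left_mono) auto
      moreover have "s (k - 1) \<ge> 0"
      proof -
        have "(real (k - 1))\<^sup>2 \<ge> 2\<^sup>2" using that by (intro power_mono) auto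
        then show ?thesis using s_lo[of "k - 1"] that by simp
      qed
      ultimately show ?thesis unfolding v_def m_def[symmetric] using m by (simp add: right_diff_distrib)
    qed
    have "(real n - 1) * (real n * pp_diff3 n)
        = (real n - 1) * (s 1 * pp_diff3 (n - 1) + (\<Sum>k=2..n. s k * pp_diff3 (n - k)))"
      unfolding pp_diff3_recurrence s_def[symmetric] using False
      by (subst sum.atLeast_Suc_atMost) (auto simp: numeral_2_eq_2)
    also have "\<dots> = (\<Sum>k=2..n. (real n - 1) * s k * pp_diff3 (n - k)) - 2 * (real (n - 1) * pp_diff3 (n - 1))"
      using False by (simp add: s12[unfolded One_nat_def] algebra_simps sum_distrib_left of_nat_diff)
    also have "real (n - 1) * pp_diff3 (n - 1) = (\<Sum>k=1..n-1. s k * pp_diff3 (n - 1 - k))"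
      unfolding pp_diff3_recurrence s_def ..
    also have "\<dots> = (\<Sum>k=2..n. s (k - 1) * pp_diff3 (n - k))"
      by (rule sum.reindex_bij_witness[where i = "\<lambda>k. k - 1" and j = Suc]) auto
    also have "(\<Sum>k=2..n. (real n - 1) * s k * pp_diff3 (n - k)) - 2 * \<dots>
        = (\<Sum>k=2..n. v k * pp_diff3 (n - k))"
      by (simp add: v_def sum_distrib_left left_diff_distrib sum_subtractf mult.assoc)
    also have "\<dots> = (\<Sum>k=2..n-5. v k * pp_diff3 (n - k)) + (\<Sum>k=n-4..n. v k * pp_diff3 (n - k))"
    proof -
      have "{2..n} = {2..n-5} \<union> {n-4..n}" using False by auto
      then show ?thesis by (simp add: sum.union_disjoint)
    qed
    also have "(\<Sum>k=n-4..n. v k * pp_diff3 (n - k))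
        = 3 * v (n - 4) - v (n - 3) + 3 * v (n - 2) - 2 * v (n - 1) + v n"
    proof -
      have "(\<Sum>k=n-4..n. v k * pp_diff3 (n - k)) = (\<Sum>i\<in>{0,1,2,3,4}. v (n - i) * pp_diff3 i)"
        by (rule sum.reindex_bij_witness[where i = "\<lambda>i. n - i" and j = "\<lambda>i. n - i"])
          (use False in auto)
      then show ?thesis by (simp add: pp_diff3_small pp_diff3_small(2)[unfolded One_nat_def])
    qed
    finally have eq: "(real n - 1) * (real n * pp_diff3 n) = (\<Sum>k=2..n-5. v k * pp_diff3 (n - k))
       + (3 * v (n - 4) - v (n - 3) + 3 * v (n - 2) - 2 * v (n - 1) + v n)" .
    have "(\<Sum>k=2..n-5. v k * pp_diff3 (n - k)) \<ge> 0"
      using False by (intro sum_nonneg mult_nonneg_nonneg v_nonneg less.IH) auto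
    \<comment> \<open>With k^2 \<le> \<open>sigma2 k\<close> \<le> 2 k^2, the positive values 3, 3,
      1 at the indices 4, 2, 0 contribute at least 7 to leading order, the negative ones at 3 and 1
      at most 2 * (1 + 2) = 6. The positive value at index 4 tips the balance, hence the split at
      \<open>n - 5\<close>.\<close>
    moreover have "3 * v (n - 4) - v (n - 3) + 3 * v (n - 2) - 2 * v (n - 1) + v n \<ge> 0"
    proof -
      have k: "real (n - 4) = m - 4" "real (n - 3) = m - 3" "real (n - 2) = m - 2" "real (n - 1) = m - 1"
        using False by (auto simp: m_def of_nat_diff)
      have "0 \<le> (m - 1) * (m * (m - 44) + 45)"
        using m by simp
      also have "\<dots> = 3 * ((m - 1) * ((m - 4)\<^sup>2 - 3) - 4 * (m - 1)\<^sup>2) - (m - 1) * (2 * (m - 3)\<^sup>2)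
          + 3 * ((m - 1) * ((m - 2)\<^sup>2 - 3) - 4 * (m - 1)\<^sup>2) - 2 * ((m - 1) * (2 * (m - 1)\<^sup>2))
          + ((m - 1) * (m\<^sup>2 - 3) - 4 * (m - 1)\<^sup>2)"
        by (simp add: power2_eq_square algebra_simps)
      also have "\<dots> \<le> 3 * v (n - 4) - v (n - 3) + 3 * v (n - 2) - 2 * v (n - 1) + v n"
      proof -
        have ge: "4 \<le> n - 4" "4 \<le> n - 3" "4 \<le> n - 2" "4 \<le> n - 1" "4 \<le> n"
          "n - 4 \<le> n" "n - 2 \<le> n" "n \<le> n"
          using False by auto
        show ?thesis
          by (intro add_mono diff_mono mult_left_mono v_lo[OF ge(1,6), unfolded k]
              v_hi[OF ge(2), unfolded k] v_lo[OF ge(3,7), unfolded k] v_hi[OF ge(4), unfolded k]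
              v_lo[OF ge(5,8), folded m_def]) simp_all
      qed
      finally show ?thesis .
    qed
    ultimately have "(real n - 1) * (real n * pp_diff3 n) \<ge> 0"
      unfolding eq by simp
    then show ?thesis
      using False by (simp add: zero_le_mult_iff)
  qed
qed

section \<open>Iterated sums of the divisor function\<close>

definition S1 :: "nat \<Rightarrow> real" where "S1 n = (\<Sum>k\<le>n. real (sigma2 k))"
definition S2 :: "nat \<Rightarrow> real" where "S2 n = (\<Sum>k\<le>n. S1 k)"
definition S3 :: "nat \<Rightarrow> real" where "S3 n = (\<Sum>k\<le>n. S2 k)"

definition square_sum :: "nat \<Rightarrow> real" where
  "square_sum x = real x * (real x + 1) * (2 * real x + 1) / 6"

text \<open>The share of the divisor \<open>d\<close> in \<open>S2 (M - 1)\<close>, when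
  \<open>sigma2\<close> is written as a sum of squared cofactors.\<close>

definition square_sum_sum :: "nat \<Rightarrow> nat \<Rightarrow> real" where
  "square_sum_sum d M = (\<Sum>i<M. square_sum (i div d))"

lemma sigma2_eq_sum_cofactor:
  assumes "n > 0" "n \<le> N"
  shows "real (sigma2 n) = (\<Sum>d=1..N. if d dvd n then (real (n div d))\<^sup>2 else 0)"
proof -
  have "real (sigma2 n) = (\<Sum>d | d dvd n. (real d)\<^sup>2)"
    by (simp add: sigma2_def)
  also have "\<dots> = (\<Sum>d | d dvd n. (real (n div d))\<^sup>2)"
    by (rule sum.reindex_bij_witness[where i = "\<lambda>d. n div d" and j = "\<lambda>d. n div d"])
      (use assms in \<open>auto elim!: dvdE\<close>)
  also have "{d. d dvd n} = {d \<in> {1..N}. d dvd n}"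
    using assms by (auto dest: dvd_imp_le intro!: Nat.gr0I simp: Suc_le_eq)
  also have "(\<Sum>d\<in>\<dots>. (real (n div d))\<^sup>2) = (\<Sum>d=1..N. if d dvd n then (real (n div d))\<^sup>2 else 0)"
    by (rule sum.inter_filter) simp
  finally show ?thesis .
qed

text \<open>Going from \<open>j\<close> to \<open>Suc j\<close> changes \<open>j div d\<close> only
  if \<open>d\<close> divides \<open>Suc j\<close>, and then exactly the square of the cofactor is
  added.\<close>

lemma S1_eq: "j \<le> N \<Longrightarrow> S1 j = (\<Sum>d=1..N. square_sum (j div d))"
proof (induction j)
  case 0
  then show ?case by (simp add: S1_def square_sum_def)
next
  case (Suc j)
  have "S1 (Suc j) = S1 j + real (sigma2 (Suc j))"
    by (simp add: S1_def)
  also have "\<dots> = (\<Sum>d=1..N. square_sum (j div d)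
      + (if d dvd Suc j then (real (Suc j div d))\<^sup>2 else 0))"
    using Suc sigma2_eq_sum_cofactor[of "Suc j" N] by (simp add: sum.distrib)
  also have "\<dots> = (\<Sum>d=1..N. square_sum (Suc j div d))"
    by (intro sum.cong refl)
      (auto simp: div_Suc dvd_eq_mod_eq_0 square_sum_def power2_eq_square field_simps)
  finally show ?case .
qed

lemma S2_eq: "K \<le> N \<Longrightarrow> S2 K = (\<Sum>d=1..N. square_sum_sum d (Suc K))"
proof -
  assume "K \<le> N"
  then have "S2 K = (\<Sum>j<Suc K. \<Sum>d=1..N. square_sum (j div d))"
    unfolding S2_def lessThan_Suc_atMost by (intro sum.cong refl S1_eq) auto
  also have "\<dots> = (\<Sum>d=1..N. square_sum_sum d (Suc K))"
    unfolding square_sum_sum_def by (rule sum.swap)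
  finally show ?thesis .
qed

text \<open>Each argument below \<open>M div d\<close> occurs \<open>d\<close> times and
  \<open>M div d\<close> itself occurs \<open>M mod d\<close> times; the values of
  \<open>square_sum\<close> below q sum to q^2 (q^2 - 1) / 12.\<close>

lemma square_sum_sum_closed:
  assumes "d > 0"
  shows "12 * square_sum_sum d M = real d * (real (M div d))\<^sup>2 * ((real (M div d))\<^sup>2 - 1)
      + 12 * real (M mod d) * square_sum (M div d)"
proof (induction M)
  case (Suc M)
  have "12 * square_sum_sum d (Suc M) = 12 * square_sum_sum d M + 12 * square_sum (M div d)"
    by (simp add: square_sum_sum_def)
  also have "\<dots> = real d * (real (Suc M div d))\<^sup>2 * ((real (Suc M div d))\<^sup>2 - 1)
      + 12 * real (Suc M mod d) * square_sum (Suc M div d)"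
  proof (cases "Suc (M mod d) = d")
    case True
    then have eqs: "Suc M div d = Suc (M div d)" "Suc M mod d = 0" "real (M mod d) = real d - 1"
      using mod_Suc[of M d] by (auto simp: div_Suc)
    then show ?thesis
      unfolding Suc.IH eqs by (simp add: square_sum_def power2_eq_square field_simps)
  next
    case False
    then have "Suc M div d = M div d" "Suc M mod d = Suc (M mod d)"
      using mod_Suc[of M d] by (auto simp: div_Suc)
    then show ?thesis
      unfolding Suc.IH by (simp add: algebra_simps)
  qed
  finally show ?case .
qed (simp add: square_sum_sum_def)

text \<open>With \<open>M = d * (q + t)\<close> and 0 \<le> t \<le> 1, dividing by \<open>d\<close>
  leaves polynomial inequalities in \<open>q\<close> and \<open>t\<close>. The gap in the upper
  bound is a positive combination of two squares, the gap in the lower bound a sum of products of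
  nonnegative factors.\<close>

lemma square_sum_sum_bounds:
  assumes "d > 0"
  shows "12 * square_sum_sum d M \<le> (real M)^4 / (real d)^3 + (real M)\<^sup>2 / (2 * real d)"
    and "(real M)^4 / (real d)^3 - (real M)\<^sup>2 / real d \<le> 12 * square_sum_sum d M"
proof -
  define D q t where "D = real d" and "q = real (M div d)" and "t = real (M mod d) / D"
  have D: "D > 0" using assms by (simp add: D_def)
  have r: "real (M mod d) = D * t" using D by (simp add: t_def)
  have t: "0 \<le> t" "t \<le> 1" "0 \<le> q"
    using assms by (auto simp: t_def D_def q_def order.strict_implies_order)
  have "real M = real (d * (M div d) + M mod d)" by simp
  then have M: "real M = D * (q + t)"
    unfolding of_nat_add of_nat_mult r by (simp add: D_def q_def algebra_simps)
  have closed: "12 * square_sum_sum d M = D * (q\<^sup>2 * (q\<^sup>2 - 1) + 2 * t * q * (q + 1) * (2 * q + 1))"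
    unfolding square_sum_sum_closed[OF assms] r square_sum_def
    by (simp add: D_def q_def algebra_simps)
  have Mp: "(real M)^4 / D^3 = D * (q + t)^4" "(real M)\<^sup>2 / D = D * (q + t)\<^sup>2"
    unfolding M using D by (simp_all add: power_mult_distrib power2_eq_square power3_eq_cube power4_eq_xxxx)
  have "(q + t)^4 + (q + t)\<^sup>2 / 2 - (q\<^sup>2 * (q\<^sup>2 - 1) + 2 * t * q * (q + 1) * (2 * q + 1))
     = 3 / 2 * (q * (1 - 2 * t) - t * (1 + 2 * t) / 3)\<^sup>2 + t\<^sup>2 * (1 - t)\<^sup>2 / 3"
    by (simp add: power2_eq_square power4_eq_xxxx field_simps)
  also have "\<dots> \<ge> 0" by simp
  finally have "D * (q\<^sup>2 * (q\<^sup>2 - 1) + 2 * t * q * (q + 1) * (2 * q + 1))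
      \<le> D * ((q + t)^4 + (q + t)\<^sup>2 / 2)"
    using D by (intro mult_left_mono) auto
  also have "\<dots> = (real M)^4 / D^3 + (real M)\<^sup>2 / (2 * D)"
    using Mp by (simp add: algebra_simps)
  finally show "12 * square_sum_sum d M \<le> (real M)^4 / (real d)^3 + (real M)\<^sup>2 / (2 * real d)"
    unfolding closed D_def .
  have "q\<^sup>2 * (q\<^sup>2 - 1) + 2 * t * q * (q + 1) * (2 * q + 1) - ((q + t)^4 - (q + t)\<^sup>2)
     = 6 * (q\<^sup>2 * (t * (1 - t))) + 4 * (q * (t * ((1 - t) * (1 + t)))) + t\<^sup>2 * ((1 - t) * (1 + t))"
    by (simp add: power2_eq_square power4_eq_xxxx algebra_simps)
  also have "\<dots> \<ge> 0"
    using t by (intro add_nonneg_nonneg mult_nonneg_nonneg) auto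
  finally have "D * ((q + t)^4 - (q + t)\<^sup>2)
      \<le> D * (q\<^sup>2 * (q\<^sup>2 - 1) + 2 * t * q * (q + 1) * (2 * q + 1))"
    using D by (intro mult_left_mono) auto
  then show "(real M)^4 / (real d)^3 - (real M)\<^sup>2 / real d \<le> 12 * square_sum_sum d M"
    unfolding closed D_def[symmetric] Mp by (simp add: algebra_simps)
qed

lemma square_sum_sum_nonneg: "square_sum_sum d M \<ge> 0"
  unfolding square_sum_sum_def square_sum_def by (intro sum_nonneg) auto

text \<open>1.203 is slightly more than zeta(3). The term 1 / (2 n (n + 1)) is a telescoping bound
  for the tail and is sharp enough from n = 4 on.\<close>

lemma sum_inverse_cubes_le: "(\<Sum>d=1..n. 1 / (real d)^3) \<le> 1.203"
proof -
  have large: "(\<Sum>d=1..n. 1 / (real d)^3) \<le> 1.203 - 1 / (2 * real n * (real n + 1))" if "n \<ge> 4" for n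
    using that
  proof (induction n rule: dec_induct)
    case base
    have "{1..4::nat} = {1,2,3,4}" by auto
    then show ?case by (simp add: eval_nat_numeral)
  next
    case (step n)
    define x where "x = real n"
    have x: "x \<ge> 4" using step.hyps by (simp add: x_def)
    have "1 / (x + 1)^3 \<le> 1 / (x * (x + 1) * (x + 2))"
    proof (rule frac_le)
      show "x * (x + 1) * (x + 2) \<le> (x + 1)^3"
        using x by (simp add: power3_eq_cube algebra_simps)
    qed (use x in \<open>auto intro!: mult_pos_pos\<close>)
    also have "\<dots> = 1 / (2 * x * (x + 1)) - 1 / (2 * (x + 1) * (x + 2))"
      using x by (simp add: divide_simps) (simp add: algebra_simps)
    finally have "1 / (x + 1)^3 \<le> 1 / (2 * x * (x + 1)) - 1 / (2 * (x + 1) * (x + 2))" .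
    moreover have "(\<Sum>d=1..Suc n. 1 / (real d)^3) = (\<Sum>d=1..n. 1 / (real d)^3) + 1 / (x + 1)^3"
      by (simp add: x_def add.commute)
    moreover have "1 / (2 * real (Suc n) * (real (Suc n) + 1)) = 1 / (2 * (x + 1) * (x + 2))"
      by (simp add: x_def add.commute)
    ultimately show ?case
      using step.IH unfolding x_def[symmetric] by linarith
  qed
  have "(\<Sum>d=1..n. 1 / (real d)^3) \<le> (\<Sum>d=1..max 4 n. 1 / (real d)^3)"
    by (rule sum_mono2) auto
  also have "\<dots> \<le> 1.203 - 1 / (2 * real (max 4 n) * (real (max 4 n) + 1))"
    by (rule large) simp
  also have "\<dots> \<le> 1.203" by simp
  finally show ?thesis .
qed

text \<open>A linear bound keeps the later estimates polynomial; this line passes through the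
  harmonic sums at 5 and 6.\<close>

lemma harmonic_sum_le: "n > 0 \<Longrightarrow> (\<Sum>d=1..n. 1 / real d) \<le> 29 / 20 + real n / 6"
proof (induction n)
  case (Suc n)
  consider "n \<le> 4" | "n \<ge> 5" by linarith
  then show ?case
  proof cases
    case 1
    then have "n \<in> {0,1,2,3,4}" by auto
    then show ?thesis by (auto simp: eval_nat_numeral)
  next
    case 2
    have "1 / real (Suc n) \<le> 1 / 6"
      using 2 by (intro divide_left_mono) auto
    moreover have "(\<Sum>d=1..n. 1 / real d) \<le> 29 / 20 + real n / 6"
      using Suc.IH 2 by simp
    ultimately have "(\<Sum>d=1..n. 1 / real d) + 1 / real (Suc n) \<le> 29 / 20 + real n / 6 + 1 / 6"
      by (intro add_mono)
    also have "\<dots> = 29 / 20 + real (Suc n) / 6"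
      by (simp add: field_simps)
    finally show ?thesis by simp
  qed
qed simp

lemma S2_upper:
  assumes "K > 0"
  shows "12 * S2 K \<le> 1.203 * (real K + 1)^4 + (real K + 1)\<^sup>2 / 2 * (29 / 20 + real K / 6)"
proof -
  define M where "M = real K + 1"
  have "12 * S2 K = (\<Sum>d=1..K. 12 * square_sum_sum d (Suc K))"
    unfolding S2_eq[OF order.refl] by (simp add: sum_distrib_left)
  also have "\<dots> \<le> (\<Sum>d=1..K. M^4 * (1 / (real d)^3) + M\<^sup>2 / 2 * (1 / real d))"
  proof (rule sum_mono)
    fix d assume "d \<in> {1..K}"
    then show "12 * square_sum_sum d (Suc K) \<le> M^4 * (1 / (real d)^3) + M\<^sup>2 / 2 * (1 / real d)"
      using square_sum_sum_bounds(1)[of d "Suc K"] by (simp add: M_def add.commute)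
  qed
  also have "\<dots> = M^4 * (\<Sum>d=1..K. 1 / (real d)^3) + M\<^sup>2 / 2 * (\<Sum>d=1..K. 1 / real d)"
    by (simp add: sum.distrib sum_distrib_left)
  also have "\<dots> \<le> M^4 * 1.203 + M\<^sup>2 / 2 * (29 / 20 + real K / 6)"
    using sum_inverse_cubes_le[of K] harmonic_sum_le[OF assms]
    by (intro add_mono mult_left_mono) auto
  finally show ?thesis by (simp add: M_def mult.commute)
qed

lemma S2_lower_1: "((real j + 1)^4 - (real j + 1)\<^sup>2) \<le> 12 * S2 j"
proof -
  have "square_sum_sum 1 (Suc j) \<le> (\<Sum>d=1..Suc j. square_sum_sum d (Suc j))"
    by (rule member_le_sum) (auto intro: square_sum_sum_nonneg)
  also have "\<dots> = S2 j"
    by (rule S2_eq[symmetric]) simp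
  finally show ?thesis
    using square_sum_sum_bounds(2)[of 1 "Suc j"] by (simp add: add.commute)
qed

text \<open>Only the shares of \<open>d = 1\<close> and \<open>d = 2\<close> are kept: 1.125 = 1 +
  1/8 and 1.5 = 1 + 1/2.\<close>

lemma S2_lower_2: "1.125 * (real j + 1)^4 - 1.5 * (real j + 1)\<^sup>2 \<le> 12 * S2 j"
proof -
  have "(\<Sum>d\<in>{1,2}. square_sum_sum d (Suc j)) \<le> (\<Sum>d=1..j+2. square_sum_sum d (Suc j))"
    by (rule sum_mono2) (auto intro: square_sum_sum_nonneg)
  also have "\<dots> = S2 j"
    by (rule S2_eq[symmetric]) simp
  finally have "12 * square_sum_sum 1 (Suc j) + 12 * square_sum_sum 2 (Suc j) \<le> 12 * S2 j"
    by simp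
  then show ?thesis
    using square_sum_sum_bounds(2)[of 1 "Suc j"] square_sum_sum_bounds(2)[of 2 "Suc j"]
    by (simp add: add.commute)
qed

text \<open>The left side is the closed form of the sum of 1.125 x^4 - 1.5 x^2 over x from 1 to
  \<open>Suc K\<close>, that is, of the bounds in \<open>S2_lower_2\<close>.\<close>

lemma S3_lower:
  "0.225 * real (Suc K)^5 + 0.5625 * real (Suc K)^4 - 0.125 * real (Suc K)^3 - 0.75 * (real (Suc K))\<^sup>2
     - 0.2875 * real (Suc K) \<le> 12 * S3 K"
proof (induction K)
  case 0
  show ?case using S2_lower_2[of 0] by (simp add: S3_def)
next
  case (Suc K)
  define x where "x = real (Suc K)"
  have "12 * S3 (Suc K) = 12 * S3 K + 12 * S2 (Suc K)"
    by (simp add: S3_def)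
  moreover have "1.125 * (x + 1)^4 - 1.5 * (x + 1)\<^sup>2 \<le> 12 * S2 (Suc K)"
    using S2_lower_2[of "Suc K"] by (simp add: x_def)
  moreover have e: "real (Suc (Suc K)) = x + 1" by (simp add: x_def)
  moreover have "0.225 * (x + 1)^5 + 0.5625 * (x + 1)^4 - 0.125 * (x + 1)^3 - 0.75 * (x + 1)\<^sup>2
     - 0.2875 * (x + 1) = 0.225 * x^5 + 0.5625 * x^4 - 0.125 * x^3 - 0.75 * x\<^sup>2 - 0.2875 * x
       + (1.125 * (x + 1)^4 - 1.5 * (x + 1)\<^sup>2)"
    by algebra
  ultimately show ?case
    using Suc.IH unfolding e unfolding x_def[symmetric] by linarith
qed

text \<open>\<open>ratio_poly y K\<close> is the difference of the two sides of the inequality \<open>S2_le_S3\<close> below, up to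
  the factor \<open>12 y\<^sup>2\<close>, after inserting the polynomial bounds for \<open>S2\<close> and \<open>S3\<close> and with
  \<open>y = K l\<close>. Positivity is read off from Bernstein expansions on two intervals and from a Taylor
  expansion on the third.\<close>

definition ratio_poly :: "real \<Rightarrow> real \<Rightarrow> real" where
  "ratio_poly y K =
     (261 / 50) * K ^ 3 + (261 / 50) * K ^ 4 + (93 / 10) * y * K ^ 2 + (93 / 10) * y * K ^ 3
     + (- 241 / 125) * y ^ 2 + (191 / 750) * y ^ 2 * K + (- 4529 / 3000) * y ^ 2 * K ^ 2
     + (- 7343 / 1500) * y ^ 2 * K ^ 3 + (- 1203 / 1000) * y ^ 2 * K ^ 4 + (- 23 / 80) * y ^ 3
     + (- 3 / 4) * y ^ 3 * K + (- 1 / 8) * y ^ 3 * K ^ 2 + (9 / 16) * y ^ 3 * K ^ 3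
     + (9 / 40) * y ^ 3 * K ^ 4"

lemma ratio_poly_nonneg:
  assumes "0 \<le> y" "1 \<le> K" "97 / 20 * y \<le> K"
  shows "ratio_poly y K \<ge> 0"
proof -
  \<comment> \<open>The coefficient of K^4 is 5.22 - 1.203 y^2 + 0.225 y^3. Its minimum, near y =
    3.56, is only about 0.13, so the middle interval ends just beyond it. For small \<open>y\<close>
    the bound \<open>1 \<le> K\<close> is enough; from 9/4 on \<open>K\<close> is measured from the
    bound 97/20 * y, at the left end of the interval or at \<open>y\<close> itself. The factors
    729/64 and 343/125 are the cubed interval lengths, which homogenise in \<open>u\<close> and
    \<open>w\<close>.\<close>
  consider "y \<le> 9 / 4" | "9 / 4 \<le> y" "y \<le> 73 / 20" | "73 / 20 \<le> y" by linarith
  then show ?thesis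
  proof cases
    case 1
    define u where "u = y"
    define w where "w = 9 / 4 - y"
    define k where "k = K - 1"
    have nn: "u \<ge> 0" "w \<ge> 0" "k \<ge> 0"
      using assms 1 by (auto simp: u_def w_def k_def)
    have "729 / 64 * ratio_poly y K =
      (261 / 25) * w ^ 3 + (1827 / 50) * w ^ 3 * k + (2349 / 50) * w ^ 3 * k ^ 2
      + (261 / 10) * w ^ 3 * k ^ 3 + (261 / 50) * w ^ 3 * k ^ 4 + (7317 / 100) * u * w ^ 2
      + (42849 / 200) * u * w ^ 2 * k + (5616 / 25) * u * w ^ 2 * k ^ 2
      + (3969 / 40) * u * w ^ 2 * k ^ 3 + (783 / 50) * u * w ^ 2 * k ^ 4
      + (272133 / 4000) * u ^ 2 * w + (824661 / 4000) * u ^ 2 * w * k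
      + (3036933 / 16000) * u ^ 2 * w * k ^ 2 + (568053 / 8000) * u ^ 2 * w * k ^ 3
      + (153117 / 16000) * u ^ 2 * w * k ^ 4 + (66033 / 64000) * u ^ 3
      + (5957487 / 128000) * u ^ 3 * k + (5801409 / 128000) * u ^ 3 * k ^ 2
      + (1861173 / 128000) * u ^ 3 * k ^ 3 + (108333 / 64000) * u ^ 3 * k ^ 4"
      unfolding ratio_poly_def u_def w_def k_def by algebra
    also have "\<dots> \<ge> 0"
      using nn by (intro add_nonneg_nonneg mult_nonneg_nonneg zero_le_power) simp_all
    finally show ?thesis by simp
  next
    case 2
    define u where "u = y - 9 / 4"
    define w where "w = 73 / 20 - y"
    define k where "k = K - 873 / 80"
    have nn: "u \<ge> 0" "w \<ge> 0" "k \<ge> 0"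
      using assms 2 by (auto simp: u_def w_def k_def)
    have "343 / 125 * ratio_poly y K =
      (92851781087732373 / 2621440000000) * w ^ 3 + (96877213586091 / 8192000000) * w ^ 3 * k
      + (302212161891 / 204800000) * w ^ 3 * k ^ 2 + (104519799 / 1280000) * w ^ 3 * k ^ 3
      + (108333 / 64000) * w ^ 3 * k ^ 4 + (772522036940246607 / 13107200000000) * u * w ^ 2
      + (772532333354769 / 40960000000) * u * w ^ 2 * k
      + (2292767678169 / 1024000000) * u * w ^ 2 * k ^ 2
      + (749524341 / 6400000) * u * w ^ 2 * k ^ 3 + (730647 / 320000) * u * w ^ 2 * k ^ 4
      + (1109891124264090847 / 65536000000000) * u ^ 2 * w
      + (2814829221288547 / 614400000000) * u ^ 2 * w * k
      + (6423708398747 / 15360000000) * u ^ 2 * w * k ^ 2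
      + (1355402383 / 96000000) * u ^ 2 * w * k ^ 3 + (171687 / 1600000) * u ^ 2 * w * k ^ 4
      + (269602332578428577 / 65536000000000) * u ^ 3
      + (797303400047677 / 614400000000) * u ^ 3 * k
      + (2244736378277 / 15360000000) * u ^ 3 * k ^ 2 + (686851153 / 96000000) * u ^ 3 * k ^ 3
      + (214617 / 1600000) * u ^ 3 * k ^ 4"
      unfolding ratio_poly_def u_def w_def k_def by algebra
    also have "\<dots> \<ge> 0"
      using nn by (intro add_nonneg_nonneg mult_nonneg_nonneg zero_le_power) simp_all
    finally show ?thesis by simp
  next
    case 3
    define u where "u = y - 73 / 20"
    define k where "k = K - 97 / 20 * y"
    have nn: "u \<ge> 0" "k \<ge> 0"
      using assms 3 by (auto simp: u_def k_def)
    have "ratio_poly y K =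
      (2726431206635119679171 / 122880000000000000) + (340980048575800741 / 76800000000000) * k
      + (126331443430133 / 384000000000) * k ^ 2 + (5182955081 / 480000000) * k ^ 3
      + (214617 / 1600000) * k ^ 4 + (108560922415276039577 / 6144000000000000) * u
      + (37298088427213 / 9600000000) * u * k + (6465235239529 / 19200000000) * u * k ^ 2
      + (162886553 / 12000000) * u * k ^ 3 + (16863 / 80000) * u * k ^ 4
      + (8655814647873662443 / 61440000000000) * u ^ 2
      + (1211876303452273 / 38400000000) * u ^ 2 * k + (1254418608361 / 480000000) * u ^ 2 * k ^ 2
      + (7097027 / 75000) * u ^ 2 * k ^ 3 + (5043 / 4000) * u ^ 2 * k ^ 4
      + (526963985401268257 / 3072000000000) * u ^ 3 + (7192685024087 / 240000000) * u ^ 3 * k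
      + (14399061571 / 8000000) * u ^ 3 * k ^ 2 + (409533 / 10000) * u ^ 3 * k ^ 3
      + (9 / 40) * u ^ 3 * k ^ 4 + (13110294087068773 / 153600000000) * u ^ 4
      + (348078703377 / 32000000) * u ^ 4 * k + (334347651 / 800000) * u ^ 4 * k ^ 2
      + (873 / 200) * u ^ 4 * k ^ 3 + (810115157082107 / 38400000000) * u ^ 5
      + (1739319513 / 1000000) * u ^ 5 * k + (254043 / 8000) * u ^ 5 * k ^ 2
      + (1650798201423 / 640000000) * u ^ 6 + (8214057 / 80000) * u ^ 6 * k
      + (796763529 / 6400000) * u ^ 7"
      unfolding ratio_poly_def u_def k_def by algebra
    also have "\<dots> \<ge> 0"
      using nn by (intro add_nonneg_nonneg mult_nonneg_nonneg zero_le_power) simp_all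
    finally show ?thesis .
  qed
qed

text \<open>\<open>S2\<close> has order K^4 and \<open>l * S3\<close> order l K^5, so the difference
  matters only while K l is bounded, and there it is at most a multiple of K^2 / l^2. With the
  leading constants 1.203 and 0.225 the maximum requires about 0.85 / l^2; 0.87 leaves room for the
  lower orders. The bound on \<open>l\<close> yields 97/20 * y \<le> K.\<close>

lemma S2_le_S3:
  fixes l :: real
  assumes l: "0 < l" "l \<le> 0.206" and K: "K > 0"
  shows "S2 K \<le> l * S3 (K - 1) + (0.87 / l\<^sup>2 + 1.55 / l + 1.1) * (real K * (real K + 1) / 2)"
proof -
  define x y \<mu> where "x = real K" and "y = x * l" and "\<mu> = 0.87 / l\<^sup>2 + 1.55 / l + 1.1"
  have x: "x \<ge> 1" using K by (simp add: x_def)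
  have y: "y > 0" using x l by (simp add: y_def)
  have "97 / 20 * l \<le> 1" using l by simp
  then have "x * (97 / 20 * l) \<le> x * 1" using x by (intro mult_left_mono) auto
  then have "97 / 20 * y \<le> x" by (simp add: y_def algebra_simps)
  then have "ratio_poly y x \<ge> 0"
    using x y by (intro ratio_poly_nonneg) auto
  have l_eq: "l = y / x" using x by (simp add: y_def)
  have S3: "0.225 * x^5 + 0.5625 * x^4 - 0.125 * x^3 - 0.75 * x\<^sup>2 - 0.2875 * x \<le> 12 * S3 (K - 1)"
    using S3_lower[of "K - 1"] K by (simp add: x_def)
  have "ratio_poly y x = y\<^sup>2 * (l * (0.225 * x^5 + 0.5625 * x^4 - 0.125 * x^3 - 0.75 * x\<^sup>2 - 0.2875 * x)
      + 6 * (0.87 / l\<^sup>2 + 1.55 / l + 1.1) * (x * (x + 1))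
      - (1.203 * (x + 1)^4 + (x + 1)\<^sup>2 / 2 * (29 / 20 + x / 6)))"
    unfolding ratio_poly_def l_eq using x y
    by (simp add: field_simps) algebra
  with \<open>ratio_poly y x \<ge> 0\<close> have "0 \<le> l * (0.225 * x^5 + 0.5625 * x^4 - 0.125 * x^3 - 0.75 * x\<^sup>2 - 0.2875 * x)
      + 6 * (0.87 / l\<^sup>2 + 1.55 / l + 1.1) * (x * (x + 1))
      - (1.203 * (x + 1)^4 + (x + 1)\<^sup>2 / 2 * (29 / 20 + x / 6))"
    using y by (simp add: zero_le_mult_iff)
  also have "\<dots> \<le> l * (12 * S3 (K - 1)) + 6 * (0.87 / l\<^sup>2 + 1.55 / l + 1.1) * (x * (x + 1)) - 12 * S2 K"
    using S3 l x S2_upper[OF K] unfolding x_def[symmetric] by (intro diff_mono add_mono mult_left_mono) auto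
  finally show ?thesis
    unfolding x_def[symmetric] \<mu>_def[symmetric] by (simp add: field_simps)
qed

section \<open>Upper bound for consecutive ratios\<close>

lemma fps_nth_geometric_mult:
  fixes f :: "real fps"
  shows "fps_nth (Abs_fps (\<lambda>_. 1) * f) n = (\<Sum>k\<le>n. fps_nth f k)"
  by (subst mult.commute) (simp add: fps_mult_nth atLeast0AtMost)

text \<open>Take the coefficient of X^(n + 1) in (1 - (1 + l) X) X F', where F is
  \<open>pp_fps\<close>. Substituting X F' = F \<open>sigma2_fps\<close> and F = U + X^2 U^2 + U^3
  G', the factor \<open>A\<close> cancels one \<open>U\<close> in each summand, and the three
  hypotheses bound the three resulting series.\<close>

lemma pp_ratio_bound:
  fixes l \<mu> :: real
  assumes n: "n \<ge> 2" and \<mu>: "\<mu> \<ge> 0"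
    and h1: "real (sigma2 (Suc n)) \<le> l * S1 n"
    and h2: "S1 (n - 1) \<le> l * S2 (n - 2)"
    and h3: "\<And>K. K > 0 \<Longrightarrow> S2 K \<le> l * S3 (K - 1) + \<mu> * (real K * (real K + 1) / 2)"
  shows "real (Suc n) * real (pp (Suc n)) \<le> ((1 + l) * real n + \<mu>) * real (pp n)"
proof -
  define U :: "real fps" where "U = Abs_fps (\<lambda>_. 1)"
  define A :: "real fps" where "A = 1 - fps_X"
  define Y :: "real fps" where "Y = fps_const l * fps_X"
  define G where "G = A ^ 3 * pp_fps"
  define G' where "G' = G - (1 - 2 * fps_X + 2 * fps_X ^ 2 - fps_X ^ 3)"
  have AU: "A * U = 1"
  proof (rule fps_ext)
    fix k
    show "fps_nth (A * U) k = fps_nth 1 k"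
      by (cases k) (auto simp: A_def U_def left_diff_distrib)
  qed
  have G'_nth: "fps_nth G' k = (if k = 0 \<or> k = 1 \<or> k = 3 then 0 else if k = 2 then 1 else pp_diff3 k)" for k
    using pp_diff3_small
    by (auto simp: G'_def G_def A_def pp_diff3_def[symmetric] numeral_fps_const fps_mult_left_const_nth)
  have G'_nonneg: "fps_nth G' k \<ge> 0" for k
  proof (cases "k \<ge> 4")
    case False
    then have "k \<in> {0, 1, 2, 3}" by auto
    then show ?thesis by (auto simp: G'_nth)
  qed (simp add: G'_nth pp_diff3_nonneg)
  have F: "pp_fps = U + fps_X ^ 2 * U ^ 2 + U ^ 3 * G'"
  proof -
    have "pp_fps = (A * U) ^ 3 * pp_fps"
      by (simp add: AU)
    also have "\<dots> = U ^ 3 * G"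
      by (simp add: G_def power_mult_distrib algebra_simps)
    \<comment> \<open>The polynomial 1 - 2X + 2X^2 - X^3 removes the negative coefficients of
      \<open>G\<close>, and it factors so that multiplication by \<open>U ^ 3\<close> gives series
      with nonnegative coefficients.\<close>
    also have "G = A ^ 2 + fps_X ^ 2 * A + G'"
      by (simp add: G'_def A_def power2_eq_square power3_eq_cube algebra_simps)
    also have "U ^ 3 * (A ^ 2 + fps_X ^ 2 * A + G')
        = (A * U) ^ 2 * U + fps_X ^ 2 * (A * U) * U ^ 2 + U ^ 3 * G'"
      by (simp add: power2_eq_square power3_eq_cube algebra_simps)
    finally show ?thesis by (simp add: AU)
  qed
  have "(A - Y) * (pp_fps * sigma2_fps)
      = (A * U) * sigma2_fps - Y * (U * sigma2_fps)
        + fps_X ^ 2 * ((A * U) * (U * sigma2_fps) - Y * (U * (U * sigma2_fps)))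
        + G' * ((A * U) * (U * (U * sigma2_fps)) - Y * (U * (U * (U * sigma2_fps))))"
    unfolding F by (simp add: power2_eq_square power3_eq_cube algebra_simps)
  then have E: "(A - Y) * (pp_fps * sigma2_fps)
      = (sigma2_fps - Y * (U * sigma2_fps))
        + fps_X ^ 2 * (U * sigma2_fps - Y * (U * (U * sigma2_fps)))
        + G' * (U * (U * sigma2_fps) - Y * (U * (U * (U * sigma2_fps))))"
    unfolding AU by simp
  have s0: "fps_nth sigma2_fps k = real (sigma2 k)" for k
    by (simp add: sigma2_fps_def)
  have s1: "fps_nth (U * sigma2_fps) k = S1 k" for k
    by (simp add: U_def fps_nth_geometric_mult S1_def s0)
  have s2: "fps_nth (U * (U * sigma2_fps)) k = S2 k" for k
    using s1 by (simp add: U_def fps_nth_geometric_mult S2_def)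
  have s3: "fps_nth (U * (U * (U * sigma2_fps))) k = S3 k" for k
    using s2 by (simp add: U_def fps_nth_geometric_mult S3_def)
  have Y: "fps_nth (Y * f) (Suc k) = l * fps_nth f k" "fps_nth (Y * f) 0 = 0" for f k
    by (simp_all add: Y_def mult.assoc fps_mult_left_const_nth)
  \<comment> \<open>\<open>T\<close> generates the triangular numbers in the third hypothesis. Its
    product with \<open>G'\<close> is \<open>U ^ 3 * G'\<close> shifted by one, so the error costs
    at most \<mu> times \<open>pp n\<close>.\<close>
  define T where "T = fps_X * U ^ 3"
  have u2: "fps_nth (U * U) i = real i + 1" for i
    by (simp add: U_def fps_nth_geometric_mult)
  have T: "fps_nth T k = real k * (real k + 1) / 2" for k
  proof (cases k)
    case (Suc j)
    have "fps_nth (U * (U * U)) j = (\<Sum>i\<le>j. fps_nth (U * U) i)"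
      by (subst U_def, subst fps_nth_geometric_mult) (rule refl)
    also have "\<dots> = (real j + 1) * (real j + 2) / 2"
      unfolding u2 by (induction j) (auto simp: field_simps)
    finally show ?thesis
      using Suc by (simp add: T_def power3_eq_cube mult.assoc add.commute)
  qed (simp add: T_def)
  have "real (Suc n) * real (pp (Suc n)) - (1 + l) * (real n * real (pp n))
      = fps_nth ((A - Y) * (fps_X * fps_deriv pp_fps)) (Suc n)"
  proof -
    have AY: "A - Y = 1 - fps_const (1 + l) * fps_X"
      by (simp add: A_def Y_def algebra_simps flip: fps_const_add)
    have "(A - Y) * f = f - fps_const (1 + l) * (fps_X * f)" for f
      unfolding AY by (simp only: left_diff_distrib mult_1_left mult.assoc)
    then have "fps_nth ((A - Y) * (fps_X * fps_deriv pp_fps)) (Suc n)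
       = fps_nth (fps_X * fps_deriv pp_fps) (Suc n) - (1 + l) * fps_nth (fps_X * fps_deriv pp_fps) n"
      by (simp only: fps_sub_nth fps_mult_left_const_nth) simp
    then show ?thesis
      unfolding fps_X_deriv_nth by (simp add: pp_fps_def)
  qed
  also have "\<dots> = (real (sigma2 (Suc n)) - l * S1 n) + (S1 (n - 1) - l * S2 (n - 2))
      + (\<Sum>i=0..Suc n. fps_nth G' i * fps_nth (U * (U * sigma2_fps) - Y * (U * (U * (U * sigma2_fps)))) (Suc n - i))"
  proof -
    obtain m where m: "n = Suc (Suc m)"
      using n by (metis add_2_eq_Suc le_Suc_ex)
    show ?thesis
      unfolding pp_fps_log_deriv E
      unfolding fps_add_nth fps_mult_nth[of G'] fps_X_power_mult_nth m
      by (simp add: s0 s1 s2 Y)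
  qed
  also have "\<dots> \<le> (\<Sum>i=0..Suc n. fps_nth G' i * fps_nth (U * (U * sigma2_fps) - Y * (U * (U * (U * sigma2_fps)))) (Suc n - i))"
    using h1 h2 by simp
  also have "\<dots> \<le> (\<Sum>i=0..Suc n. fps_nth G' i * (\<mu> * fps_nth T (Suc n - i)))"
  proof (intro sum_mono mult_left_mono G'_nonneg)
    fix i
    show "fps_nth (U * (U * sigma2_fps) - Y * (U * (U * (U * sigma2_fps)))) (Suc n - i) \<le> \<mu> * fps_nth T (Suc n - i)"
    proof (cases "Suc n - i")
      case 0
      show ?thesis
        unfolding 0 T fps_sub_nth s2 Y(2) by (simp add: S2_def S1_def)
    next
      case (Suc K)
      then show ?thesis using h3[of "Suc K"] by (simp add: Y s2 s3 T)
    qed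
  qed
  also have "\<dots> = \<mu> * fps_nth (G' * T) (Suc n)"
    by (simp add: fps_mult_nth sum_distrib_left algebra_simps del: sum.atLeast0_atMost_Suc)
  also have "fps_nth (G' * T) (Suc n) = fps_nth (U ^ 3 * G') n"
  proof -
    have "G' * T = fps_X * (U ^ 3 * G')" by (simp add: T_def mult_ac)
    then show ?thesis by (simp only:) simp
  qed
  also have "\<mu> * fps_nth (U ^ 3 * G') n \<le> \<mu> * real (pp n)"
  proof (rule mult_left_mono[OF _ \<mu>])
    have "real (pp n) = fps_nth (U + fps_X ^ 2 * U ^ 2 + U ^ 3 * G') n"
      unfolding F[symmetric] by (simp add: pp_fps_def)
    moreover have "fps_nth (fps_X ^ 2 * U ^ 2) n \<ge> 0"
      unfolding power2_eq_square[of U] by (simp add: fps_X_power_mult_nth u2)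
    moreover have "fps_nth U n \<ge> 0" by (simp add: U_def)
    ultimately show "fps_nth (U ^ 3 * G') n \<le> real (pp n)" by simp
  qed
  finally show ?thesis by (simp add: algebra_simps)
qed

text \<open>With \<open>\<mu> \<approx> 0.87 / l\<^sup>2\<close>, the choice \<open>l = 1.2 / n\<^sup>1\<^sup>/\<^sup>3\<close> nearly minimises \<open>l + \<mu> / n\<close>.\<close>

lemma pp_ratio_le:
  assumes n: "n \<ge> 200"
  defines "u \<equiv> 1 / root 3 (real n)"
  shows "real (pp (Suc n)) \<le> (1 + 1.8042 * u + 1.2917 * u\<^sup>2 + 1.1 * u ^ 3) * real (pp n)"
proof -
  define s where "s = root 3 (real n)"
  have s3: "s ^ 3 = real n" by (simp add: s_def)
  \<comment> \<open>5.84 is just below the cube root of 200; it makes 1.2 / s \<le> 0.206.\<close>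
  have "s ^ 3 \<ge> 5.84 ^ 3" unfolding s3 using n by (simp add: power3_eq_cube)
  then have s: "s \<ge> 5.84"
    using power_mono_iff[of "5.84" s 3] by (simp add: s_def)
  define l where "l = 1.2 / s"
  define \<mu> where "\<mu> = 0.87 / l\<^sup>2 + 1.55 / l + 1.1"
  have l: "0 < l" "l \<le> 0.206"
    using s by (auto simp: l_def field_simps)
  have \<mu>: "\<mu> \<ge> 0" using l by (simp add: \<mu>_def)
  define x where "x = real n"
  have x: "x \<ge> 200" using n by (simp add: x_def)
  have s2: "s\<^sup>2 \<ge> 34" using power_mono[OF s, of 2] by (simp add: power2_eq_square)
  have lx: "l * x = 1.2 * s\<^sup>2"
    unfolding x_def s3[symmetric] l_def using s by (simp add: power2_eq_square power3_eq_cube)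
  have sq: "(\<Sum>k\<le>m. (real k)\<^sup>2) = real m * (real m + 1) * (2 * real m + 1) / 6" for m
    by (induction m) (auto simp: field_simps power2_eq_square)
  have S1_lo: "S1 m \<ge> real m * (real m + 1) * (2 * real m + 1) / 6" for m
    unfolding S1_def sq[symmetric]
  proof (rule sum_mono)
    fix k show "(real k)\<^sup>2 \<le> real (sigma2 k)"
      using sigma2_ge[of k] of_nat_mono[of "k\<^sup>2" "sigma2 k", where 'a = real] by (cases "k = 0") auto
  qed
  have S1_hi: "S1 m \<le> real m * (real m + 1) * (2 * real m + 1) / 3" for m
  proof -
    have "S1 m \<le> (\<Sum>k\<le>m. 2 * (real k)\<^sup>2)"
      unfolding S1_def
    proof (rule sum_mono)
      fix k show "real (sigma2 k) \<le> 2 * (real k)\<^sup>2"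
        using of_nat_mono[OF sigma2_le[of k], where 'a = real] by simp
    qed
    also have "\<dots> = 2 * (\<Sum>k\<le>m. (real k)\<^sup>2)" by (simp add: sum_distrib_left)
    finally show ?thesis unfolding sq by simp
  qed
  have "real (Suc n) * real (pp (Suc n)) \<le> ((1 + l) * real n + \<mu>) * real (pp n)"
  proof (rule pp_ratio_bound)
    show "n \<ge> 2" using n by simp
    show "real (sigma2 (Suc n)) \<le> l * S1 n"
    proof -
      have "real (sigma2 (Suc n)) \<le> 2 * (x + 1)\<^sup>2"
        using of_nat_mono[OF sigma2_le[of "Suc n"], where 'a = real] by (simp add: x_def add.commute)
      also have "\<dots> \<le> 2 * (x + 1) * (2 * x + 1)"
        using x by (simp add: power2_eq_square algebra_simps)
      also have "\<dots> \<le> (1.2 * s\<^sup>2 / 6) * ((x + 1) * (2 * x + 1))"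
      proof -
        have "2 * ((x + 1) * (2 * x + 1)) \<le> (1.2 * s\<^sup>2 / 6) * ((x + 1) * (2 * x + 1))"
          by (rule mult_right_mono) (use s2 x in auto)
        then show ?thesis by (simp only: mult.assoc)
      qed
      also have "\<dots> = l * (x * (x + 1) * (2 * x + 1) / 6)"
        unfolding lx[symmetric] by simp
      also have "\<dots> \<le> l * S1 n"
        using S1_lo[of n] l by (intro mult_left_mono) (auto simp: x_def)
      finally show ?thesis .
    qed
    show "S1 (n - 1) \<le> l * S2 (n - 2)"
    proof -
      have r: "real (n - 1) = x - 1" "real (n - 2) = x - 2" using n by (auto simp: x_def)
      have "S1 (n - 1) \<le> (x - 1) * x * (2 * x - 1) / 3"
        using S1_hi[of "n - 1"] unfolding r by simp
      also have "\<dots> \<le> (x - 1) * x * (2 * x) / 3"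
        using x by (intro divide_right_mono mult_left_mono) auto
      also have "\<dots> = (x - 1) * (x * (2 * x / 3))" by simp
      also have "\<dots> \<le> (x - 1) * (1.2 * s\<^sup>2 / 12 * ((x - 1) * (x - 2)))"
      proof (rule mult_left_mono)
        have "x * (2 * x / 3) \<le> (2 * (x - 1)) * (x - 2)"
          by (rule mult_mono) (use x in auto)
        also have "\<dots> = 2 * ((x - 1) * (x - 2))" by simp
        also have "\<dots> \<le> 1.2 * s\<^sup>2 / 12 * ((x - 1) * (x - 2))"
          by (rule mult_right_mono) (use x s2 in auto)
        finally show "x * (2 * x / 3) \<le> 1.2 * s\<^sup>2 / 12 * ((x - 1) * (x - 2))" .
      qed (use x in auto)
      also have "\<dots> = l * (((x - 1)^4 - (x - 1)\<^sup>2) / 12)"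
        unfolding lx[symmetric] by (simp add: power2_eq_square power4_eq_xxxx field_simps)
      also have "\<dots> \<le> l * S2 (n - 2)"
        using S2_lower_1[of "n - 2"] l unfolding r by (intro mult_left_mono) auto
      finally show ?thesis .
    qed
    show "S2 K \<le> l * S3 (K - 1) + \<mu> * (real K * (real K + 1) / 2)" if "K > 0" for K
      unfolding \<mu>_def by (rule S2_le_S3[OF l that])
  qed (rule \<mu>)
  also have "(1 + l) * real n + \<mu> \<le> (1 + l + \<mu> / x) * real (Suc n)"
  proof -
    have "(1 + l) * x + \<mu> = (1 + l + \<mu> / x) * x" using x by (simp add: field_simps)
    also have "\<dots> \<le> (1 + l + \<mu> / x) * (x + 1)"
      using l \<mu> x by (intro mult_left_mono) auto
    finally show ?thesis by (simp add: x_def add.commute)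
  qed
  also have "1 + l + \<mu> / x \<le> 1 + 1.8042 * u + 1.2917 * u\<^sup>2 + 1.1 * u ^ 3"
  proof -
    have us: "s = 1 / u" "u > 0" using s n by (auto simp: u_def s_def)
    have "1 + l + \<mu> / x = 1 + 1.2 * u + (0.87 / 1.44 * u + 1.55 / 1.2 * u\<^sup>2 + 1.1 * u ^ 3)"
      unfolding \<mu>_def l_def x_def s3[symmetric] us(1) using us(2)
      by (simp add: power2_eq_square power3_eq_cube field_simps)
    also have "\<dots> = 1 + (1.2 * u + 0.87 / 1.44 * u) + 1.55 / 1.2 * u\<^sup>2 + 1.1 * u ^ 3"
      by simp
    \<comment> \<open>1.2 + 0.87 / 1.44 and 1.55 / 1.2, rounded up.\<close>
    also have "\<dots> \<le> 1 + 1.8042 * u + 1.2917 * u\<^sup>2 + 1.1 * u ^ 3"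
      by (intro add_mono order.refl mult_right_mono) (use us(2) in auto)
    finally show ?thesis .
  qed
  finally have "real (Suc n) * real (pp (Suc n))
      \<le> (1 + 1.8042 * u + 1.2917 * u\<^sup>2 + 1.1 * u ^ 3) * real (Suc n) * real (pp n)"
    by (simp add: mult_right_mono)
  then have "real (Suc n) * real (pp (Suc n))
      \<le> real (Suc n) * ((1 + 1.8042 * u + 1.2917 * u\<^sup>2 + 1.1 * u ^ 3) * real (pp n))"
    by (simp only: mult_ac)
  then show ?thesis by (simp only: mult_le_cancel_left_pos of_nat_0_less_iff zero_less_Suc)
qed

section \<open>Lower bound up to 200\<close>

text \<open>A rational substitute for exp (-2h) with an error of third order. As the ratio of a
  geometric series it makes all sums rational functions of \<open>h\<close>; its reciprocal gives
  numerical upper bounds for exp.\<close>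

lemma exp_ge_symmetric_quotient:
  fixes h :: real
  assumes "0 \<le> h" "h < 1"
  shows "(1 - h) / (1 + h) \<le> exp (- (2 * h))"
proof -
  let ?g = "\<lambda>x::real. (1 + x) * exp (- x) - (1 - x) * exp x"
  have "?g 0 \<le> ?g h"
  proof (rule DERIV_nonneg_imp_nondecreasing[OF assms(1)])
    fix x :: real assume "0 \<le> x" "x \<le> h"
    have "(?g has_real_derivative x * (exp x - exp (- x))) (at x)"
      by (auto intro!: derivative_eq_intros simp: algebra_simps)
    moreover have "x * (exp x - exp (- x)) \<ge> 0"
      using \<open>0 \<le> x\<close> by (intro mult_nonneg_nonneg) auto
    ultimately show "\<exists>y. (?g has_real_derivative y) (at x) \<and> 0 \<le> y"
      by blast
  qed
  then have "(1 - h) * exp h \<le> (1 + h) * exp (- h)" by simp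
  then have "(1 - h) * exp h * exp (- h) \<le> (1 + h) * exp (- h) * exp (- h)"
    by (intro mult_right_mono) auto
  then have "1 - h \<le> (1 + h) * exp (- (2 * h))"
    by (simp add: mult.assoc flip: exp_add)
  then show ?thesis
    using assms by (simp add: divide_le_eq mult.commute)
qed

lemma exp_le_power_quotient:
  fixes x :: real
  assumes "0 \<le> x" "x < 2 * real N" "N > 0"
  shows "exp x \<le> ((2 * real N + x) / (2 * real N - x)) ^ N"
proof -
  define h where "h = x / (2 * real N)"
  have h: "0 \<le> h" "h < 1" using assms by (auto simp: h_def)
  have "(1 - h) / (1 + h) > 0" using h by simp
  then have "exp (2 * h) \<le> 1 / ((1 - h) / (1 + h))"
    using le_imp_inverse_le[OF exp_ge_symmetric_quotient[OF h]]
    by (simp add: exp_minus inverse_eq_divide)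
  also have "\<dots> = (2 * real N + x) / (2 * real N - x)"
    using assms h by (simp add: h_def field_simps)
  finally have "exp (2 * h) ^ N \<le> ((2 * real N + x) / (2 * real N - x)) ^ N"
    by (intro power_mono) auto
  moreover have "exp (2 * h) ^ N = exp x"
    using assms by (simp add: h_def flip: exp_of_nat_mult)
  ultimately show ?thesis by simp
qed

text \<open>The constant 19/10 has to exceed the 1.8042 of the ratio bound. Keeping only k^2 from
  \<open>sigma2 k\<close> would limit it to 1.5 * 2^(1/3) < 1.89; adding k^2 / 4 for even k raises
  the limit to 1.5 * 2.25^(1/3) > 1.96. The shift 7/2 cancels in the induction step, so small n
  alone dictate it.\<close>

definition lower_exponent :: "nat \<Rightarrow> real" where
  "lower_exponent n = 19 / 10 * (root 3 (real n))\<^sup>2 - 7 / 2"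

text \<open>Compares the geometric sequence with start \<open>a / b\<close> and ratio
  \<open>c / d\<close> to a list, with denominators cleared.\<close>

fun dominates :: "int \<Rightarrow> int \<Rightarrow> int \<Rightarrow> int \<Rightarrow> int list \<Rightarrow> bool" where
  "dominates a b c d [] \<longleftrightarrow> True"
| "dominates a b c d (p # ps) \<longleftrightarrow> a \<le> p * b \<and> dominates (a * c) (b * d) c d ps"

lemma dominates_nth: "dominates a b c d ps \<Longrightarrow> i < length ps \<Longrightarrow> a * c ^ i \<le> ps ! i * (b * d ^ i)"
proof (induction ps arbitrary: a b i)
  case (Cons p ps)
  show ?case
  proof (cases i)
    case (Suc j)
    then show ?thesis using Cons.IH[of "a * c" "b * d" j] Cons.prems by (simp add: mult_ac)
  qed (use Cons.prems in simp)
qed simp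

text \<open>Tangent lines to the concave function \<open>x \<mapsto> x\<^sup>2\<^sup>/\<^sup>3\<close> turn the bound into a geometric
  sequence; the tangent of slope \<open>1 / m\<close> touches at \<open>x = (19 m / 15)\<^sup>3\<close>.\<close>

lemma lower_exponent_le_tangent:
  assumes "m > 0" "19 / 30 * (19 * m / 15)\<^sup>2 - 7 / 2 \<le> c"
  shows "lower_exponent n \<le> c + real n * (1 / m)"
proof -
  define r where "r = root 3 (real n)"
  have r: "r \<ge> 0" "r ^ 3 = real n" by (auto simp: r_def)
  define s where "s = 19 * m / 15"
  have s: "s > 0" using assms(1) by (simp add: s_def)
  have "s ^ 3 + 2 * r ^ 3 - 3 * r\<^sup>2 * s = (s - r)\<^sup>2 * (s + 2 * r)"
    by (simp add: power2_eq_square power3_eq_cube algebra_simps)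
  also have "\<dots> \<ge> 0" using s r by (intro mult_nonneg_nonneg) auto
  finally have "r\<^sup>2 * s \<le> (s ^ 3 + 2 * real n) / 3"
    using r(2) by simp
  also have "\<dots> = (s\<^sup>2 / 3 + 2 / 3 * real n / s) * s"
    using s by (simp add: field_simps power2_eq_square power3_eq_cube)
  finally have "r\<^sup>2 \<le> s\<^sup>2 / 3 + 2 / 3 * real n / s"
    using s by (simp only: mult_le_cancel_right_pos)
  then have "19 / 10 * r\<^sup>2 - 7 / 2 \<le> 19 / 10 * (s\<^sup>2 / 3 + 2 / 3 * real n / s) - 7 / 2"
    by simp
  also have "\<dots> = 19 / 30 * s\<^sup>2 - 7 / 2 + real n * (1 / m)"
    using assms(1) by (simp add: s_def field_simps)
  also have "\<dots> \<le> c + real n * (1 / m)"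
    using assms(2) by (simp add: s_def)
  finally show ?thesis by (simp add: lower_exponent_def r_def)
qed

text \<open>\<open>x\<close> is an upper bound for the tangent at \<open>n0\<close>, and the two
  fractions bound exp of it and exp of the slope; the rest is an integer comparison with the
  table.\<close>

lemma exp_lower_exponent_le_pp:
  fixes m x :: real
  assumes m: "m > 0" "19 / 30 * (19 * m / 15)\<^sup>2 - 7 / 2 + real n0 * (1 / m) \<le> x"
    and A: "exp x \<le> of_int A1 / of_int A2" and Z: "exp (1 / m) \<le> of_int Z1 / of_int Z2"
    and pos: "A2 > 0" "Z2 > 0"
    and dom: "dominates A1 A2 Z1 Z2 (take k (drop n0 pp_table))"
    and n: "n0 \<le> n" "n < n0 + k" "n \<le> 201"
  shows "exp (lower_exponent n) \<le> real (pp n)"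
proof -
  define j where "j = n - n0"
  have nj: "n = n0 + j" using n(1) by (simp add: j_def)
  have "lower_exponent n \<le> x - real n0 * (1 / m) + real n * (1 / m)"
    using m by (intro lower_exponent_le_tangent) auto
  also have "\<dots> = x + real j * (1 / m)"
    by (simp add: nj algebra_simps add_divide_distrib)
  finally have "exp (lower_exponent n) \<le> exp (x + real j * (1 / m))"
    by simp
  also have "\<dots> = exp x * exp (1 / m) ^ j"
    by (simp only: exp_add exp_of_nat_mult)
  also have "\<dots> \<le> (of_int A1 / of_int A2) * (of_int Z1 / of_int Z2) ^ j"
  proof (intro mult_mono power_mono A Z)
    show "0 \<le> real_of_int A1 / of_int A2" by (rule order_trans[OF _ A]) simp
  qed auto
  also have "\<dots> \<le> real (pp n)"
  proof -
    have "j < length (take k (drop n0 pp_table))"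
      using n nj pp_table_length by auto
    from dominates_nth[OF dom this]
    have "A1 * Z1 ^ j \<le> int (pp n) * (A2 * Z2 ^ j)"
      using n nj by (simp add: pp_table_length pp_table_correct)
    then have "real_of_int (A1 * Z1 ^ j) \<le> real_of_int (int (pp n) * (A2 * Z2 ^ j))"
      by (simp only: of_int_le_iff)
    then show ?thesis
      using pos by (simp add: power_divide divide_le_eq)
  qed
  finally show ?thesis .
qed

lemma pp_lower_bound_small:
  assumes "n \<le> 200"
  shows "exp (lower_exponent n) \<le> real (pp n)"
proof -
  consider "n < 11" | "11 \<le> n" "n < 23" | "23 \<le> n" "n < 46" | "46 \<le> n" "n < 86"
    | "86 \<le> n" "n < 166" | "166 \<le> n" using assms by linarith
  then show ?thesis
  proof cases
    case 1
    \<comment> \<open>The exponent at 0 is negative, so a lower bound for exp of its negation is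
      inverted.\<close>
    have "(1 + (1213 / 1000) / real 8) ^ 8 \<le> exp (1213 / 1000 :: real)"
      by (rule exp_ge_one_plus_x_over_n_power_n) auto
    moreover have "3 \<le> (1 + (1213 / 1000) / real 8 :: real) ^ 8" by (simp add: eval_nat_numeral)
    ultimately have "(3 :: real) \<le> exp (1213 / 1000)" by linarith
    then have A: "exp (- 1213 / 1000) \<le> real_of_int 1 / of_int 3"
      by (simp add: exp_minus field_simps)
    have Z: "exp (1 / (3 / 2)) \<le> real_of_int 2 / of_int 1"
      by (rule order_trans[OF exp_le_power_quotient[of _ 4]]) (simp_all add: power_divide)
    have "dominates 1 3 2 1 (take 11 (drop 0 pp_table))"
      by code_simp
    from exp_lower_exponent_le_pp[OF _ _ A Z _ _ this, of n] show ?thesis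
      using 1 assms by (simp add: power2_eq_square)
  next
    case 2
    \<comment> \<open>The exponent 152/25 is too large for a good quotient bound, so a sixteenth of
      it is estimated and raised to the power 16. The later cases do the same.\<close>
    have "exp (19 / 50 :: real) \<le> 3657 / 2500"
      by (rule order_trans[OF exp_le_power_quotient[of _ 4]]) (simp_all add: power_divide)
    then have "exp (19 / 50 :: real) ^ 16 \<le> (3657 / 2500) ^ 16"
      by (intro power_mono) auto
    also have "(3657 / 2500 :: real) ^ 16 \<le> 440"
      by (simp add: power_divide)
    finally have A: "exp (152 / 25) \<le> real_of_int 440 / of_int 1"
      by (simp flip: exp_of_nat_mult)
    have Z: "exp (1 / (2)) \<le> real_of_int 5 / of_int 3"
      by (rule order_trans[OF exp_le_power_quotient[of _ 4]]) (simp_all add: power_divide)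
    have "dominates 440 1 5 3 (take 12 (drop 11 pp_table))"
      by code_simp
    from exp_lower_exponent_le_pp[OF _ _ A Z _ _ this, of n] show ?thesis
      using 2 assms by (simp add: power2_eq_square)
  next
    case 3
    have "exp (151 / 200 :: real) \<le> 266 / 125"
      by (rule order_trans[OF exp_le_power_quotient[of _ 16]]) (simp_all add: power_divide)
    then have "exp (151 / 200 :: real) ^ 16 \<le> (266 / 125) ^ 16"
      by (intro power_mono) auto
    also have "(266 / 125 :: real) ^ 16 \<le> 177100"
      by (simp add: power_divide)
    finally have A: "exp (302 / 25) \<le> real_of_int 177100 / of_int 1"
      by (simp flip: exp_of_nat_mult)
    have Z: "exp (1 / (5 / 2)) \<le> real_of_int 3 / of_int 2"
      by (rule order_trans[OF exp_le_power_quotient[of _ 4]]) (simp_all add: power_divide)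
    have "dominates 177100 1 3 2 (take 23 (drop 23 pp_table))"
      by code_simp
    from exp_lower_exponent_le_pp[OF _ _ A Z _ _ this, of n] show ?thesis
      using 3 assms by (simp add: power2_eq_square)
  next
    case 4
    have "exp (164 / 125 :: real) \<le> 37143 / 10000"
      by (rule order_trans[OF exp_le_power_quotient[of _ 32]]) (simp_all add: power_divide)
    then have "exp (164 / 125 :: real) ^ 16 \<le> (37143 / 10000) ^ 16"
      by (intro power_mono) auto
    also have "(37143 / 10000 :: real) ^ 16 \<le> 1314000000"
      by (simp add: power_divide)
    finally have A: "exp (2624 / 125) \<le> real_of_int 1314000000 / of_int 1"
      by (simp flip: exp_of_nat_mult)
    have Z: "exp (1 / (3)) \<le> real_of_int 7 / of_int 5"
      by (rule order_trans[OF exp_le_power_quotient[of _ 4]]) (simp_all add: power_divide)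
    have "dominates 1314000000 1 7 5 (take 40 (drop 46 pp_table))"
      by code_simp
    from exp_lower_exponent_le_pp[OF _ _ A Z _ _ this, of n] show ?thesis
      using 4 assms by (simp add: power2_eq_square)
  next
    case 5
    have "exp (1339 / 2500 :: real) \<le> 8543 / 5000"
      by (rule order_trans[OF exp_le_power_quotient[of _ 16]]) (simp_all add: power_divide)
    then have "exp (1339 / 2500 :: real) ^ 64 \<le> (8543 / 5000) ^ 64"
      by (intro power_mono) auto
    also have "(8543 / 5000 :: real) ^ 64 \<le> 775300000000000"
      by (simp add: power_divide)
    finally have A: "exp (21424 / 625) \<le> real_of_int 775300000000000 / of_int 1"
      by (simp flip: exp_of_nat_mult)
    have Z: "exp (1 / (4)) \<le> real_of_int 9 / of_int 7"
      by (rule order_trans[OF exp_le_power_quotient[of _ 4]]) (simp_all add: power_divide)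
    have "dominates 775300000000000 1 9 7 (take 80 (drop 86 pp_table))"
      by code_simp
    from exp_lower_exponent_le_pp[OF _ _ A Z _ _ this, of n] show ?thesis
      using 5 assms by (simp add: power2_eq_square)
  next
    case 6
    have "exp (861 / 1000 :: real) \<le> 23657 / 10000"
      by (rule order_trans[OF exp_le_power_quotient[of _ 32]]) (simp_all add: power_divide)
    then have "exp (861 / 1000 :: real) ^ 64 \<le> (23657 / 10000) ^ 64"
      by (intro power_mono) auto
    also have "(23657 / 10000 :: real) ^ 64 \<le> 858800000000000000000000"
      by (simp add: power_divide)
    finally have A: "exp (6888 / 125) \<le> real_of_int 858800000000000000000000 / of_int 1"
      by (simp flip: exp_of_nat_mult)
    have Z: "exp (1 / (5)) \<le> real_of_int 11 / of_int 9"
      by (rule order_trans[OF exp_le_power_quotient[of _ 4]]) (simp_all add: power_divide)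
    have "dominates 858800000000000000000000 1 11 9 (take 35 (drop 166 pp_table))"
      by code_simp
    from exp_lower_exponent_le_pp[OF _ _ A Z _ _ this, of n] show ?thesis
      using 6 assms by (simp add: power2_eq_square)
  qed
qed

section \<open>Lower bound in general\<close>

text \<open>Taking the \<open>m\<close>-th root of \<open>z\<close> reduces the claim to the
  convergence of n y^n.\<close>

lemma power_times_geometric_tendsto_0:
  fixes z :: real
  assumes "0 < z" "z < 1"
  shows "(\<lambda>n. real n ^ m * z ^ n) \<longlonglongrightarrow> 0"
proof (cases "m = 0")
  case True
  then show ?thesis using assms by (simp add: LIMSEQ_power_zero)
next
  case False
  define y where "y = root m z"
  have "norm y < 1" using assms False by (simp add: y_def)
  then have "(\<lambda>n. (real n * y ^ n) ^ m) \<longlonglongrightarrow> 0 ^ m"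
    by (intro tendsto_power powser_times_n_limit_0)
  moreover have "(real n * y ^ n) ^ m = real n ^ m * z ^ n" for n
  proof -
    have "(y ^ n) ^ m = (y ^ m) ^ n" by (simp add: mult.commute flip: power_mult)
    also have "y ^ m = z" using assms False by (simp add: y_def)
    finally show ?thesis by (simp add: power_mult_distrib)
  qed
  ultimately show ?thesis using False by (simp add: zero_power)
qed

text \<open>The partial sums telescope: the summand is \<open>z\<^sup>k p(k) - z\<^sup>k\<^sup>+\<^sup>1 p(k + 1)\<close> for the polynomial \<open>p\<close>
  with \<open>p(k) = \<Sum>\<^sub>j (k + j)\<^sup>m z\<^sup>j\<close>.\<close>

lemma sums_square_geometric:
  fixes z :: real
  assumes "0 < z" "z < 1"
  shows "(\<lambda>k. (real k)\<^sup>2 * z ^ k) sums (z * (1 + z) / (1 - z) ^ 3)"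
proof -
  define e where "e = 1 / (1 - z)"
  have e: "e * (1 - z) = 1" using assms by (simp add: e_def)
  define p where "p = (\<lambda>x. e * x\<^sup>2 + 2 * z * e\<^sup>2 * x + z * (1 + z) * e ^ 3)"
  define f where "f = (\<lambda>n. - (z ^ n * p (real n)))"
  have "(\<lambda>n. - (e * (real n ^ 2 * z ^ n) + 2 * z * e\<^sup>2 * (real n ^ 1 * z ^ n)
      + z * (1 + z) * e ^ 3 * (real n ^ 0 * z ^ n)))
      \<longlonglongrightarrow> - (e * 0 + 2 * z * e\<^sup>2 * 0 + z * (1 + z) * e ^ 3 * 0)"
    by (intro tendsto_intros power_times_geometric_tendsto_0 assms)
  then have "f \<longlonglongrightarrow> 0"
    by (simp add: f_def p_def algebra_simps)
  then have "(\<lambda>n. f (Suc n) - f n) sums (0 - f 0)"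
    by (rule telescope_sums)
  moreover have "f (Suc n) - f n = (real n)\<^sup>2 * z ^ n" for n
  proof -
    have "p x - z * p (x + 1) = x\<^sup>2" for x
      unfolding p_def using e by algebra
    from this[of "real n"] have "z ^ n * (p (real n) - z * p (real n + 1)) = z ^ n * (real n)\<^sup>2"
      by simp
    then show ?thesis by (simp add: f_def algebra_simps)
  qed
  moreover have "0 - f 0 = z * (1 + z) / (1 - z) ^ 3"
    by (simp add: f_def p_def e_def power_divide)
  ultimately show ?thesis by simp
qed

lemma sums_fourth_power_geometric:
  fixes z :: real
  assumes "0 < z" "z < 1"
  shows "(\<lambda>k. (real k) ^ 4 * z ^ k) sums (z * (1 + z) * (1 + 10 * z + z\<^sup>2) / (1 - z) ^ 5)"
proof -
  define e where "e = 1 / (1 - z)"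
  have e: "e * (1 - z) = 1" using assms by (simp add: e_def)
  define p where "p = (\<lambda>x. e * x ^ 4 + 4 * z * e\<^sup>2 * x ^ 3 + 6 * z * (1 + z) * e ^ 3 * x\<^sup>2
    + 4 * z * (1 + 4 * z + z\<^sup>2) * e ^ 4 * x + z * (1 + z) * (1 + 10 * z + z\<^sup>2) * e ^ 5)"
  define f where "f = (\<lambda>n. - (z ^ n * p (real n)))"
  have "(\<lambda>n. - (e * (real n ^ 4 * z ^ n) + 4 * z * e\<^sup>2 * (real n ^ 3 * z ^ n)
      + 6 * z * (1 + z) * e ^ 3 * (real n ^ 2 * z ^ n)
      + 4 * z * (1 + 4 * z + z\<^sup>2) * e ^ 4 * (real n ^ 1 * z ^ n)
      + z * (1 + z) * (1 + 10 * z + z\<^sup>2) * e ^ 5 * (real n ^ 0 * z ^ n)))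
      \<longlonglongrightarrow> - (e * 0 + 4 * z * e\<^sup>2 * 0 + 6 * z * (1 + z) * e ^ 3 * 0
      + 4 * z * (1 + 4 * z + z\<^sup>2) * e ^ 4 * 0 + z * (1 + z) * (1 + 10 * z + z\<^sup>2) * e ^ 5 * 0)"
    by (intro tendsto_intros power_times_geometric_tendsto_0 assms)
  moreover have "(\<lambda>n. - (e * (real n ^ 4 * z ^ n) + 4 * z * e\<^sup>2 * (real n ^ 3 * z ^ n)
      + 6 * z * (1 + z) * e ^ 3 * (real n ^ 2 * z ^ n)
      + 4 * z * (1 + 4 * z + z\<^sup>2) * e ^ 4 * (real n ^ 1 * z ^ n)
      + z * (1 + z) * (1 + 10 * z + z\<^sup>2) * e ^ 5 * (real n ^ 0 * z ^ n))) = f"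
    unfolding f_def p_def by (rule ext) (simp add: distrib_left mult_ac)
  ultimately have "f \<longlonglongrightarrow> 0"
    by simp
  then have "(\<lambda>n. f (Suc n) - f n) sums (0 - f 0)"
    by (rule telescope_sums)
  moreover have "f (Suc n) - f n = (real n) ^ 4 * z ^ n" for n
  proof -
    have "p x - z * p (x + 1) = x ^ 4" for x
      unfolding p_def using e by algebra
    from this[of "real n"] have "z ^ n * (p (real n) - z * p (real n + 1)) = z ^ n * (real n) ^ 4"
      by simp
    then show ?thesis by (simp add: f_def algebra_simps)
  qed
  moreover have "0 - f 0 = z * (1 + z) * (1 + 10 * z + z\<^sup>2) / (1 - z) ^ 5"
    by (simp add: f_def p_def e_def power_divide)
  ultimately show ?thesis by simp
qed

text \<open>The left side is the full infinite series. By the condition on \<open>N\<close> its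
  terms beyond \<open>N\<close> are nonpositive, so cutting them off can only increase the
  sum.\<close>

lemma sum_damped_square_geometric_ge:
  fixes z B :: real
  assumes z: "0 < z" "z < 1" and B: "0 \<le> B" "1 \<le> B * (real N + 1)\<^sup>2"
  shows "z * (1 + z) / (1 - z) ^ 3 - B * (z * (1 + z) * (1 + 10 * z + z\<^sup>2) / (1 - z) ^ 5)
    \<le> (\<Sum>k=1..N. (real k)\<^sup>2 * z ^ k * (1 - B * (real k)\<^sup>2))" (is "?L \<le> _")
proof -
  define w where "w k = (real k)\<^sup>2 * z ^ k * (1 - B * (real k)\<^sup>2)" for k
  have "(\<lambda>k. (real k)\<^sup>2 * z ^ k - B * ((real k) ^ 4 * z ^ k)) sums ?L"
    by (intro sums_diff sums_mult sums_square_geometric sums_fourth_power_geometric z)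
  moreover have "(real k)\<^sup>2 * z ^ k - B * ((real k) ^ 4 * z ^ k) = w k" for k
    by (simp add: w_def algebra_simps power2_eq_square power4_eq_xxxx)
  ultimately have "w sums ?L" by simp
  then have "(\<lambda>k. - w k) sums (- ?L)" by (rule sums_minus)
  have "sum (\<lambda>k. - w k) {1..N} \<le> suminf (\<lambda>k. - w k)"
  proof (rule sum_le_suminf)
    show "summable (\<lambda>k. - w k)" using \<open>(\<lambda>k. - w k) sums _\<close> by (rule sums_summable)
    fix k assume "k \<in> - {1..N}"
    then consider "k = 0" | "k \<ge> N + 1" by (auto simp: not_le)
    then show "0 \<le> - w k"
    proof cases
      case 2
      have "B * (real N + 1)\<^sup>2 \<le> B * (real k)\<^sup>2"
        using B(1) 2 by (intro mult_left_mono power_mono) auto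
      then have "(real k)\<^sup>2 * z ^ k * (1 - B * (real k)\<^sup>2) \<le> 0"
        using B(2) z by (intro mult_nonneg_nonpos mult_nonneg_nonneg) auto
      then show ?thesis by (simp add: w_def)
    qed (simp add: w_def)
  qed simp
  also have "\<dots> = - ?L"
    using \<open>(\<lambda>k. - w k) sums _\<close> by (simp add: sums_iff)
  finally show ?thesis
    by (simp add: sum_negf w_def)
qed

text \<open>A bound for (1 - x)^(2/3), whose quadratic Taylor coefficient is -1/9. The weaker -1/6
  absorbs all higher terms up to x = 2/5.\<close>

lemma two_thirds_power_ge:
  fixes r s x :: real
  assumes x: "0 \<le> x" "x \<le> 2 / 5" and s: "s > 0" and r: "r \<ge> 0" "r ^ 3 = s ^ 3 * (1 - x)"
  shows "s\<^sup>2 * (1 - 2 / 3 * x - x\<^sup>2 / 6) \<le> r\<^sup>2"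
proof -
  define w where "w = 2 / 3 * x + x\<^sup>2 / 6"
  have "x\<^sup>2 \<le> (2 / 5)\<^sup>2" using x by (intro power_mono) auto
  have c: "8 / 27 \<le> (2 / 3 + x / 6) ^ 3"
    using power_mono[of "2 / 3" "2 / 3 + x / 6" 3] x by (simp add: power3_eq_cube)
  have "0 \<le> x\<^sup>2 * (1 / 6 - 2 / 3 * x - x\<^sup>2 / 12 + x * (8 / 27))"
    using x \<open>x\<^sup>2 \<le> _\<close> by (intro mult_nonneg_nonneg) (auto simp: power2_eq_square)
  also have "\<dots> \<le> x\<^sup>2 * (1 / 6 - 2 / 3 * x - x\<^sup>2 / 12 + x * (2 / 3 + x / 6) ^ 3)"
    using c x by (intro mult_left_mono add_left_mono) auto
  also have "\<dots> = (1 - x)\<^sup>2 - (1 - w) ^ 3"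
    by (simp add: w_def power2_eq_square power3_eq_cube field_simps)
  finally have "(1 - w) ^ 3 \<le> (1 - x)\<^sup>2" by simp
  then have "(s\<^sup>2) ^ 3 * (1 - w) ^ 3 \<le> (s\<^sup>2) ^ 3 * (1 - x)\<^sup>2"
    by (intro mult_left_mono) auto
  also have "\<dots> = (s ^ 3 * (1 - x))\<^sup>2"
    by (simp add: power_mult_distrib mult.commute flip: power_mult)
  also have "\<dots> = (r\<^sup>2) ^ 3"
    unfolding r(2)[symmetric] by (simp flip: power_mult)
  finally have "(s\<^sup>2 * (1 - w)) ^ 3 \<le> (r\<^sup>2) ^ 3"
    by (simp add: power_mult_distrib)
  then have "s\<^sup>2 * (1 - w) \<le> r\<^sup>2"
    using power_le_imp_le_base[of "s\<^sup>2 * (1 - w)" 2 "r\<^sup>2"] by (simp add: numeral_3_eq_3)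
  then show ?thesis by (simp add: w_def algebra_simps)
qed

text \<open>\<open>2 * h\<close> is the slope of \<open>lower_exponent\<close> at \<open>n\<close>,
  and \<open>B\<close> bounds the quadratic term. Replacing exp (-B k^2) by 1 - B k^2 leaves sums
  with closed forms.\<close>

lemma exp_lower_exponent_diff_ge:
  assumes n: "n > 200" and k: "1 \<le> k" "k \<le> n"
  defines "s \<equiv> root 3 (real n)"
  defines "h \<equiv> 19 / (30 * s)" and "B \<equiv> 19 / (60 * s ^ 4)"
  shows "exp (lower_exponent n) * (((1 - h) / (1 + h)) ^ k * (1 - B * (real k)\<^sup>2))
    \<le> exp (lower_exponent (n - k))"
proof -
  have s3: "s ^ 3 = real n" by (simp add: s_def)
  have "s ^ 3 \<ge> (584 / 100) ^ 3" unfolding s3 using n by (simp add: power3_eq_cube)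
  then have s: "s \<ge> 584 / 100"
    using power_mono_iff[of "584 / 100" s 3] by (simp add: s_def)
  have h: "0 < h" "h < 1" using s by (auto simp: h_def)
  have z: "0 < (1 - h) / (1 + h)" using h by simp
  show ?thesis
  proof (cases "B * (real k)\<^sup>2 < 1")
    \<comment> \<open>For large \<open>k\<close> the left side is not positive. In the other case B
      k^2 < 1 forces k / n \<le> 2/5, as \<open>two_thirds_power_ge\<close> requires.\<close>
    case False
    then have "((1 - h) / (1 + h)) ^ k * (1 - B * (real k)\<^sup>2) \<le> 0"
      using z by (intro mult_nonneg_nonpos zero_le_power) auto
    then have "exp (lower_exponent n) * (((1 - h) / (1 + h)) ^ k * (1 - B * (real k)\<^sup>2)) \<le> 0"
      by (rule mult_nonneg_nonpos[OF exp_ge_zero])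
    then show ?thesis using exp_ge_zero[of "lower_exponent (n - k)"] by linarith
  next
    case True
    define x where "x = real k / s ^ 3"
    define r where "r = root 3 (real (n - k))"
    have kx: "real k = x * s ^ 3" using s by (simp add: x_def)
    have s2: "s\<^sup>2 \<ge> 34" using power_mono[OF s, of 2] by (simp add: power2_eq_square)
    have "B * (real k)\<^sup>2 = 19 / 60 * s\<^sup>2 * x\<^sup>2"
      unfolding B_def kx using s by (simp add: field_simps power2_eq_square power3_eq_cube power4_eq_xxxx)
    moreover have "19 / 60 * 34 * x\<^sup>2 \<le> 19 / 60 * s\<^sup>2 * x\<^sup>2"
      using s2 by (intro mult_right_mono) auto
    ultimately have "x\<^sup>2 \<le> (2 / 5)\<^sup>2" using True by (simp add: power2_eq_square)
    then have x: "0 \<le> x" "x \<le> 2 / 5"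
      using s power2_le_imp_le[of x "2 / 5"] by (auto simp: x_def)
    have "s\<^sup>2 * (1 - 2 / 3 * x - x\<^sup>2 / 6) \<le> r\<^sup>2"
    proof (rule two_thirds_power_ge[OF x])
      have "real (n - k) = s ^ 3 - x * s ^ 3" using k s3 kx by simp
      then show "r ^ 3 = s ^ 3 * (1 - x)" by (simp add: r_def algebra_simps)
    qed (use s in \<open>auto simp: r_def\<close>)
    then have le: "lower_exponent n + 19 / 10 * (s\<^sup>2 * (- 2 / 3 * x - x\<^sup>2 / 6)) \<le> lower_exponent (n - k)"
      unfolding lower_exponent_def r_def[symmetric] s_def[symmetric] by (simp add: algebra_simps)
    have eq: "19 / 10 * (s\<^sup>2 * (- 2 / 3 * x - x\<^sup>2 / 6)) = real k * (- (2 * h)) - B * (real k)\<^sup>2"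
      unfolding h_def B_def kx using s
      by (simp add: field_simps power2_eq_square power3_eq_cube power4_eq_xxxx)
    have "exp (lower_exponent n + (real k * (- (2 * h)) - B * (real k)\<^sup>2)) \<le> exp (lower_exponent (n - k))"
      using le unfolding eq by (simp only: exp_le_cancel_iff)
    moreover have "exp (lower_exponent n + (real k * (- (2 * h)) - B * (real k)\<^sup>2))
        = exp (lower_exponent n) * (exp (- (2 * h)) ^ k * exp (- (B * (real k)\<^sup>2)))"
      by (simp only: diff_conv_add_uminus exp_add exp_of_nat_mult)
    moreover have "((1 - h) / (1 + h)) ^ k * (1 - B * (real k)\<^sup>2) \<le> exp (- (2 * h)) ^ k * exp (- (B * (real k)\<^sup>2))"
    proof (intro mult_mono power_mono)
      show "(1 - h) / (1 + h) \<le> exp (- (2 * h))"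
        using h by (intro exp_ge_symmetric_quotient) auto
      show "1 - B * (real k)\<^sup>2 \<le> exp (- (B * (real k)\<^sup>2))"
        using exp_ge_add_one_self[of "- (B * (real k)\<^sup>2)"] by simp
    qed (use True z in auto)
    ultimately show ?thesis
      by (smt (verit) exp_gt_zero mult_left_mono)
  qed
qed

text \<open>In terms of \<open>h\<close> each summand is h^(-3) times a polynomial in
  \<open>x = h\<^sup>2\<close>. The leading terms are 1/4 from all k and 1/32 from even k, against
  the required 6859/27000, about 0.254; so 1/4 alone would fall short. The smallness of
  \<open>x\<close> controls the rest.\<close>

lemma weighted_sum_ge:
  fixes h s :: real
  assumes s: "584 / 100 \<le> s"
  defines "h \<equiv> 19 / (30 * s)" and "B \<equiv> 19 / (60 * s ^ 4)"
  defines "z \<equiv> (1 - h) / (1 + h)"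
  shows "s ^ 3 \<le> z * (1 + z) / (1 - z) ^ 3 - B * (z * (1 + z) * (1 + 10 * z + z\<^sup>2) / (1 - z) ^ 5)
    + (z\<^sup>2 * (1 + z\<^sup>2) / (1 - z\<^sup>2) ^ 3 - 4 * B * (z\<^sup>2 * (1 + z\<^sup>2) * (1 + 10 * z\<^sup>2 + (z\<^sup>2)\<^sup>2) / (1 - z\<^sup>2) ^ 5))"
proof -
  define x where "x = h\<^sup>2"
  have h: "0 < h" "h \<le> 1085 / 10000" using s by (auto simp: h_def field_simps)
  have x: "0 \<le> x" "x \<le> 118 / 10000"
    using power_mono[OF h(2), of 2] h(1) by (auto simp: x_def power2_eq_square)
  have sh: "s = 19 / (30 * h)" using s by (simp add: h_def)
  have B: "B = 13500 / 6859 * h ^ 4" unfolding B_def sh using h by (simp add: field_simps power4_eq_xxxx)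
  have h1: "1 + h \<noteq> 0" "h \<noteq> 0" using h by auto
  have zh: "z * (1 + h) = 1 - h" using h1 by (simp add: z_def)
  then have "(1 + 10 * z + z\<^sup>2) * (1 + h)\<^sup>2 = 12 - 8 * h\<^sup>2"
    "(1 + 10 * z\<^sup>2 + (z\<^sup>2)\<^sup>2) * (1 + h) ^ 4 = 12 - 8 * h\<^sup>2 + 12 * h ^ 4"
    "(1 - z\<^sup>2) * (1 + h)\<^sup>2 = 4 * h" "(1 + z\<^sup>2) * (1 + h)\<^sup>2 = 2 * (1 + h\<^sup>2)"
    by algebra+
  then have q: "1 + 10 * z + z\<^sup>2 = (12 - 8 * h\<^sup>2) / (1 + h)\<^sup>2"
    "1 + 10 * z\<^sup>2 + (z\<^sup>2)\<^sup>2 = (12 - 8 * h\<^sup>2 + 12 * h ^ 4) / (1 + h) ^ 4"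
    and z2: "1 - z\<^sup>2 = 4 * h / (1 + h)\<^sup>2" "1 + z\<^sup>2 = 2 * (1 + h\<^sup>2) / (1 + h)\<^sup>2"
    using h1 by (simp_all add: eq_divide_eq)
  have z1: "1 - z = 2 * h / (1 + h)" "1 + z = 2 / (1 + h)"
    using h1 by (simp_all add: z_def field_simps)
  define g a b c\<^sub>1 c\<^sub>2 where "g = 1 + h" and "a = 1 - h" and "b = 1 + x"
    and "c\<^sub>1 = 3 - 2 * x" and "c\<^sub>2 = 3 - 2 * x + 3 * x\<^sup>2"
  have g: "g \<noteq> 0" using h1 by (simp add: g_def)
  have ag: "1 - x = a * g" by (simp add: a_def g_def x_def power2_eq_square algebra_simps)
  have z_eq: "z = a / g" "1 - z = 2 * h / g" "1 + z = 2 / g" "1 + 10 * z + z\<^sup>2 = 4 * c\<^sub>1 / g\<^sup>2"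
    unfolding z1 q by (simp_all add: z_def a_def g_def c\<^sub>1_def x_def)
  have z2_eq: "1 - z\<^sup>2 = 4 * h / g\<^sup>2" "1 + z\<^sup>2 = 2 * b / g\<^sup>2"
    "1 + 10 * z\<^sup>2 + (z\<^sup>2)\<^sup>2 = 4 * c\<^sub>2 / g ^ 4"
    unfolding z2 q by (simp_all add: b_def g_def c\<^sub>2_def x_def)
  have T1: "z * (1 + z) / (1 - z) ^ 3 = (1 - x) / (4 * h ^ 3)"
    unfolding z_eq(2,3) unfolding z_eq(1) ag using g h1(2) by (simp add: field_simps eval_nat_numeral)
  have T2: "z * (1 + z) * (1 + 10 * z + z\<^sup>2) / (1 - z) ^ 5 = (1 - x) * (3 - 2 * x) / (4 * h ^ 5)"
    unfolding z_eq(2-4) unfolding z_eq(1) ag c\<^sub>1_def[symmetric] using g h1(2)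
    by (simp add: field_simps eval_nat_numeral)
  have T3: "z\<^sup>2 * (1 + z\<^sup>2) / (1 - z\<^sup>2) ^ 3 = (1 - x)\<^sup>2 * (1 + x) / (32 * h ^ 3)"
    unfolding z2_eq unfolding z_eq(1) ag b_def[symmetric] using g h1(2)
    by (simp add: field_simps eval_nat_numeral)
  have T4: "z\<^sup>2 * (1 + z\<^sup>2) * (1 + 10 * z\<^sup>2 + (z\<^sup>2)\<^sup>2) / (1 - z\<^sup>2) ^ 5
     = (1 - x)\<^sup>2 * (1 + x) * (3 - 2 * x + 3 * x\<^sup>2) / (128 * h ^ 5)"
    unfolding z2_eq unfolding z_eq(1) ag b_def[symmetric] c\<^sub>2_def[symmetric] using g h1(2)
    by (simp add: field_simps eval_nat_numeral)
  have a: "x * ((1 - x) * (3 - 2 * x)) \<le> x * (1 * 3)"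
    using x by (intro mult_left_mono mult_mono) auto
  have b: "1 - 2 * x \<le> (1 - x)\<^sup>2 * (1 + x)"
  proof -
    have "(1 - x)\<^sup>2 * (1 + x) - (1 - 2 * x) = x * (1 - x) + x ^ 3"
      by (simp add: power2_eq_square power3_eq_cube algebra_simps)
    also have "\<dots> \<ge> 0" using x by simp
    finally show ?thesis by simp
  qed
  have b': "(1 - x)\<^sup>2 * (1 + x) \<le> 1"
  proof -
    have "(1 - x)\<^sup>2 * (1 + x) = (1 - x) * (1 - x\<^sup>2)"
      by (simp add: power2_eq_square algebra_simps)
    also have "\<dots> \<le> 1 * 1" using x by (intro mult_mono) (auto simp: power2_eq_square mult_le_one)
    finally show ?thesis by simp
  qed
  have c: "x * ((1 - x)\<^sup>2 * (1 + x) * (3 - 2 * x + 3 * x\<^sup>2)) \<le> x * (1 * 3)"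
  proof (intro mult_left_mono mult_mono b')
    have "x * (3 * x) \<le> x * 2" using x by (intro mult_left_mono) auto
    then show "3 - 2 * x + 3 * x\<^sup>2 \<le> 3" by (simp add: power2_eq_square)
  qed (use x in auto)
  have "6859 / 27000 \<le> (1 - x) / 4 - 13500 / 6859 / 4 * (x * (1 * 3)) + (1 - 2 * x) / 32
      - 13500 / 6859 / 32 * (x * (1 * 3))"
    using x by (simp add: field_simps)
  also have "\<dots> \<le> (1 - x) / 4 - 13500 / 6859 / 4 * (x * ((1 - x) * (3 - 2 * x)))
      + ((1 - x)\<^sup>2 * (1 + x)) / 32
      - 13500 / 6859 / 32 * (x * ((1 - x)\<^sup>2 * (1 + x) * (3 - 2 * x + 3 * x\<^sup>2)))"
    by (intro add_mono diff_mono mult_left_mono divide_right_mono a b c) auto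
  finally have "6859 / 27000 / h ^ 3 \<le> ((1 - x) / 4 - 13500 / 6859 / 4 * (x * ((1 - x) * (3 - 2 * x)))
      + ((1 - x)\<^sup>2 * (1 + x)) / 32
      - 13500 / 6859 / 32 * (x * ((1 - x)\<^sup>2 * (1 + x) * (3 - 2 * x + 3 * x\<^sup>2)))) / h ^ 3"
    using h by (intro divide_right_mono) auto
  also have "\<dots> = (1 - x) / (4 * h ^ 3) - B * ((1 - x) * (3 - 2 * x) / (4 * h ^ 5))
      + ((1 - x)\<^sup>2 * (1 + x) / (32 * h ^ 3)
      - 4 * B * ((1 - x)\<^sup>2 * (1 + x) * (3 - 2 * x + 3 * x\<^sup>2) / (128 * h ^ 5)))"
  proof -
    have "13500 / 6859 * x / h ^ 3 = B / h ^ 5"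
      unfolding B x_def using h by (simp add: field_simps eval_nat_numeral)
    then have Bx: "B / h ^ 5 = 13500 / 6859 * x / h ^ 3" ..
    have B_eq: "B * (p / (4 * h ^ 5)) = 13500 / 6859 / 4 * (x * p) / h ^ 3"
      "4 * B * (p / (128 * h ^ 5)) = 13500 / 6859 / 32 * (x * p) / h ^ 3" for p
    proof -
      have "B * (p / (4 * h ^ 5)) = B / h ^ 5 * p / 4" by simp
      then show "B * (p / (4 * h ^ 5)) = 13500 / 6859 / 4 * (x * p) / h ^ 3"
        unfolding Bx by simp
      have "4 * B * (p / (128 * h ^ 5)) = B / h ^ 5 * p / 32" by simp
      then show "4 * B * (p / (128 * h ^ 5)) = 13500 / 6859 / 32 * (x * p) / h ^ 3"
        unfolding Bx by simp
    qed
    show ?thesis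
      unfolding B_eq by (simp add: diff_divide_distrib add_divide_distrib)
  qed
  also have "6859 / 27000 / h ^ 3 = s ^ 3"
    unfolding sh by (simp add: power_divide power_mult_distrib)
  finally show ?thesis
    unfolding T1 T2 T3 T4 .
qed

lemma pp_lower_bound: "exp (lower_exponent n) \<le> real (pp n)"
proof (induction n rule: less_induct)
  case (less n)
  show ?case
  proof (cases "n \<le> 200")
    case True
    then show ?thesis by (rule pp_lower_bound_small)
  next
    case False
    define s where "s = root 3 (real n)"
    define h where "h = 19 / (30 * s)"
    define B where "B = 19 / (60 * s ^ 4)"
    define z where "z = (1 - h) / (1 + h)"
    have s3: "s ^ 3 = real n" by (simp add: s_def)
    have "s ^ 3 \<ge> (584 / 100) ^ 3" unfolding s3 using False by (simp add: power3_eq_cube)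
    then have s: "s \<ge> 584 / 100"
      using power_mono_iff[of "584 / 100" s 3] by (simp add: s_def)
    have h: "0 < h" "h < 1" using s by (auto simp: h_def)
    have z: "0 < z" "z < 1" using h by (auto simp: z_def)
    have B: "0 \<le> B" using s by (simp add: B_def)
    have Bn: "B * (real n)\<^sup>2 \<ge> 1"
    proof -
      have "B * (real n)\<^sup>2 = 19 / 60 * s\<^sup>2"
        unfolding B_def s3[symmetric] using s by (simp add: field_simps power2_eq_square power3_eq_cube power4_eq_xxxx)
      moreover have "s\<^sup>2 \<ge> 34" using power_mono[OF s, of 2] by (simp add: power2_eq_square)
      ultimately show ?thesis by simp
    qed
    define m where "m k = (real k)\<^sup>2 + (if even k then (real k)\<^sup>2 / 4 else 0)" for k :: nat
    define t where "t k = z ^ k * (1 - B * (real k)\<^sup>2)" for k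
    have m_le: "m k \<le> real (sigma2 k)" if "k > 0" for k
    proof (cases "even k")
      case True
      then obtain j where j: "k = 2 * j" by (elim evenE)
      then have "real ((2 * j)\<^sup>2 + j\<^sup>2) \<le> real (sigma2 k)"
        using sigma2_ge_even[of j] that by (simp only: of_nat_le_iff)
      then show ?thesis using j True by (simp add: m_def power2_eq_square)
    next
      case False
      then show ?thesis
        using sigma2_ge[OF that] of_nat_mono[of "k\<^sup>2" "sigma2 k", where 'a = real] by (simp add: m_def)
    qed
    have "exp (lower_exponent n) * real n \<le> exp (lower_exponent n) * (\<Sum>k=1..n. m k * t k)"
    proof (rule mult_left_mono)
      have "real n \<le> z * (1 + z) / (1 - z) ^ 3 - B * (z * (1 + z) * (1 + 10 * z + z\<^sup>2) / (1 - z) ^ 5)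
        + (z\<^sup>2 * (1 + z\<^sup>2) / (1 - z\<^sup>2) ^ 3 - 4 * B * (z\<^sup>2 * (1 + z\<^sup>2) * (1 + 10 * z\<^sup>2 + (z\<^sup>2)\<^sup>2) / (1 - z\<^sup>2) ^ 5))"
        using weighted_sum_ge[OF s] unfolding s3 h_def B_def z_def by simp
      also have "\<dots> \<le> (\<Sum>k=1..n. (real k)\<^sup>2 * z ^ k * (1 - B * (real k)\<^sup>2))
        + (\<Sum>j=1..n div 2. (real j)\<^sup>2 * (z\<^sup>2) ^ j * (1 - 4 * B * (real j)\<^sup>2))"
      proof (intro add_mono sum_damped_square_geometric_ge)
        have "B * (real n)\<^sup>2 \<le> B * (real n + 1)\<^sup>2"
          using B by (intro mult_left_mono power_mono) auto
        then show "1 \<le> B * (real n + 1)\<^sup>2" using Bn by simp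
        have "n \<le> 2 * (n div 2 + 1)" by simp
        then have "real n \<le> real (2 * (n div 2 + 1))" by (simp only: of_nat_le_iff)
        then have "real n \<le> 2 * (real (n div 2) + 1)" by simp
        then have "B * (real n)\<^sup>2 \<le> B * (2 * (real (n div 2) + 1))\<^sup>2"
          using B by (intro mult_left_mono power_mono) auto
        also have "\<dots> = 4 * B * (real (n div 2) + 1)\<^sup>2"
          by (simp only: power_mult_distrib) simp
        finally show "1 \<le> 4 * B * (real (n div 2) + 1)\<^sup>2" using Bn by linarith
        show "z\<^sup>2 < 1" using z by (simp add: power_less_one_iff)
      qed (use z B in auto)
      also have "(\<Sum>j=1..n div 2. (real j)\<^sup>2 * (z\<^sup>2) ^ j * (1 - 4 * B * (real j)\<^sup>2))
        = (\<Sum>k\<in>{k\<in>{1..n}. even k}. (real k)\<^sup>2 / 4 * t k)"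
        by (rule sum.reindex_bij_witness[where i = "\<lambda>k. k div 2" and j = "\<lambda>j. 2 * j"])
          (auto simp: t_def power_mult power_mult_distrib elim!: evenE)
      also have "\<dots> = (\<Sum>k=1..n. if even k then (real k)\<^sup>2 / 4 * t k else 0)"
        by (rule sum.inter_filter) simp
      also have "(\<Sum>k=1..n. (real k)\<^sup>2 * z ^ k * (1 - B * (real k)\<^sup>2)) + \<dots> = (\<Sum>k=1..n. m k * t k)"
        by (simp add: m_def t_def distrib_right mult.assoc flip: sum.distrib)
           (intro sum.cong, auto simp: t_def)
      finally show "real n \<le> (\<Sum>k=1..n. m k * t k)" .
    qed simp
    also have "\<dots> = (\<Sum>k=1..n. m k * (exp (lower_exponent n) * t k))"
      by (simp add: sum_distrib_left mult_ac)
    also have "\<dots> \<le> (\<Sum>k=1..n. real (sigma2 k) * real (pp (n - k)))"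
    proof (rule sum_mono)
      \<comment> \<open>\<open>t k\<close> may be negative, so the bound on
        \<open>pp (n - k)\<close> is inserted before \<open>m k\<close> is replaced by the larger
        \<open>sigma2 k\<close>.\<close>
      fix k assume k: "k \<in> {1..n}"
      have "exp (lower_exponent n) * t k \<le> exp (lower_exponent (n - k))"
        using exp_lower_exponent_diff_ge[of n k] k False
        unfolding t_def z_def h_def B_def s_def by simp
      also have "\<dots> \<le> real (pp (n - k))"
        using k by (intro less.IH) auto
      finally have "exp (lower_exponent n) * t k \<le> real (pp (n - k))" .
      moreover have "0 \<le> m k" by (simp add: m_def)
      ultimately have "m k * (exp (lower_exponent n) * t k) \<le> m k * real (pp (n - k))"
        by (rule mult_left_mono)
      also have "\<dots> \<le> real (sigma2 k) * real (pp (n - k))"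
        using m_le[of k] k by (intro mult_right_mono) auto
      finally show "m k * (exp (lower_exponent n) * t k) \<le> real (sigma2 k) * real (pp (n - k))" .
    qed
    also have "\<dots> = real n * real (pp n)"
      using arg_cong[OF pp_recurrence[of n], of real] by simp
    finally show ?thesis
      using False by (simp add: mult.commute)
  qed
qed

section \<open>Monotonicity of the roots\<close>

lemma pp_pos: "pp n > 0"
  using pp_lower_bound[of n] exp_gt_zero[of "lower_exponent n"] by (simp del: exp_gt_zero)

text \<open>\<open>R\<close> bounds the ratio and \<open>t\<close> is
  \<open>lower_exponent n / n\<close>, so the claim reduces to \<open>R < exp t\<close>, which the
  quadratic Taylor polynomial of exp already shows.\<close>

lemma pp_Suc_power_less_large:
  assumes n: "n \<ge> 200"
  shows "pp (Suc n) ^ n < pp n ^ Suc n"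
proof -
  define s where "s = root 3 (real n)"
  define u where "u = 1 / s"
  have s3: "s ^ 3 = real n" by (simp add: s_def)
  have "s ^ 3 \<ge> (584 / 100) ^ 3" unfolding s3 using n by (simp add: power3_eq_cube)
  then have s: "s \<ge> 584 / 100"
    using power_mono_iff[of "584 / 100" s 3] by (simp add: s_def)
  have u: "0 < u" "u \<le> 1713 / 10000" using s by (auto simp: u_def field_simps)
  define R where "R = 1 + 1.8042 * u + 1.2917 * u\<^sup>2 + 1.1 * u ^ 3"
  define t where "t = 19 / 10 * u - 7 / 2 * u ^ 3"
  have u2: "u\<^sup>2 \<le> (1713 / 10000)\<^sup>2" using u by (intro power_mono) auto
  have u3: "u ^ 3 \<le> u * (1713 / 10000)\<^sup>2"
    using mult_left_mono[OF u2, of u] u by (simp add: power2_eq_square power3_eq_cube)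
  have t0: "0 \<le> t"
    unfolding t_def using u u3 by (simp add: power2_eq_square)
  \<comment> \<open>The gap 1.9 - 1.8042 gives the 9/100. At u = 0.1713, which corresponds to n
    about 200, the second factor is below 0.01.\<close>
  have "0 < u * (9 / 100 + 51 / 100 * u - 46 / 10 * u\<^sup>2 - 665 / 100 * u ^ 3)"
  proof (rule mult_pos_pos)
    have "u\<^sup>2 \<le> 1713 / 10000 * u" using u by (simp add: power2_eq_square)
    moreover have "u ^ 3 \<le> 2935 / 100000 * u" using u3 u by (simp add: power2_eq_square)
    ultimately show "0 < 9 / 100 + 51 / 100 * u - 46 / 10 * u\<^sup>2 - 665 / 100 * u ^ 3"
      using u by linarith
  qed (rule u)
  also have "\<dots> \<le> 1 + t + t\<^sup>2 / 2 - R"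
  proof -
    have "1 + t + t\<^sup>2 / 2 - R - u * (9 / 100 + 51 / 100 * u - 46 / 10 * u\<^sup>2 - 665 / 100 * u ^ 3)
       = (19 / 10 - 1.8042 - 9 / 100) * u + (361 / 200 - 1.2917 - 51 / 100) * u\<^sup>2 + 49 / 8 * (u ^ 3)\<^sup>2"
      unfolding t_def R_def by (simp add: field_simps eval_nat_numeral)
    also have "\<dots> \<ge> 0" using u by (intro add_nonneg_nonneg mult_nonneg_nonneg) auto
    finally show ?thesis by simp
  qed
  also have "1 + t + t\<^sup>2 / 2 \<le> exp t"
    using t0 by (rule exp_lower_Taylor_quadratic)
  finally have "R < exp t" by simp
  moreover have R0: "0 \<le> R" using u by (simp add: R_def)
  ultimately have "R ^ n < exp t ^ n"
    using n by (intro power_strict_mono) auto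
  also have "exp t ^ n = exp (lower_exponent n)"
  proof -
    have "real n * t = lower_exponent n"
    proof -
      have L: "lower_exponent n = 19 / 10 * s\<^sup>2 - 7 / 2" by (simp add: lower_exponent_def s_def)
      show ?thesis
        unfolding L t_def u_def s3[symmetric] using s
        by (simp add: field_simps power2_eq_square power3_eq_cube)
    qed
    then show ?thesis by (simp flip: exp_of_nat_mult)
  qed
  also have "\<dots> \<le> real (pp n)" by (rule pp_lower_bound)
  finally have "R ^ n < real (pp n)" .
  have "real (pp (Suc n)) ^ n \<le> (R * real (pp n)) ^ n"
    using pp_ratio_le[OF n] unfolding R_def u_def s_def by (intro power_mono) auto
  also have "\<dots> = R ^ n * real (pp n) ^ n" by (rule power_mult_distrib)
  also have "\<dots> < real (pp n) * real (pp n) ^ n"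
    using \<open>R ^ n < real (pp n)\<close> pp_pos[of n] by (intro mult_strict_right_mono) auto
  finally have "real (pp (Suc n) ^ n) < real (pp n ^ Suc n)" by simp
  then show ?thesis by (simp only: of_nat_less_iff)
qed

fun log_concave :: "int list \<Rightarrow> bool" where
  "log_concave (a # b # c # xs) \<longleftrightarrow> a * c \<le> b * b \<and> log_concave (b # c # xs)"
| "log_concave _ \<longleftrightarrow> True"

lemma log_concave_nth:
  "log_concave xs \<Longrightarrow> Suc (Suc i) < length xs \<Longrightarrow> xs ! i * xs ! Suc (Suc i) \<le> xs ! Suc i * xs ! Suc i"
proof (induction xs arbitrary: i rule: log_concave.induct)
  case (1 a b c xs)
  then show ?case by (cases i) auto
qed auto

text \<open>Log-concavity does not hold from the beginning: \<open>pp 10 * pp 12\<close> = 500 *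
  1479 exceeds the square of \<open>pp 11\<close> = 859.\<close>

lemma pp_log_concave:
  assumes "12 \<le> n" "n \<le> 199"
  shows "pp n * pp (Suc (Suc n)) \<le> pp (Suc n) * pp (Suc n)"
proof -
  obtain i where i: "n = 12 + i" using assms(1) le_Suc_ex by blast
  have "log_concave (drop 12 pp_table)"
    by code_simp
  from log_concave_nth[OF this, of i]
  have "int (pp n) * int (pp (Suc (Suc n))) \<le> int (pp (Suc n)) * int (pp (Suc n))"
    using assms i by (simp add: pp_table_length pp_table_correct)
  then show ?thesis by (simp only: of_nat_mult[symmetric] of_nat_le_iff)
qed

text \<open>At n = 5 the inequality is false, since 48^5 > 24^6.\<close>

lemma pp_Suc_power_less_tiny:
  assumes "6 \<le> n" "n \<le> 12"
  shows "pp (Suc n) ^ n < pp n ^ Suc n"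
proof -
  have "take 8 (drop 6 pp_table) = [48, 86, 160, 282, 500, 859, 1479, 2485]"
    by code_simp
  then have "pp_table ! (6 + i) = [48, 86, 160, 282, 500, 859, 1479, 2485] ! i" if "i < 8" for i
    using that pp_table_length by (metis nth_drop nth_take le_add2 add_leD1 numeral_le_iff semiring_norm)
  from this[of 0] this[of 1] this[of 2] this[of 3] this[of 4] this[of 5] this[of 6] this[of 7]
  have v: "pp 6 = 48" "pp 7 = 86" "pp 8 = 160" "pp 9 = 282" "pp 10 = 500" "pp 11 = 859"
    "pp 12 = 1479" "pp 13 = 2485"
    by (simp_all add: pp_table_correct)
  consider "n = 6" | "n = 7" | "n = 8" | "n = 9" | "n = 10" | "n = 11" | "n = 12"
    using assms by linarith
  then show ?thesis
    by cases (simp_all add: v)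
qed

text \<open>For consecutive values a, b, c with a c \<le> b^2, raising to the power n + 1 and
  inserting b^n < a^(n + 1) cancels a and leaves c^(n + 1) < b^(n + 2).\<close>

lemma pp_Suc_power_less_medium:
  assumes "12 \<le> n" "n \<le> 200"
  shows "pp (Suc n) ^ n < pp n ^ Suc n"
  using assms
proof (induction n rule: dec_induct)
  case base
  then show ?case using pp_Suc_power_less_tiny[of 12] by simp
next
  case (step n)
  let ?a = "pp n" and ?b = "pp (Suc n)" and ?c = "pp (Suc (Suc n))"
  have "(?a * ?c) ^ Suc n \<le> (?b * ?b) ^ Suc n"
    using pp_log_concave[of n] step by (intro power_mono) auto
  also have "\<dots> = ?b ^ n * ?b ^ Suc (Suc n)"
    by (simp add: power_mult_distrib)
  also have "\<dots> < ?a ^ Suc n * ?b ^ Suc (Suc n)"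
    using step pp_pos[of "Suc n"] by (intro mult_strict_right_mono zero_less_power) auto
  finally have "?a ^ Suc n * ?c ^ Suc n < ?a ^ Suc n * ?b ^ Suc (Suc n)"
    by (simp only: power_mult_distrib)
  then show ?case
    by (simp only: mult_less_cancel1)
qed

lemma pp_Suc_power_less: "6 \<le> n \<Longrightarrow> pp (Suc n) ^ n < pp n ^ Suc n"
  using pp_Suc_power_less_tiny pp_Suc_power_less_medium pp_Suc_power_less_large
  by (metis linorder_le_cases)

lemma root_pp_Suc_less:
  assumes "6 \<le> n"
  shows "root (Suc n) (real (pp (Suc n))) < root n (real (pp n))"
proof (rule power_less_imp_less_base)
  let ?y = "root (Suc n) (real (pp (Suc n)))" and ?x = "root n (real (pp n))"
  have "?y ^ (Suc n * n) = real (pp (Suc n) ^ n)"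
    by (simp only: power_mult) (simp add: real_root_pow_pos2 del: power_Suc)
  also have "\<dots> < real (pp n ^ Suc n)"
    using pp_Suc_power_less[OF assms] by (simp only: of_nat_less_iff)
  also have "\<dots> = (?x ^ n) ^ Suc n"
    using assms by (simp add: real_root_pow_pos2 del: power_Suc)
  also have "\<dots> = ?x ^ (Suc n * n)"
    by (simp only: power_mult[symmetric] mult.commute)
  finally show "?y ^ (Suc n * n) < ?x ^ (Suc n * n)" .
qed (use assms in simp)

lemma root_pp_strict_antimono: "strict_antimono_on {6..} (\<lambda>n. root n (real (pp n)))"
proof (rule monotone_onI)
  fix m n :: nat
  assume "m \<in> {6..}" "m < n"
  then show "root n (real (pp n)) < root m (real (pp m))"
  proof (induction n)
    case (Suc n)
    then have "root (Suc n) (real (pp (Suc n))) < root n (real (pp n))"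
      by (intro root_pp_Suc_less) auto
    then show ?case
      using Suc by (cases "m = n") (auto simp: less_Suc_eq)
  qed simp
qed

theorem theorem1p4:
  shows "((\<lambda>m. inverse ((1 - fps_X ^ Suc m) ^ Suc m) :: real fps)
           has_prod Abs_fps (\<lambda>n. real (pp n))) \<and>
         strict_antimono_on {6..} (\<lambda>n. root n (real (pp n)))"
  using has_prod_macmahon root_pp_strict_antimono by blast

end
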